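(* Let $p$ be an odd prime, let $F/\mathbb{Q}$ be a cyclic extension of degree $p$, let $K=\mathbb{Q}(\zeta_p)$ and $L=FK$, with $\Phi$, $I_i(x)$ and $\chi$ as defined in the context. Let $x\in L^{*}$ with $\mathrm{N}_{L/\mathbb{Q}}(x)=\pm q_1^{l_1}\cdots q_n^{l_n}$, where $n\ge 1$, $l_i\in\mathbb{Z}\setminus\{0\}$ and the $q_i$ are distinct rational primes. Suppose that there exists an $i$ such that $q_i$ splits completely in $L$ and $p$ does not divide $\chi(I_i(x))$. Then $\Phi(\mathrm{N}_{L/K}(x))\notin (L^{*})^{p}$ and $\Phi(\zeta_p\mathrm{N}_{L/K}(x))\notin (L^{*})^{p}$.
   Context: $\zeta_p$ is a fixed primitive $p$-th root of unity and all fields lie in a fixed algebraic closure of $\mathbb{Q}$. $\mathcal{O}_N$ denotes the ring of integers of a number field $N$, and $(L^* )^p$ is the group of $p$-th powers of elements of $L^*$. Let $\bar\tau$ be a fixed generator of $\mathrm{Gal}(L/F)$; its restriction $\tau=\bar\tau|_K$ generates $\mathrm{Gal}(K/\mathbb{Q})$ (cyclic of order $p-1$). Let $e$ be a primitive root modulo $p$. The homomorphism $\Phi:L^*\to L^*$ is $$\Phi(y)=\prod_{j=0}^{p-2}\bar\tau^{j}(y)^{e^{p-2-j}}=y^{e^{p-2}}\,\bar\tau(y)^{e^{p-3}}\cdots\bar\tau^{p-2}(y).$$ For $x$ as in the claim, $J_i(x)$ denotes the part of the fractional ideal $\mathcal{O}_Lx$ composed of the prime ideals of $\mathcal{O}_L$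 lying above $q_i$; then $\mathrm{N}_{L/\mathbb{Q}}(J_i(x))=\mathbb{Z}q_i^{l_i}$. Put $I_i(x)=\mathrm{N}_{L/K}(J_i(x))$ (ideal norm), a fractional ideal of $K$ with $\mathrm{N}_{K/\mathbb{Q}}(I_i(x))=\mathbb{Z}q_i^{l_i}$. If $q_i$ splits completely in $K$, let $P_1,\dots,P_{p-1}$ be the distinct prime ideals of $\mathcal{O}_K$ above $q_i$, numbered so that $\tau(P_j)=P_{j+1}$ for $1\le j\le p-2$ and $\tau(P_{p-1})=P_1$. Writing $I_i(x)=P_1^{\beta_1}\cdots P_{p-1}^{\beta_{p-1}}$ with $\beta_j\in\mathbb{Z}$, define $$\chi(I_i(x))=e^{p-2}\beta_1+e^{p-3}\beta_{p-1}+e^{p-4}\beta_{p-2}+\cdots+e\beta_3+\beta_2 .$$ Whether $p$ divides $\chi(I_i(x))$ does not depend on the choice of $P_1$. *)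

theory Defs
  imports
    Complex_Main
    "HOL-Computational_Algebra.Polynomial"
    "HOL-Number_Theory.Residue_Primitive_Roots"
    "HOL-Algebra.Bij"
    "HOL-Algebra.QuotRing"
    "HOL-Algebra.Ideal_Product"
    "HOL-Algebra.Generated_Fields"
    "HOL-Algebra.Embedded_Algebras"
    "HOL-Algebra.Elementary_Groups"
begin

text \<open>
  All number fields are subfields of the complex numbers, represented by their carrier sets;
  finite extensions of \<^term>\<open>\<rat>\<close> inside the complex numbers lie in the algebraic closure of
  \<^term>\<open>\<rat>\<close> there.
\<close>

definition complex_ring :: "complex ring" where
  "complex_ring = \<lparr>carrier = UNIV, mult = (*), one = 1, zero = 0, add = (+)\<rparr>"

abbreviation subring_of :: "complex set \<Rightarrow> complex ring" where
  "subring_of A \<equiv> complex_ring\<lparr>carrier := A\<rparr>"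


subsection \<open>Field extensions and Galois groups\<close>

definition degree_ext :: "complex set \<Rightarrow> complex set \<Rightarrow> nat" where
  "degree_ext K L = ring.dim complex_ring K L"

definition gal_group :: "complex set \<Rightarrow> complex set \<Rightarrow> (complex \<Rightarrow> complex) monoid" where
  "gal_group K L = (BijGroup L)
     \<lparr>carrier := {s \<in> Bij L. s \<in> ring_iso (subring_of L) (subring_of L) \<and> (\<forall>a\<in>K. s a = a)}\<rparr>"

definition finite_galois_ext :: "complex set \<Rightarrow> complex set \<Rightarrow> bool" where
  "finite_galois_ext K L \<longleftrightarrow>
     subfield K complex_ring \<and> subfield L complex_ring \<and> K \<subseteq> L \<and>
     ring.finite_dimension complex_ring K L \<and>
     {y \<in> L. \<forall>s \<in> carrier (gal_group K L). s y = y} = K"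

definition cyclic_ext :: "complex set \<Rightarrow> complex set \<Rightarrow> bool" where
  "cyclic_ext K L \<longleftrightarrow> finite_galois_ext K L \<and> cyclic_group (gal_group K L)"

definition embeddings :: "complex set \<Rightarrow> complex set \<Rightarrow> (complex \<Rightarrow> complex) set" where
  "embeddings K L =
     {s \<in> extensional L. s \<in> ring_hom (subring_of L) complex_ring \<and> (\<forall>a\<in>K. s a = a)}"

text \<open>The norm of a finite (separable) extension is the product of the conjugates.\<close>

definition field_norm :: "complex set \<Rightarrow> complex set \<Rightarrow> complex \<Rightarrow> complex" where
  "field_norm K L y = (\<Prod>s\<in>embeddings K L. s y)"

definition primitive_root_of_unity :: "nat \<Rightarrow> complex \<Rightarrow> bool" where
  "primitive_root_of_unity p z \<longleftrightarrow> z ^ p = 1 \<and> (\<forall>k. 0 < k \<and> k < p \<longrightarrow> z ^ k \<noteq> 1)"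


subsection \<open>Rings of integers and fractional ideals\<close>

definition ints_of :: "complex set \<Rightarrow> complex set" where
  "ints_of L = {y \<in> L. algebraic_int y}"

definition fractional_ideal :: "complex set \<Rightarrow> complex set \<Rightarrow> bool" where
  "fractional_ideal L I \<longleftrightarrow>
     I \<subseteq> L \<and> I \<noteq> {0} \<and> subalgebra (ints_of L) I complex_ring \<and>
     (\<exists>d \<in> ints_of L - {0}. \<forall>y\<in>I. d * y \<in> ints_of L)"

definition ideal_group :: "complex set \<Rightarrow> complex set monoid" where
  "ideal_group L = \<lparr>carrier = {I. fractional_ideal L I},
                    mult = ideal_prod complex_ring,
                    one = ints_of L\<rparr>"

definition principal_ideal :: "complex set \<Rightarrow> complex \<Rightarrow> complex set" where
  "principal_ideal L y = (\<lambda>a. a * y) ` ints_of L"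

definition prime_ideals :: "complex set \<Rightarrow> complex set set" where
  "prime_ideals L = {P. primeideal P (subring_of (ints_of L)) \<and> P \<noteq> {0}}"

definition primes_above :: "complex set \<Rightarrow> complex set \<Rightarrow> complex set \<Rightarrow> complex set set" where
  "primes_above K L Q = {P \<in> prime_ideals L. P \<inter> ints_of K = Q}"

abbreviation primes_above_nat :: "complex set \<Rightarrow> nat \<Rightarrow> complex set set" where
  "primes_above_nat L q \<equiv> primes_above \<rat> L (principal_ideal \<rat> (of_nat q))"

text \<open>
  The family of exponents in the factorization of a fractional ideal into prime ideals, which
  exists and is unique when \<^term>\<open>L\<close> is a number field.
\<close>

definition ideal_exponent :: "complex set \<Rightarrow> complex set \<Rightarrow> complex set \<Rightarrow> int" where
  "ideal_exponent L I =
     (THE a. finite {P. a P \<noteq> 0} \<and> {P. a P \<noteq> 0} \<subseteq> prime_ideals L \<and>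
             I = finprod (ideal_group L) (\<lambda>P. P [^]\<^bsub>ideal_group L\<^esub> (a P :: int)) {P. a P \<noteq> 0})"

text \<open>
  The degree of the residue field of \<^term>\<open>P\<close> over the image in it of the ring of integers of
  \<^term>\<open>K\<close>.
\<close>

definition residue_degree :: "complex set \<Rightarrow> complex set \<Rightarrow> complex set \<Rightarrow> nat" where
  "residue_degree K L P =
     (let R = subring_of (ints_of L)
      in ring.dim (R Quot P) ((\<lambda>a. P +>\<^bsub>R\<^esub> a) ` ints_of K) (carrier (R Quot P)))"

text \<open>
  The ideal norm is the multiplicative map that sends a prime ideal \<^term>\<open>P\<close> with residue degree
  \<^term>\<open>f\<close> to the \<^term>\<open>f\<close>-th power of the prime ideal below it.
\<close>

definition ideal_norm :: "complex set \<Rightarrow> complex set \<Rightarrow> complex set \<Rightarrow> complex set" where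
  "ideal_norm K L J =
     finprod (ideal_group K)
       (\<lambda>P. (P \<inter> ints_of K) [^]\<^bsub>ideal_group K\<^esub> (int (residue_degree K L P) * ideal_exponent L J P))
       {P \<in> prime_ideals L. ideal_exponent L J P \<noteq> 0}"

definition splits_completely :: "complex set \<Rightarrow> nat \<Rightarrow> bool" where
  "splits_completely L q \<longleftrightarrow> card (primes_above_nat L q) = degree_ext \<rat> L"


subsection \<open>The ideals, the integer and the homomorphism attached to an element\<close>

definition J_part :: "complex set \<Rightarrow> nat \<Rightarrow> complex \<Rightarrow> complex set" where
  "J_part L q x =
     finprod (ideal_group L)
       (\<lambda>P. P [^]\<^bsub>ideal_group L\<^esub> ideal_exponent L (principal_ideal L x) P)
       (primes_above_nat L q)"

definition I_part :: "complex set \<Rightarrow> complex set \<Rightarrow> nat \<Rightarrow> complex \<Rightarrow> complex set" where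
  "I_part K L q x = ideal_norm K L (J_part L q x)"

definition prime_numbering ::
    "nat \<Rightarrow> complex set \<Rightarrow> (complex \<Rightarrow> complex) \<Rightarrow> nat \<Rightarrow> (nat \<Rightarrow> complex set) \<Rightarrow> bool" where
  "prime_numbering p K t q P \<longleftrightarrow>
     bij_betw P {1..p-1} (primes_above_nat K q) \<and>
     (\<forall>j\<in>{1..p-2}. t ` P j = P (j + 1)) \<and> t ` P (p - 1) = P 1"

text \<open>
  For \<open>j \<ge> 2\<close> the exponent of \<open>P j\<close> has the coefficient \<open>e ^ (j - 2)\<close>: the coefficients of the
  exponents at \<open>P 1, P (p - 1), P (p - 2), \<dots>, P 3, P 2\<close> are \<open>e ^ (p - 2), e ^ (p - 3), \<dots>, e, 1\<close>.
  The ideal \<open>I\<close> is meant to be a product of powers of the ideals \<open>P j\<close>.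
\<close>

definition chi :: "nat \<Rightarrow> nat \<Rightarrow> complex set \<Rightarrow> (nat \<Rightarrow> complex set) \<Rightarrow> complex set \<Rightarrow> int" where
  "chi p e K P I =
     (let b = (\<lambda>j. ideal_exponent K I (P j))
      in int e ^ (p - 2) * b 1 + (\<Sum>j=2..p-1. int e ^ (j - 2) * b j))"

definition Phi :: "nat \<Rightarrow> nat \<Rightarrow> (complex \<Rightarrow> complex) \<Rightarrow> complex \<Rightarrow> complex" where
  "Phi p e s y = (\<Prod>j=0..p-2. ((s ^^ j) y) ^ (e ^ (p - 2 - j)))"

definition nonzero_powers :: "complex set \<Rightarrow> nat \<Rightarrow> complex set" where
  "nonzero_powers L p = {z ^ p | z. z \<in> L - {0}}"

end

theory Submission
  imports Defs "Jordan_Normal_Form.Char_Poly"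
begin

text \<open>
  Let \<open>v\<close> be the valuation of a prime of \<open>L\<close> above \<open>P 1\<close>, and \<open>y = N x\<close> the norm from \<open>L\<close> to \<open>K\<close>.
  The conjugates of \<open>v\<close> under the powers of \<open>\<sigma>\<close> lie above the successive \<open>P j\<close>, so \<open>v (\<Phi> y)\<close> is the
  combination of the valuations of \<open>y\<close> at primes above the \<open>P j\<close> with the coefficients of \<open>\<chi>\<close>. Since
  \<open>q\<close> splits completely, the embeddings of \<open>L\<close> over \<open>K\<close> permute the primes of \<open>L\<close> above \<open>P j\<close> simply
  transitively; hence the valuation of \<open>y\<close> at any of them is the sum of the valuations of \<open>x\<close> at all
  of them, which is the exponent of \<open>P j\<close> in the ideal norm because all residue degrees are 1. So
  \<open>v (\<Phi> y) = \<chi>\<close>, and the root of unity \<open>\<zeta>\<close> does not change this. If \<open>\<Phi> y = z\<^sup>p\<close>, then \<open>p\<close> divides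
  \<open>\<chi>\<close>.

  Transitivity uses that an element of \<open>L\<close> fixed by all embeddings over \<open>K\<close> lies in \<open>K\<close>. The numbering
  of the \<open>P j\<close> shows that \<open>\<zeta>\<close> has \<open>p - 1\<close> conjugates under \<open>\<sigma>\<close>, so that \<open>1, \<zeta>, \<dots>, \<zeta>\<^sup>p\<^sup>-\<^sup>2\<close> are
  independent over \<open>F\<close> and every automorphism of \<open>F\<close> extends to \<open>L\<close> with \<open>\<zeta>\<close> fixed.
\<close>

section \<open>Algebraic integers\<close>

text \<open>Complete splitting of \<open>q\<close> is given only as a number of primes. It enters
  through one counting argument, \<open>split_approximation\<close>: modulo every power of a prime
  above \<open>q\<close>, an algebraic integer agrees with a fraction whose denominator is prime to
  \<open>q\<close>. That density statement yields both residue degree 1 and the fact that no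
  nontrivial automorphism fixes such a prime, so neither the sum formula for ramification indices
  and residue degrees nor decomposition groups are developed.

  Finiteness has a single source as well: inside a finite-dimensional rational space, only finitely
  many subgroups lie between \<open>m A\<close> and \<open>A\<close>. Applied to rings of integers
  and to \<open>\<O>[1/x]\<close>, it replaces integral bases and discriminants: chains of ideals
  repeat, so primes are maximal, almost integral elements are integral and ideals factor.

  A number field is therefore carried as a subfield with a finite set \<open>B\<close> whose
  rational span contains it. \<open>B\<close> need be neither a basis nor a subset of the field, so
  one set serves \<open>L\<close>, \<open>K\<close> and fixed subfields. Its size matters only where
  splitting is used: there it must not exceed the number of primes above \<open>q\<close>.\<close>

interpretation zm: Modules.module "\<lambda>(c::int) (x::complex). of_int c * x"
  by unfold_locales (auto simp: algebra_simps)

lemma int_span_mult: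
  assumes "\<And>a b. a \<in> A \<Longrightarrow> b \<in> B \<Longrightarrow> a * b \<in> zm.span C"
    and "x \<in> zm.span A" "y \<in> zm.span B"
  shows "x * y \<in> zm.span C"
proof -
  have *: "a * y \<in> zm.span C" if "a \<in> A" for a
    using assms(3)
  proof (induction rule: zm.span_induct_alt)
    case base show ?case by (simp add: zm.span_zero)
  next
    case (step c b z)
    have "of_int c * (a * b) + a * z \<in> zm.span C"
      by (intro zm.span_add zm.span_scale step assms(1) that)
    thus ?case by (simp add: algebra_simps)
  qed
  show ?thesis using assms(2)
  proof (induction rule: zm.span_induct_alt)
    case base show ?case by (simp add: zm.span_zero)
  next
    case (step c a z)
    have "of_int c * (a * y) + z * y \<in> zm.span C"
      by (intro zm.span_add zm.span_scale step *)
    thus ?case by (simp add: algebra_simps)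
  qed
qed

text \<open>The determinant trick: the eigenvalue equation exhibits the number as a root of the
  characteristic polynomial of an integer matrix.\<close>

lemma algebraic_int_if_stabilizes_span:
  fixes x :: complex
  assumes fin: "finite B" and nz: "\<exists>b\<in>B. b \<noteq> 0" and st: "\<And>b. b \<in> B \<Longrightarrow> x * b \<in> zm.span B"
  shows "algebraic_int x"
proof -
  define n where "n = card B"
  obtain f where f: "bij_betw f {0..<n} B"
    using ex_bij_betw_nat_finite[OF fin] by (auto simp: n_def)
  have "\<exists>c. x * b = (\<Sum>v\<in>B. of_int (c v) * v)" if "b \<in> B" for b
    using st[OF that] by (auto simp: zm.span_finite[OF fin])
  then obtain c where c: "\<And>b. b \<in> B \<Longrightarrow> x * b = (\<Sum>v\<in>B. of_int (c b v) * v)"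
    by metis
  define A :: "int mat" where "A = mat n n (\<lambda>(i, j). c (f i) (f j))"
  define A' :: "complex mat" where "A' = map_mat of_int A"
  define v where "v = vec n f"
  have A: "A \<in> carrier_mat n n" and A': "A' \<in> carrier_mat n n"
    by (simp_all add: A_def A'_def)
  have "A' *\<^sub>v v = x \<cdot>\<^sub>v v"
  proof (rule eq_vecI)
    fix i assume "i < dim_vec (x \<cdot>\<^sub>v v)"
    hence i: "i < n" by (simp add: v_def)
    hence "f i \<in> B" using f by (auto simp: bij_betw_def)
    have "(A' *\<^sub>v v) $ i = (\<Sum>j\<in>{0..<n}. of_int (c (f i) (f j)) * f j)"
      using i by (simp add: A'_def A_def v_def scalar_prod_def)
    also have "\<dots> = (\<Sum>b\<in>B. of_int (c (f i) b) * b)"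
      using sum.reindex_bij_betw[OF f, of "\<lambda>b. of_int (c (f i) b) * b"] by simp
    also have "\<dots> = x * f i" using c[OF \<open>f i \<in> B\<close>] by simp
    finally show "(A' *\<^sub>v v) $ i = (x \<cdot>\<^sub>v v) $ i" using i by (simp add: v_def)
  qed (use A' in \<open>simp add: v_def\<close>)
  moreover have "v \<noteq> 0\<^sub>v n"
  proof
    assume v0: "v = 0\<^sub>v n"
    have "f i = 0" if "i < n" for i
      using arg_cong[OF v0, of "\<lambda>w. w $ i"] that by (simp add: v_def)
    with nz f show False by (auto simp: bij_betw_def)
  qed
  ultimately have "eigenvalue A' x"
    using A' unfolding eigenvalue_def eigenvector_def by (intro exI[of _ v]) (simp add: v_def)
  hence "poly (char_poly A') x = 0" using eigenvalue_root_char_poly[OF A'] by simp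
  moreover have "char_poly A' = map_poly of_int (char_poly A)"
    unfolding A'_def by (rule of_int_hom.char_poly_hom[OF A])
  moreover have "lead_coeff (char_poly A) = 1"
    using degree_monic_char_poly[OF A] by simp
  ultimately show ?thesis by (auto simp: algebraic_int_altdef_ipoly)
qed

text \<open>Closure under addition is implicit in being a span. Finite generation as an additive
  group is the working criterion for integrality: all elements of such a ring are algebraic
  integers, and finitely many algebraic integers lie in a common one.\<close>

definition finite_int_ring :: "complex set \<Rightarrow> bool" where
  "finite_int_ring R \<longleftrightarrow> 1 \<in> R \<and> (\<forall>x\<in>R. \<forall>y\<in>R. x * y \<in> R) \<and> (\<exists>B. finite B \<and> R = zm.span B)"

lemma finite_int_ring_mult: "finite_int_ring R \<Longrightarrow> x \<in> R \<Longrightarrow> y \<in> R \<Longrightarrow> x * y \<in> R"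
  by (auto simp: finite_int_ring_def)

lemma finite_int_ring_add: "finite_int_ring R \<Longrightarrow> x \<in> R \<Longrightarrow> y \<in> R \<Longrightarrow> x + y \<in> R"
  by (auto simp: finite_int_ring_def intro: zm.span_add)

lemma finite_int_ring_Ints:
  assumes "finite_int_ring R" "x \<in> \<int>"
  shows "x \<in> R"
proof -
  obtain k where "x = of_int k" using assms(2) by (auto elim: Ints_cases)
  moreover have "of_int k * 1 \<in> R"
    using assms(1) unfolding finite_int_ring_def by (metis zm.span_scale)
  ultimately show ?thesis by simp
qed

lemma algebraic_int_if_in_finite_int_ring:
  assumes R: "finite_int_ring R" and x: "x \<in> R"
  shows "algebraic_int x"
proof -
  obtain B where B: "finite B" "R = zm.span B" using R by (auto simp: finite_int_ring_def)
  have "\<exists>b\<in>B. b \<noteq> 0"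
  proof (rule ccontr)
    assume "\<not> (\<exists>b\<in>B. b \<noteq> 0)"
    hence "B \<subseteq> {0}" by auto
    hence "zm.span B \<subseteq> zm.span {0}" by (rule zm.span_mono)
    moreover have "zm.span {0} = {0}" by (auto simp: zm.span_singleton)
    ultimately have "1 \<in> {0::complex}" using R B by (auto simp: finite_int_ring_def)
    thus False by simp
  qed
  moreover have "x * b \<in> zm.span B" if "b \<in> B" for b
    using finite_int_ring_mult[OF R x, of b] that B by (auto intro: zm.span_base)
  ultimately show ?thesis by (intro algebraic_int_if_stabilizes_span[OF B(1)])
qed

text \<open>The monic equation rewrites \<open>y ^ d\<close> through lower powers, so the products
  of generators of \<open>R\<close> with \<open>y ^ i\<close> for \<open>i < d\<close> generate
  \<open>R[y]\<close> additively.\<close>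

lemma finite_int_ring_adjoin:
  assumes R: "finite_int_ring R" and p: "lead_coeff p = 1" "\<And>i. poly.coeff p i \<in> R" "poly p y = 0"
  shows "\<exists>R'. finite_int_ring R' \<and> R \<subseteq> R' \<and> y \<in> R'"
proof -
  obtain B where B: "finite B" "R = zm.span B" using R by (auto simp: finite_int_ring_def)
  define d where "d = Polynomial.degree p"
  have d: "d > 0"
  proof (rule ccontr)
    assume "\<not> d > 0"
    hence "p = 1" using p(1) by (metis d_def degree_0_id lead_coeff_1 monom_eq_1 neq0_conv poly_monom one_poly_eq_simps(1) pCons_one degree_eq_zeroE lead_coeff_pCons(2))
    thus False using p(3) by simp
  qed
  define C where "C = (\<lambda>(b, i). b * y ^ i) ` (B \<times> {..<d})"
  define R' where "R' = zm.span C"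
  have finC: "finite C" by (simp add: C_def B)
  \<comment> \<open>The factor \<open>r\<close> is arbitrary in the induction on \<open>i\<close>,
    since each reduction of \<open>y ^ d\<close> multiplies it by a coefficient of
    \<open>p\<close>.\<close>
  have mono: "r * y ^ i \<in> R'" if "r \<in> R" for r i
    using that
  proof (induction i arbitrary: r rule: less_induct)
    case (less i)
    show ?case
    proof (cases "i < d")
      case True
      have "r \<in> zm.span B" "y ^ i \<in> zm.span {y ^ i}" using less.prems B by (auto intro: zm.span_base)
      thus ?thesis unfolding R'_def
        by (rule int_span_mult[rotated]) (use True in \<open>auto intro!: zm.span_base simp: C_def\<close>)
    next
      case False
      have "(\<Sum>j\<le>d. poly.coeff p j * y ^ j) = 0" using p(3) by (simp add: poly_altdef d_def)
      hence yd: "y ^ d = - (\<Sum>j<d. poly.coeff p j * y ^ j)"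
        using p(1) by (simp add: lessThan_Suc_atMost[symmetric] d_def eq_neg_iff_add_eq_0 add.commute)
      have "r * y ^ i = r * y ^ (i - d) * y ^ d" using False by (simp flip: power_add)
      also have "\<dots> = - (\<Sum>j<d. (r * poly.coeff p j) * y ^ (i - d + j))"
        unfolding yd by (simp add: sum_distrib_left power_add mult_ac)
      also have "\<dots> \<in> R'" unfolding R'_def
      proof (intro zm.span_neg zm.span_sum)
        fix j assume "j \<in> {..<d}"
        hence "i - d + j < i" using False by auto
        thus "(r * poly.coeff p j) * y ^ (i - d + j) \<in> zm.span C"
          using less.IH less.prems finite_int_ring_mult[OF R] p(2) by (auto simp: R'_def)
      qed
      finally show ?thesis .
    qed
  qed
  have "finite_int_ring R'" unfolding finite_int_ring_def
  proof (intro conjI ballI exI)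
    have "1 \<in> R" using R by (auto simp: finite_int_ring_def)
    from mono[OF this, of 0] show "1 \<in> R'" by simp
    fix u v assume uv: "u \<in> R'" "v \<in> R'"
    show "u * v \<in> R'"
      using uv unfolding R'_def
    proof (rule int_span_mult[rotated])
      fix a b assume "a \<in> C" "b \<in> C"
      then obtain s i t j where st: "s \<in> B" "t \<in> B" "a = s * y ^ i" "b = t * y ^ j"
        by (auto simp: C_def)
      have "s * t \<in> R" using st B by (intro finite_int_ring_mult[OF R]) (auto intro: zm.span_base)
      from mono[OF this, of "i + j"] show "a * b \<in> zm.span C"
        by (simp add: st R'_def power_add mult_ac)
    qed
  qed (use finC R'_def in auto)
  moreover have "R \<subseteq> R'" using mono[where i = 0] by auto
  moreover have "1 \<in> R" using R by (auto simp: finite_int_ring_def)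
  hence "y \<in> R'" using mono[of 1 1] by simp
  ultimately show ?thesis by blast
qed

lemma finite_int_ring_Ints_ring: "finite_int_ring \<int>"
proof -
  have "(\<int>::complex set) = zm.span {1}" by (auto simp: zm.span_singleton Ints_def)
  thus ?thesis unfolding finite_int_ring_def by (intro conjI exI[of _ "{1}"]) auto
qed

lemma algebraic_ints_in_finite_int_ring:
  assumes "finite A" "\<And>a. a \<in> A \<Longrightarrow> algebraic_int a"
  shows "\<exists>R. finite_int_ring R \<and> A \<subseteq> R"
  using assms
proof (induction rule: finite_induct)
  case empty
  show ?case using finite_int_ring_Ints_ring by blast
next
  case (insert a A)
  then obtain R where R: "finite_int_ring R" "A \<subseteq> R" by auto
  from insert.prems[of a] obtain p where p: "lead_coeff p = 1"
    "\<forall>i. poly.coeff p i \<in> \<int>" "poly p a = 0" by (auto elim: algebraic_int.cases)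
  have "\<And>i. poly.coeff p i \<in> R" using p(2) finite_int_ring_Ints[OF R(1)] by blast
  from finite_int_ring_adjoin[OF R(1) p(1) this p(3)] R(2) show ?case by blast
qed

lemma algebraic_int_two:
  assumes "algebraic_int (x::complex)" "algebraic_int y"
  obtains R where "finite_int_ring R" "x \<in> R" "y \<in> R"
  using algebraic_ints_in_finite_int_ring[of "{x, y}"] assms that by auto

lemma algebraic_int_add: "algebraic_int (x::complex) \<Longrightarrow> algebraic_int y \<Longrightarrow> algebraic_int (x + y)"
  by (metis algebraic_int_two finite_int_ring_add algebraic_int_if_in_finite_int_ring)

lemma algebraic_int_mult: "algebraic_int (x::complex) \<Longrightarrow> algebraic_int y \<Longrightarrow> algebraic_int (x * y)"
  by (metis algebraic_int_two finite_int_ring_mult algebraic_int_if_in_finite_int_ring)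

text \<open>The finitely many coefficients lie in one \<open>finite_int_ring\<close>, to which
  \<open>y\<close> can be adjoined: this is transitivity of integrality.\<close>

lemma algebraic_int_integral:
  assumes "lead_coeff p = 1" "\<And>i. algebraic_int (poly.coeff p i)" "poly p (y::complex) = 0"
  shows "algebraic_int y"
proof -
  have fin: "finite (range (poly.coeff p))"
  proof -
    have "range (poly.coeff p) \<subseteq> insert 0 (poly.coeff p ` {..Polynomial.degree p})"
      by (auto simp: not_le coeff_eq_0) (metis atMost_iff coeff_eq_0 imageI not_le)
    thus ?thesis by (rule finite_subset) auto
  qed
  obtain R where R: "finite_int_ring R" "range (poly.coeff p) \<subseteq> R"
    using algebraic_ints_in_finite_int_ring[OF fin] assms(2) by blast
  obtain R' where "finite_int_ring R'" "y \<in> R'"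
    using finite_int_ring_adjoin[OF R(1) assms(1) _ assms(3)] R(2) by blast
  thus ?thesis by (rule algebraic_int_if_in_finite_int_ring)
qed

lemma algebraic_int_multiple:
  assumes "algebraic (x::complex)"
  obtains m :: nat where "m > 0" "algebraic_int (of_nat m * x)"
proof -
  from assms obtain p where p: "\<And>i. poly.coeff p i \<in> \<int>" "p \<noteq> 0" "poly p x = 0"
    by (auto simp: algebraic_def)
  define n where "n = Polynomial.degree p"
  define c where "c = lead_coeff p"
  have c: "c \<in> \<int>" "c \<noteq> 0" using p by (auto simp: c_def)
  have n: "n > 0"
    using p by (intro Nat.gr0I) (auto simp: n_def elim!: degree_eq_zeroE)
  \<comment> \<open>\<open>g\<close> satisfies \<open>g (c x) = c ^ (n - 1) p (x)\<close>: passing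
    from \<open>x\<close> to its multiple by the leading coefficient makes the equation monic and
    keeps it integral.\<close>
  define g where "g = Polynomial.monom 1 n + (\<Sum>i<n. Polynomial.monom (poly.coeff p i * c ^ (n - 1 - i)) i)"
  have cg: "poly.coeff g i = (if i = n then 1 else if i < n then poly.coeff p i * c ^ (n - 1 - i) else 0)" for i
    by (auto simp: g_def coeff_sum)
  have deg: "Polynomial.degree g = n"
    by (rule antisym) (auto intro!: degree_le le_degree simp: cg)
  have "(\<Sum>i\<le>n. poly.coeff p i * x ^ i) = 0" using p(3) by (simp add: poly_altdef n_def)
  hence s: "c * x ^ n + (\<Sum>i<n. poly.coeff p i * x ^ i) = 0"
    by (simp add: lessThan_Suc_atMost[symmetric] n_def c_def add.commute)
  have "poly g (c * x) = (c * x) ^ n + (\<Sum>i<n. poly.coeff p i * c ^ (n - 1 - i) * (c * x) ^ i)"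
    by (simp add: g_def poly_sum poly_monom)
  also have "(\<Sum>i<n. poly.coeff p i * c ^ (n - 1 - i) * (c * x) ^ i)
      = (\<Sum>i<n. c ^ (n - 1) * (poly.coeff p i * x ^ i))"
  proof (rule sum.cong)
    fix i assume "i \<in> {..<n}"
    hence "c ^ (n - 1) = c ^ (n - 1 - i) * c ^ i" by (simp flip: power_add)
    thus "poly.coeff p i * c ^ (n - 1 - i) * (c * x) ^ i = c ^ (n - 1) * (poly.coeff p i * x ^ i)"
      by (simp add: power_mult_distrib mult_ac)
  qed simp
  also have "(c * x) ^ n = c ^ (n - 1) * (c * x ^ n)"
    using n by (cases n) (auto simp: power_mult_distrib mult_ac)
  finally have "poly g (c * x) = 0"
    using s by (simp add: sum_distrib_left[symmetric] distrib_left[symmetric])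
  moreover have "\<forall>i. poly.coeff g i \<in> \<int>" using p(1) c by (auto simp: cg)
  moreover have "lead_coeff g = 1" by (simp add: deg cg)
  ultimately have a: "algebraic_int (c * x)" by (intro algebraic_int.intros)
  obtain k where k: "c = of_int k" using c(1) by (auto elim: Ints_cases)
  have "algebraic_int (of_nat (nat \<bar>k\<bar>) * x)"
  proof (cases "k \<ge> 0")
    case True thus ?thesis using a k by simp
  next
    case False thus ?thesis using algebraic_int_minus[OF a] k by simp
  qed
  thus ?thesis using that[of "nat \<bar>k\<bar>"] c k by auto
qed

section \<open>Linear dependence and finiteness of quotients\<close>

interpretation qv: vector_space "\<lambda>(c::rat) (x::complex). of_rat c * x"
  by unfold_locales (auto simp: algebra_simps of_rat_add of_rat_mult)

lemma common_denominator:
  assumes "finite I"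
  obtains m :: nat and d :: "'i \<Rightarrow> int"
    where "m > 0" "\<And>i. i \<in> I \<Longrightarrow> of_nat m * u i = (of_int (d i) :: rat)"
proof -
  have "\<exists>m d. m > (0::nat) \<and> (\<forall>i\<in>I. of_nat m * u i = (of_int (d i) :: rat))"
    using assms
  proof (induction rule: finite_induct)
    case empty show ?case by (intro exI[of _ 1]) auto
  next
    case (insert j I)
    then obtain m d where md: "m > 0" "\<forall>i\<in>I. of_nat m * u i = (of_int (d i) :: rat)" by blast
    obtain a b where "quotient_of (u j) = (a, b)" by (cases "quotient_of (u j)")
    hence ab: "u j = of_int a / of_int b" "b > 0"
      by (auto dest: quotient_of_div quotient_of_denom_pos)
    have "of_nat (m * nat b) * u i = of_int (if i = j then int m * a else b * d i)" if "i \<in> insert j I" for i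
    proof (cases "i = j")
      case True thus ?thesis using ab by simp
    next
      case False
      hence "of_nat m * u i = of_int (d i)" using md that by auto
      hence "of_nat (m * nat b) * u i = of_int b * of_int (d i)" using ab by (simp add: mult_ac)
      thus ?thesis using False by simp
    qed
    moreover have "m * nat b > 0" using md ab by simp
    ultimately show ?case
      by (intro exI[of _ "m * nat b"] exI[of _ "\<lambda>i. if i = j then int m * a else b * d i"] conjI ballI)
  qed
  thus ?thesis using that by blast
qed

lemma int_dependent:
  assumes B: "finite B" and I: "finite I" "card I > card B"
    and a: "\<And>i. i \<in> I \<Longrightarrow> a i \<in> qv.span B"
  obtains c :: "'i \<Rightarrow> int" where "\<exists>i\<in>I. c i \<noteq> 0" "(\<Sum>i\<in>I. of_int (c i) * a i) = 0"
proof (cases "inj_on a I")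
  \<comment> \<open>\<open>qv.dependent\<close> speaks of sets while the relation is wanted for an
    indexed family, so a repeated value is treated apart; it gives the coefficients 1 and
    -1.\<close>
  case False
  then obtain i j where ij: "i \<in> I" "j \<in> I" "i \<noteq> j" "a i = a j" by (auto simp: inj_on_def)
  define c :: "'i \<Rightarrow> int" where "c = (\<lambda>k. if k = i then 1 else if k = j then - 1 else 0)"
  have "(\<Sum>k\<in>I. of_int (c k) * a k) = (\<Sum>k\<in>{i, j}. of_int (c k) * a k)"
    by (rule sum.mono_neutral_right) (use I ij in \<open>auto simp: c_def\<close>)
  also have "\<dots> = 0" using ij by (simp add: c_def)
  finally show ?thesis using that[of c] ij by (force simp: c_def)
next
  case True
  have "qv.dependent (a ` I)"
  proof (rule ccontr)
    assume "qv.independent (a ` I)"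
    from qv.independent_span_bound[OF B this] a have "card (a ` I) \<le> card B" by auto
    with card_image[OF True] I show False by simp
  qed
  then obtain u where u: "\<exists>v\<in>a ` I. u v \<noteq> 0" "(\<Sum>v\<in>a ` I. of_rat (u v) * v) = 0"
    by (subst (asm) qv.dependent_finite) (use I in auto)
  obtain m d where md: "m > 0" "\<And>i. i \<in> I \<Longrightarrow> of_nat m * u (a i) = (of_int (d i) :: rat)"
    using common_denominator[OF I(1), of "\<lambda>i. u (a i)"] by blast
  have "(\<Sum>i\<in>I. of_int (d i) * a i) = (\<Sum>i\<in>I. of_nat m * (of_rat (u (a i)) * a i))"
  proof (rule sum.cong)
    fix i assume "i \<in> I"
    have "(of_int (d i) :: complex) = of_rat (of_int (d i))" by simp
    also have "\<dots> = of_nat m * of_rat (u (a i))"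
      unfolding md(2)[OF \<open>i \<in> I\<close>, symmetric] by (simp add: of_rat_mult)
    finally show "of_int (d i) * a i = of_nat m * (of_rat (u (a i)) * a i)" by (simp add: mult_ac)
  qed simp
  also have "\<dots> = of_nat m * (\<Sum>v\<in>a ` I. of_rat (u v) * v)"
    by (simp add: sum.reindex[OF True] sum_distrib_left)
  finally have "(\<Sum>i\<in>I. of_int (d i) * a i) = 0" using u by simp
  moreover from u obtain i where i: "i \<in> I" "u (a i) \<noteq> 0" by auto
  hence "d i \<noteq> 0" using md(2)[OF i(1)] md(1) by auto
  ultimately show ?thesis using that i by blast
qed

lemma algebraic_if_powers_in_span:
  assumes "finite B" "\<And>n. x ^ n \<in> qv.span B"
  shows "algebraic x"
proof -
  obtain c where c: "\<exists>i\<in>{..card B}. c i \<noteq> 0" "(\<Sum>i\<in>{..card B}. of_int (c i) * x ^ i) = 0"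
    by (rule int_dependent[OF assms(1), of "{..card B}" "\<lambda>i. x ^ i"]) (use assms(2) in auto)
  define g where "g = (\<Sum>i\<le>card B. Polynomial.monom (of_int (c i) :: complex) i)"
  have cg: "poly.coeff g i = (if i \<le> card B then of_int (c i) else 0)" for i
    by (simp add: g_def coeff_sum)
  have "poly g x = 0" using c(2) by (simp add: g_def poly_sum poly_monom)
  moreover obtain j where "j \<le> card B" "c j \<noteq> 0" using c(1) by auto
  hence "g \<noteq> 0" using cg[of j] by auto
  ultimately show ?thesis by (intro algebraicI[of g]) (auto simp: cg)
qed

text \<open>Dividing an integer relation by the gcd of its coefficients leaves one that is
  nontrivial modulo \<open>q\<close>. This turns a dimension count over the rationals into a
  statement modulo a prime.\<close>

lemma int_dependent_not_dvd:
  assumes B: "finite B" and I: "finite I" "card I > card B"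
    and a: "\<And>i. i \<in> I \<Longrightarrow> a i \<in> qv.span B" and q: "q > 1"
  obtains c :: "'i \<Rightarrow> int" where "\<exists>i\<in>I. \<not> int q dvd c i" "(\<Sum>i\<in>I. of_int (c i) * a i) = 0"
proof -
  obtain c :: "'i \<Rightarrow> int" where c: "\<exists>i\<in>I. c i \<noteq> 0" "(\<Sum>i\<in>I. of_int (c i) * a i) = 0"
    by (rule int_dependent[OF B I, where a = a]) (use a in auto)
  define g where "g = Gcd (c ` I)"
  have g: "g \<noteq> 0" using c(1) by (auto simp: g_def)
  define c' where "c' = (\<lambda>i. c i div g)"
  have cc: "c i = g * c' i" if "i \<in> I" for i
    using that by (simp add: c'_def g_def Gcd_dvd)
  have "of_int g * (\<Sum>i\<in>I. of_int (c' i) * a i) = (\<Sum>i\<in>I. of_int (c i) * a i)"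
    unfolding sum_distrib_left by (intro sum.cong refl) (simp only: cc of_int_mult mult.assoc)
  moreover have "\<exists>i\<in>I. \<not> int q dvd c' i"
  proof (rule ccontr)
    assume "\<not> (\<exists>i\<in>I. \<not> int q dvd c' i)"
    hence "int q * g dvd c i" if "i \<in> I" for i
      using mult_dvd_mono[of "int q" "c' i" g g] that by (simp only: cc) (simp add: mult.commute)
    hence "int q * g dvd g" unfolding g_def by (intro Gcd_greatest) (auto simp: g_def)
    thus False using g q dvd_times_right_cancel_iff[OF g, of "int q" 1] by simp
  qed
  ultimately show ?thesis using that[of c'] g c(2) by simp
qed

section \<open>Finite quotients of additive groups\<close>

lemma subspace_int_combination:
  assumes "zm.subspace A" "\<And>i. i \<in> I \<Longrightarrow> a i \<in> A"
  shows "(\<Sum>i\<in>I. of_int (c i) * a i) \<in> A"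
  using assms by (intro zm.subspace_sum) (auto intro: zm.subspace_scale)

text \<open>\<open>A / q A\<close> is a vector space over the field with \<open>q\<close> elements,
  and its dimension is at most \<open>card B\<close>, because a set independent modulo
  \<open>q A\<close> is also independent over the rationals. \<open>free\<close> is that
  independence, and a largest such set generates \<open>A\<close> modulo \<open>q A\<close>.\<close>

lemma finite_mod_prime:
  assumes A: "zm.subspace A" "A \<subseteq> qv.span B" "finite B" and q: "prime (q::nat)"
  shows "\<exists>T. finite T \<and> T \<subseteq> A \<and> (\<forall>a\<in>A. \<exists>t\<in>T. \<exists>b\<in>A. a = t + of_nat q * b)"
proof -
  define free where "free S \<longleftrightarrow>
      (\<forall>c. (\<exists>b\<in>A. (\<Sum>s\<in>S. of_int (c s) * s) = of_nat q * b) \<longrightarrow> (\<forall>s\<in>S. int q dvd c s))" for S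
  define ind where "ind S \<longleftrightarrow> S \<subseteq> A \<and> finite S \<and> free S" for S
  have q1: "q > 1" using q by (rule prime_gt_1_nat)
  \<comment> \<open>A rational relation among too many elements, made primitive, would be a
    nontrivial relation modulo \<open>q A\<close> with \<open>b = 0\<close>.\<close>
  have bd: "card S \<le> card B" if S: "ind S" for S
  proof (rule ccontr)
    assume "\<not> card S \<le> card B"
    hence "card S > card B" by simp
    moreover have "finite S" "\<And>i. i \<in> S \<Longrightarrow> i \<in> qv.span B" using S A(2) by (auto simp: ind_def)
    ultimately obtain c where c: "\<exists>i\<in>S. \<not> int q dvd c i" "(\<Sum>i\<in>S. of_int (c i) * i) = 0"
      using q1 by (elim int_dependent_not_dvd[OF A(3), where a = "\<lambda>i. i" and q = q, rotated 2]) auto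
    moreover have "\<exists>b\<in>A. 0 = of_nat q * b" using zm.subspace_0[OF A(1)] by auto
    ultimately show False using S unfolding ind_def free_def by (metis (no_types, lifting))
  qed
  have "ind {}" by (simp add: ind_def free_def)
  then obtain S where S: "ind S" "\<And>S'. ind S' \<Longrightarrow> card S' \<le> card S"
    using ex_has_greatest_nat[of ind "{}" card "Suc (card B)"] bd by (auto simp: less_Suc_eq_le)
  have fS: "finite S" "S \<subseteq> A" using S by (auto simp: ind_def)
  define T where "T = (\<lambda>f. \<Sum>s\<in>S. of_int (f s) * s) ` (PiE S (\<lambda>_. {0..<int q}))"
  have "finite T" unfolding T_def by (intro finite_imageI finite_PiE fS) auto
  moreover have "T \<subseteq> A" unfolding T_def using fS A(1) by (auto intro!: subspace_int_combination)
  moreover have "\<exists>t\<in>T. \<exists>b\<in>A. a = t + of_nat q * b" if a: "a \<in> A" for a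
  proof -
    have "\<exists>c b. b \<in> A \<and> a = (\<Sum>s\<in>S. of_int (c s) * s) + of_nat q * b"
    proof (cases "a \<in> S")
      case True
      have "(\<Sum>s\<in>S. of_int (if s = a then 1 else 0) * s) = (\<Sum>s\<in>S. if s = a then a else 0)"
        by (intro sum.cong) auto
      also have "\<dots> = a" using True fS by simp
      finally show ?thesis using zm.subspace_0[OF A(1)]
        by (intro exI[of _ "\<lambda>s. if s = a then 1 else 0"] exI[of _ 0]) auto
    next
      case False
      have "\<not> ind (insert a S)" using S(2)[of "insert a S"] False fS by auto
      hence "\<not> free (insert a S)" using a fS by (simp add: ind_def)
      then obtain c b where cb: "b \<in> A" "(\<Sum>s\<in>insert a S. of_int (c s) * s) = of_nat q * b"
        "\<exists>s\<in>insert a S. \<not> int q dvd c s"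
        unfolding free_def by blast
      have eq: "of_int (c a) * a + (\<Sum>s\<in>S. of_int (c s) * s) = of_nat q * b"
        using cb(2) False fS by simp
      \<comment> \<open>Otherwise the term of \<open>a\<close> could be moved into
        \<open>q A\<close>, leaving a relation among elements of the free set
        \<open>S\<close>.\<close>
      have "\<not> int q dvd c a"
      proof
        assume "int q dvd c a"
        then obtain k where k: "c a = int q * k" by auto
        have "(\<Sum>s\<in>S. of_int (c s) * s) = of_nat q * (b - of_int k * a)"
          using eq by (simp add: k algebra_simps)
        moreover have "b - of_int k * a \<in> A"
          by (intro zm.subspace_diff zm.subspace_scale A(1) a cb(1))
        moreover have "free S" using S(1) by (simp add: ind_def)
        ultimately have "\<forall>s\<in>S. int q dvd c s" unfolding free_def by blast
        with cb(3) \<open>int q dvd c a\<close> show False by auto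
      qed
      \<comment> \<open>Inverting the coefficient of \<open>a\<close> modulo \<open>q\<close> solves
        the relation for \<open>a\<close> up to \<open>q A\<close>.\<close>
      hence "coprime (c a) (int q)"
        using q prime_imp_coprime[of "int q" "c a"] by (simp add: coprime_commute)
      then obtain u v where uv: "u * c a + v * int q = 1"
        using bezout_int[of "c a" "int q"] by (auto simp: coprime_iff_gcd_eq_1)
      have one: "of_int u * of_int (c a) + of_int v * of_nat q = (1::complex)"
        using arg_cong[OF uv, of "of_int :: int \<Rightarrow> complex"] by simp
      have "a = (of_int u * of_int (c a) + of_int v * of_nat q) * a" using one by simp
      also have "\<dots> = of_int u * (of_nat q * b - (\<Sum>s\<in>S. of_int (c s) * s)) + of_nat q * (of_int v * a)"
        unfolding eq[symmetric] by (simp add: algebra_simps)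
      also have "\<dots> = (\<Sum>s\<in>S. of_int (- u * c s) * s) + of_nat q * (of_int u * b + of_int v * a)"
        by (simp add: algebra_simps sum_distrib_left sum_negf)
      finally have "a = (\<Sum>s\<in>S. of_int (- u * c s) * s) + of_nat q * (of_int u * b + of_int v * a)" .
      moreover have "of_int u * b + of_int v * a \<in> A"
        by (intro zm.subspace_add zm.subspace_scale A(1) a cb(1))
      ultimately show ?thesis by (intro exI[of _ "\<lambda>s. - u * c s"] exI[of _ "of_int u * b + of_int v * a"]) blast
    qed
    then obtain c b where cb: "b \<in> A" "a = (\<Sum>s\<in>S. of_int (c s) * s) + of_nat q * b" by blast
    \<comment> \<open>Only the residues of the coefficients matter, which leaves finitely many
      representatives.\<close>
    define f where "f = (\<lambda>s\<in>S. c s mod int q)"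
    have f: "f \<in> PiE S (\<lambda>_. {0..<int q})" using q1 by (auto simp: f_def)
    have "(\<Sum>s\<in>S. of_int (c s) * s) = (\<Sum>s\<in>S. of_int (f s) * s + of_nat q * (of_int (c s div int q) * s))"
    proof (rule sum.cong)
      fix s assume s: "s \<in> S"
      have "(of_int (c s) :: complex) = of_int (c s mod int q + int q * (c s div int q))" by simp
      also have "\<dots> = of_int (f s) + of_nat q * of_int (c s div int q)"
        using s by (simp only: of_int_add of_int_mult) (simp add: f_def)
      finally show "of_int (c s) * s = of_int (f s) * s + of_nat q * (of_int (c s div int q) * s)"
        by (simp add: algebra_simps)
    qed simp
    hence "a = (\<Sum>s\<in>S. of_int (f s) * s) + of_nat q * ((\<Sum>s\<in>S. of_int (c s div int q) * s) + b)"
      using cb(2) by (simp add: sum.distrib sum_distrib_left algebra_simps)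
    moreover have "(\<Sum>s\<in>S. of_int (c s div int q) * s) + b \<in> A"
      using fS(2) cb(1) by (intro zm.subspace_add A(1) subspace_int_combination) auto
    moreover have "(\<Sum>s\<in>S. of_int (f s) * s) \<in> T" using f unfolding T_def by (rule imageI)
    ultimately show ?thesis by (intro bexI)
  qed
  ultimately show ?thesis by (intro exI[of _ T] conjI ballI)
qed

text \<open>For \<open>m = q * k\<close>, representatives modulo \<open>q\<close> plus
  \<open>q\<close> times representatives modulo \<open>k\<close> represent \<open>A\<close> modulo
  \<open>m\<close>.\<close>

lemma finite_mod:
  assumes A: "zm.subspace A" "A \<subseteq> qv.span B" "finite B" and m: "(m::nat) > 0"
  shows "\<exists>T. finite T \<and> T \<subseteq> A \<and> (\<forall>a\<in>A. \<exists>t\<in>T. \<exists>b\<in>A. a = t + of_nat m * b)"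
  using m
proof (induction m rule: less_induct)
  case (less m)
  show ?case
  proof (cases "m = 1")
    case True
    thus ?thesis using zm.subspace_0[OF A(1)] by (intro exI[of _ "{0}"]) auto
  next
    case False
    then obtain q where q: "prime q" "q dvd m" using prime_factor_nat by blast
    then obtain k where k: "m = q * k" by auto
    have "k < m" "k > 0" using k less.prems prime_gt_1_nat[OF q(1)] by auto
    from less.IH[OF this] obtain T where T: "finite T" "T \<subseteq> A" "\<forall>a\<in>A. \<exists>t\<in>T. \<exists>b\<in>A. a = t + of_nat k * b"
      by blast
    obtain U where U: "finite U" "U \<subseteq> A" "\<forall>a\<in>A. \<exists>t\<in>U. \<exists>b\<in>A. a = t + of_nat q * b"
      using finite_mod_prime[OF A q(1)] by blast
    define V where "V = (\<lambda>(u, t). u + of_nat q * t) ` (U \<times> T)"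
    have "finite V" using T U by (simp add: V_def)
    moreover have "u + of_nat q * t \<in> A" if "u \<in> U" "t \<in> T" for u t
      using zm.subspace_add[OF A(1), of u "of_int (int q) * t"] zm.subspace_scale[OF A(1), of t "int q"] U T that
      by auto
    hence "V \<subseteq> A" by (auto simp: V_def)
    moreover have "\<exists>t\<in>V. \<exists>b\<in>A. a = t + of_nat m * b" if a: "a \<in> A" for a
    proof -
      obtain u b where ub: "u \<in> U" "b \<in> A" "a = u + of_nat q * b" using bspec[OF U(3) a] by blast
      obtain t d where td: "t \<in> T" "d \<in> A" "b = t + of_nat k * d" using bspec[OF T(3) ub(2)] by blast
      have "a = (u + of_nat q * t) + of_nat m * d" by (simp add: ub td k algebra_simps)
      moreover have "u + of_nat q * t \<in> V" using ub td by (auto simp: V_def)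
      ultimately show ?thesis using td(2) by (intro bexI)
    qed
    ultimately show ?thesis by (intro exI[of _ V] conjI ballI)
  qed
qed

text \<open>A subgroup that contains \<open>m A\<close> is determined by which of the finitely many
  representatives of \<open>A\<close> modulo \<open>m A\<close> it contains.\<close>

lemma finite_subspaces_between:
  assumes A: "zm.subspace A" "A \<subseteq> qv.span B" "finite B" and m: "(m::nat) > 0"
  shows "finite {I. zm.subspace I \<and> (\<forall>a\<in>A. of_nat m * a \<in> I) \<and> I \<subseteq> A}" (is "finite ?F")
proof -
  obtain T where T: "finite T" "T \<subseteq> A" "\<forall>a\<in>A. \<exists>t\<in>T. \<exists>b\<in>A. a = t + of_nat m * b"
    using finite_mod[OF A m] by blast
  have "inj_on (\<lambda>I. I \<inter> T) ?F"
  proof (rule inj_onI)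
    have sub: "I \<subseteq> J" if I: "I \<in> ?F" and J: "J \<in> ?F" and eq: "I \<inter> T = J \<inter> T" for I J
    proof
      fix a assume a: "a \<in> I"
      then obtain t b where tb: "t \<in> T" "b \<in> A" "a = t + of_nat m * b" using T(3) I by blast
      have "of_nat m * b \<in> I" "zm.subspace I" using I tb by auto
      hence "a - of_nat m * b \<in> I" using a by (intro zm.subspace_diff)
      hence "t \<in> J" using eq tb by auto
      thus "a \<in> J" using J tb by (auto intro: zm.subspace_add)
    qed
    fix I J assume "I \<in> ?F" "J \<in> ?F" "I \<inter> T = J \<inter> T"
    thus "I = J" using sub[of I J] sub[of J I] by auto
  qed
  moreover have "finite ((\<lambda>I. I \<inter> T) ` ?F)"
    by (rule finite_subset[of _ "Pow T"]) (use T in auto)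
  ultimately show ?thesis using finite_image_iff by blast
qed

section \<open>Ideals of the ring of integers of a number field\<close>

lemma complex_ring_simps [simp]:
  "carrier complex_ring = UNIV" "mult complex_ring = (*)" "one complex_ring = 1"
  "zero complex_ring = 0" "add complex_ring = (+)"
  by (simp_all add: complex_ring_def)

lemma complex_ring_cring: "cring complex_ring"
proof (rule cringI)
  show "abelian_group complex_ring"
    by (rule abelian_groupI) (auto simp: algebra_simps intro: exI[of _ "- x" for x])
  show "Group.comm_monoid complex_ring"
    by (rule comm_monoidI) (auto simp: algebra_simps)
qed (auto simp: algebra_simps)

interpretation cx: cring complex_ring
  by (rule complex_ring_cring)

lemma complex_ring_field: "field complex_ring"
proof (rule cx.cring_fieldI)
  have "x \<in> Units complex_ring" if "x \<noteq> 0" for x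
    using that by (auto simp: Units_def intro!: exI[of _ "inverse x"])
  moreover have "0 \<notin> Units complex_ring" by (auto simp: Units_def)
  ultimately show "Units complex_ring = carrier complex_ring - {\<zero>\<^bsub>complex_ring\<^esub>}" by auto
qed

lemma complex_ring_a_inv [simp]: "\<ominus>\<^bsub>complex_ring\<^esub> x = - x"
  by (rule cx.minus_equality) auto

text \<open>The left-hand side is what simplification makes of the inverse in
  \<open>add_monoid complex_ring\<close>.\<close>

lemma complex_ring_add_inv [simp]: "inv\<^bsub>\<lparr>carrier = UNIV, monoid.mult = (+), one = 0 :: complex\<rparr>\<^esub> x = - x"
  using complex_ring_a_inv[of x] unfolding a_inv_def by (simp del: complex_ring_a_inv)

lemma complex_ring_m_inv: "x \<noteq> 0 \<Longrightarrow> inv\<^bsub>complex_ring\<^esub> x = inverse x"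
  by (rule cx.comm_inv_char) auto

lemma additive_subgroup_complex_iff:
  "subgroup I (add_monoid complex_ring) \<longleftrightarrow> zm.subspace I"
proof
  assume I: "subgroup I (add_monoid complex_ring)"
  have add: "x + y \<in> I" if "x \<in> I" "y \<in> I" for x y
    using subgroup.m_closed[OF I that] by simp
  have neg: "- x \<in> I" if "x \<in> I" for x
    using subgroup.m_inv_closed[OF I that] by simp
  have zero: "0 \<in> I" using subgroup.one_closed[OF I] by simp
  have nat: "of_nat n * x \<in> I" if "x \<in> I" for n x
    by (induction n) (auto simp: algebra_simps zero add that)
  show "zm.subspace I"
  proof (rule zm.subspaceI)
    fix c x assume "x \<in> I"
    hence "of_nat (nat \<bar>c\<bar>) * x \<in> I" by (rule nat)
    thus "of_int c * x \<in> I"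
      using neg by (cases "c \<ge> 0") (auto, fastforce)
  qed (use zero add in auto)
next
  assume I: "zm.subspace I"
  show "subgroup I (add_monoid complex_ring)"
    by (rule subgroup.intro)
       (auto simp: zm.subspace_add[OF I] zm.subspace_0[OF I] zm.subspace_neg[OF I])
qed

section \<open>Products of additive subgroups of the complex numbers\<close>

abbreviation iprod :: "complex set \<Rightarrow> complex set \<Rightarrow> complex set" where
  "iprod \<equiv> ideal_prod complex_ring"

lemma iprod_mult: "x \<in> I \<Longrightarrow> y \<in> J \<Longrightarrow> x * y \<in> iprod I J"
  using ideal_prod.prod[of x I y J complex_ring] by simp

lemma iprod_add: "x \<in> iprod I J \<Longrightarrow> y \<in> iprod I J \<Longrightarrow> x + y \<in> iprod I J"
  using ideal_prod.sum[of x complex_ring I J y] by simp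

lemma iprod_induct [consumes 1, case_names mult add]:
  assumes "x \<in> iprod I J" "\<And>a b. a \<in> I \<Longrightarrow> b \<in> J \<Longrightarrow> P (a * b)"
    "\<And>x y. P x \<Longrightarrow> P y \<Longrightarrow> P (x + y)"
  shows "P x"
  using assms(1) by (induction rule: ideal_prod.induct) (use assms in auto)

lemma iprod_subset:
  assumes "\<And>a b. a \<in> I \<Longrightarrow> b \<in> J \<Longrightarrow> a * b \<in> M" "zm.subspace M"
  shows "iprod I J \<subseteq> M"
proof
  fix x assume "x \<in> iprod I J"
  thus "x \<in> M" by (induction rule: iprod_induct) (use assms in \<open>auto intro: zm.subspace_add\<close>)
qed

lemma iprod_commute: "iprod I J = iprod J I"
proof -
  have "iprod I J \<subseteq> iprod J I" for I J
  proof
    fix x assume "x \<in> iprod I J"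
    thus "x \<in> iprod J I"
      by (induction rule: iprod_induct) (auto intro: iprod_add, metis iprod_mult mult.commute)
  qed
  thus ?thesis by blast
qed

lemma iprod_assoc: "iprod (iprod I J) K = iprod I (iprod J K)"
proof -
  have *: "iprod (iprod I J) K \<subseteq> iprod I (iprod J K)" for I J K
  proof
    fix x assume "x \<in> iprod (iprod I J) K"
    thus "x \<in> iprod I (iprod J K)"
    proof (induction rule: iprod_induct)
      case (mult s k)
      from mult(1) show ?case
      proof (induction rule: iprod_induct)
        case (mult a b)
        thus ?case using iprod_mult[OF mult(1) iprod_mult[OF mult(2) \<open>k \<in> K\<close>]] by (simp add: mult.assoc)
      next
        case (add a b)
        thus ?case by (auto simp: distrib_right intro: iprod_add)
      qed
    qed (rule iprod_add)
  qed
  have "iprod I (iprod J K) = iprod (iprod K J) I" by (metis iprod_commute)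
  also have "\<dots> \<subseteq> iprod K (iprod J I)" by (rule *)
  also have "\<dots> = iprod (iprod I J) K" by (metis iprod_commute)
  finally show ?thesis using * by blast
qed

section \<open>Rings of integers and their modules\<close>

locale number_field =
  fixes L B :: "complex set"
  assumes subfield_L: "subfield L complex_ring" and finite_B: "finite B" and L_span: "L \<subseteq> qv.span B"
begin

abbreviation "\<O> \<equiv> ints_of L"

lemma L_props:
  shows L_0: "0 \<in> L" and L_1: "1 \<in> L"
    and L_add: "x \<in> L \<Longrightarrow> y \<in> L \<Longrightarrow> x + y \<in> L"
    and L_mult: "x \<in> L \<Longrightarrow> y \<in> L \<Longrightarrow> x * y \<in> L"
    and L_minus: "x \<in> L \<Longrightarrow> - x \<in> L"
    and L_diff: "x \<in> L \<Longrightarrow> y \<in> L \<Longrightarrow> x - y \<in> L"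
    and L_inverse: "x \<in> L \<Longrightarrow> inverse x \<in> L"
proof -
  have sr: "subring L complex_ring" using subfieldE(1)[OF subfield_L] .
  show "0 \<in> L" "1 \<in> L" using subringE(2,3)[OF sr] by auto
  show add: "x \<in> L \<Longrightarrow> y \<in> L \<Longrightarrow> x + y \<in> L" for x y using subringE(7)[OF sr] by auto
  show "x \<in> L \<Longrightarrow> y \<in> L \<Longrightarrow> x * y \<in> L" for x y using subringE(6)[OF sr] by auto
  show neg: "x \<in> L \<Longrightarrow> - x \<in> L" for x using subringE(5)[OF sr] by auto
  show "x \<in> L \<Longrightarrow> y \<in> L \<Longrightarrow> x - y \<in> L" for x y
    using add[OF _ neg, of x y] by simp
  show "inverse x \<in> L" if "x \<in> L" for x
  proof (cases "x = 0")
    case False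
    thus ?thesis using cx.subfield_m_inv(1)[OF subfield_L, of x] that by (simp add: complex_ring_m_inv)
  qed (use \<open>0 \<in> L\<close> in simp)
qed

lemma L_power: "x \<in> L \<Longrightarrow> x ^ n \<in> L"
  by (induction n) (auto intro: L_1 L_mult)

lemma L_divide: "x \<in> L \<Longrightarrow> y \<in> L \<Longrightarrow> x / y \<in> L"
  by (simp add: divide_inverse L_mult L_inverse)

lemma L_subspace: "zm.subspace L"
  unfolding additive_subgroup_complex_iff[symmetric]
  by (rule subgroup.intro) (auto simp: L_add L_0 L_minus)

lemma L_Ints: "x \<in> \<int> \<Longrightarrow> x \<in> L"
  using zm.subspace_scale[OF L_subspace L_1] by (auto elim!: Ints_cases)

lemma L_algebraic: "x \<in> L \<Longrightarrow> algebraic x"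
  using L_span by (intro algebraic_if_powers_in_span[OF finite_B]) (auto intro: L_power)

lemma O_subset: "\<O> \<subseteq> L" by (auto simp: ints_of_def)

lemma O_1: "1 \<in> \<O>" by (auto simp: ints_of_def L_1 intro: int_imp_algebraic_int)

lemma O_mult: "x \<in> \<O> \<Longrightarrow> y \<in> \<O> \<Longrightarrow> x * y \<in> \<O>"
  by (auto simp: ints_of_def L_mult algebraic_int_mult)

lemma O_subspace: "zm.subspace \<O>"
  unfolding additive_subgroup_complex_iff[symmetric]
  by (rule subgroup.intro) (auto simp: ints_of_def L_add L_minus L_0 algebraic_int_add)

lemma O_0: "0 \<in> \<O>" by (rule zm.subspace_0[OF O_subspace])
lemma O_add: "x \<in> \<O> \<Longrightarrow> y \<in> \<O> \<Longrightarrow> x + y \<in> \<O>" by (rule zm.subspace_add[OF O_subspace])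
lemma O_diff: "x \<in> \<O> \<Longrightarrow> y \<in> \<O> \<Longrightarrow> x - y \<in> \<O>" by (rule zm.subspace_diff[OF O_subspace])
lemma O_power: "x \<in> \<O> \<Longrightarrow> x ^ n \<in> \<O>" by (induction n) (auto intro: O_1 O_mult)

lemma O_Ints: "x \<in> \<int> \<Longrightarrow> x \<in> \<O>"
  by (simp add: ints_of_def L_Ints int_imp_algebraic_int)

lemma O_prod: "(\<And>i. i \<in> A \<Longrightarrow> f i \<in> \<O>) \<Longrightarrow> prod f A \<in> \<O>"
  by (induction A rule: infinite_finite_induct) (auto intro: O_1 O_mult)

lemma O_multiple:
  assumes "x \<in> L"
  obtains m :: nat where "m > 0" "of_nat m * x \<in> \<O>"
  using algebraic_int_multiple[OF L_algebraic[OF assms]] assms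
  by (metis (no_types, lifting) ints_of_def mem_Collect_eq L_mult L_Ints Ints_of_nat)

text \<open>Neither finite generation nor a common denominator is required, so integral and
  fractional ideals, annihilators and candidate inverses obey the same closure rules.\<close>

definition is_mod :: "complex set \<Rightarrow> bool" where
  "is_mod I \<longleftrightarrow> zm.subspace I \<and> I \<subseteq> L \<and> (\<forall>a\<in>\<O>. \<forall>x\<in>I. a * x \<in> I)"

lemma is_modD:
  assumes "is_mod I"
  shows "zm.subspace I" "I \<subseteq> L" "a \<in> \<O> \<Longrightarrow> x \<in> I \<Longrightarrow> a * x \<in> I" "0 \<in> I"
    "x \<in> I \<Longrightarrow> y \<in> I \<Longrightarrow> x + y \<in> I" "x \<in> I \<Longrightarrow> y \<in> I \<Longrightarrow> x - y \<in> I" "x \<in> I \<Longrightarrow> - x \<in> I"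
  using assms unfolding is_mod_def
  by (auto intro: zm.subspace_0 zm.subspace_add zm.subspace_diff zm.subspace_neg)

lemma is_modI:
  assumes "I \<subseteq> L" "0 \<in> I" "\<And>x y. x \<in> I \<Longrightarrow> y \<in> I \<Longrightarrow> x + y \<in> I"
    "\<And>a x. a \<in> \<O> \<Longrightarrow> x \<in> I \<Longrightarrow> a * x \<in> I"
  shows "is_mod I"
  unfolding is_mod_def
proof (intro conjI ballI zm.subspaceI)
  fix c x assume "x \<in> I"
  thus "of_int c * x \<in> I" using assms(4)[of "of_int c" x] O_Ints by auto
qed (use assms in auto)

lemma is_mod_O: "is_mod \<O>"
  using O_subset O_0 O_add O_mult by (intro is_modI) auto

lemma is_mod_iprod:
  assumes "is_mod I" "is_mod J"
  shows "is_mod (iprod I J)"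
proof (rule is_modI)
  show "iprod I J \<subseteq> L"
    using is_modD(2)[OF assms(1)] is_modD(2)[OF assms(2)] L_mult
    by (intro iprod_subset L_subspace) auto
  show "0 \<in> iprod I J" using iprod_mult[OF is_modD(4)[OF assms(1)] is_modD(4)[OF assms(2)]] by simp
  fix a x assume "a \<in> \<O>" "x \<in> iprod I J"
  from this(2,1) show "a * x \<in> iprod I J"
  proof (induction rule: iprod_induct)
    case (mult u v)
    hence "(a * u) * v \<in> iprod I J" using is_modD(3)[OF assms(1)] by (intro iprod_mult) auto
    thus ?case by (simp add: mult.assoc)
  qed (auto simp: distrib_left intro: iprod_add)
qed (rule iprod_add)

lemma iprod_subset_mod:
  assumes "\<And>a b. a \<in> I \<Longrightarrow> b \<in> J \<Longrightarrow> a * b \<in> M" "is_mod M"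
  shows "iprod I J \<subseteq> M"
  using assms is_modD(1) by (intro iprod_subset) auto

lemma iprod_O: assumes "is_mod I" shows "iprod \<O> I = I"
proof
  show "iprod \<O> I \<subseteq> I" using assms is_modD(3)[OF assms] by (intro iprod_subset_mod) auto
  show "I \<subseteq> iprod \<O> I" using iprod_mult[OF O_1, of _ I] by auto
qed

lemma is_mod_principal: "x \<in> L \<Longrightarrow> is_mod (principal_ideal L x)"
  unfolding principal_ideal_def
proof (rule is_modI)
  assume x: "x \<in> L"
  show "(\<lambda>a. a * x) ` \<O> \<subseteq> L" using x O_subset L_mult by auto
  show "0 \<in> (\<lambda>a. a * x) ` \<O>" by (rule image_eqI[of _ _ 0]) (auto simp: O_0)
  show "u + v \<in> (\<lambda>a. a * x) ` \<O>" if "u \<in> (\<lambda>a. a * x) ` \<O>" "v \<in> (\<lambda>a. a * x) ` \<O>" for u v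
    using that by (auto simp: distrib_right[symmetric] intro!: imageI O_add)
  show "a * u \<in> (\<lambda>a. a * x) ` \<O>" if "a \<in> \<O>" "u \<in> (\<lambda>a. a * x) ` \<O>" for a u
    using that by (auto simp: mult.assoc[symmetric] intro!: imageI O_mult)
qed

lemma principal_subset: "is_mod I \<Longrightarrow> principal_ideal L x \<subseteq> I \<longleftrightarrow> x \<in> I"
  unfolding principal_ideal_def using is_modD(3) O_1 by force

lemma iprod_principal: "iprod (principal_ideal L x) (principal_ideal L y) = principal_ideal L (x * y)" (is "?l = ?r")
  if "x \<in> L" "y \<in> L"
proof
  show "?l \<subseteq> ?r"
  proof (rule iprod_subset_mod)
    fix a b assume "a \<in> principal_ideal L x" "b \<in> principal_ideal L y"
    then obtain c d where "c \<in> \<O>" "d \<in> \<O>" "a = c * x" "b = d * y" by (auto simp: principal_ideal_def)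
    thus "a * b \<in> ?r" unfolding principal_ideal_def
      by (intro image_eqI[of _ _ "c * d"]) (auto simp: O_mult)
  qed (use that L_mult is_mod_principal in auto)
  have "x \<in> principal_ideal L x" "y \<in> principal_ideal L y"
    using principal_subset[OF is_mod_principal] that by auto
  hence "x * y \<in> ?l" by (rule iprod_mult)
  thus "?r \<subseteq> ?l" using principal_subset is_mod_iprod is_mod_principal that by auto
qed

text \<open>For a nonzero \<open>a\<close> in \<open>I\<close>, some \<open>m / a\<close> with
  \<open>m\<close> a positive integer is integral, and \<open>m = (m / a) * a\<close>. No norm is
  involved.\<close>

lemma O_multiple_in:
  assumes "is_mod I" "I \<subseteq> \<O>" "I \<noteq> {0}"
  obtains m :: nat where "m > 0" "of_nat m \<in> I"
proof -
  obtain a where a: "a \<in> I" "a \<noteq> 0" using assms is_modD(4)[OF assms(1)] by blast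
  obtain m :: nat where m: "m > 0" "of_nat m * inverse a \<in> \<O>"
    using O_multiple[OF L_inverse] a(1) is_modD(2)[OF assms(1)] by blast
  have "of_nat m * inverse a * a \<in> I" using is_modD(3)[OF assms(1)] m a by blast
  also have "of_nat m * inverse a * a = of_nat m" using a(2) by simp
  finally have "of_nat m \<in> I" .
  thus ?thesis using that m(1) by blast
qed

lemma finite_ideals_containing:
  assumes "(m::nat) > 0"
  shows "finite {I. is_mod I \<and> I \<subseteq> \<O> \<and> of_nat m \<in> I}"
proof (rule finite_subset)
  show "finite {I. zm.subspace I \<and> (\<forall>a\<in>\<O>. of_nat m * a \<in> I) \<and> I \<subseteq> \<O>}"
    using O_subset L_span by (intro finite_subspaces_between[OF O_subspace _ finite_B assms]) auto
  show "{I. is_mod I \<and> I \<subseteq> \<O> \<and> of_nat m \<in> I} \<subseteq>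
    {I. zm.subspace I \<and> (\<forall>a\<in>\<O>. of_nat m * a \<in> I) \<and> I \<subseteq> \<O>}"
    using is_modD(3)[where x = "of_nat m"] by (auto simp: mult.commute is_mod_def)
qed

text \<open>The pigeonhole form of \<open>finite_subspaces_between\<close>. It stands in for a chain
  condition and is applied to decreasing sequences.\<close>

lemma L_subgroup_chain_repeat:
  assumes A: "zm.subspace A" "A \<subseteq> L" and m: "(m::nat) > 0"
    and I: "\<And>k::nat. zm.subspace (I k)" "\<And>k a. a \<in> A \<Longrightarrow> of_nat m * a \<in> I k" "\<And>k. I k \<subseteq> A"
  obtains k j where "k < j" "I k = I j"
proof -
  have "finite {I. zm.subspace I \<and> (\<forall>a\<in>A. of_nat m * a \<in> I) \<and> I \<subseteq> A}"
    using A(2) L_span by (intro finite_subspaces_between[OF A(1) _ finite_B m]) auto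
  moreover have "range I \<subseteq> {I. zm.subspace I \<and> (\<forall>a\<in>A. of_nat m * a \<in> I) \<and> I \<subseteq> A}"
    using I(1,2) subsetD[OF I(3)] by auto
  ultimately have "finite (range I)" by (rule finite_subset[rotated])
  hence "\<not> inj I" using finite_imageD infinite_UNIV_nat by blast
  then obtain k j where "I k = I j" "k \<noteq> j" by (auto simp: inj_def)
  thus ?thesis using that by (metis linorder_neqE_nat)
qed

section \<open>Prime ideals in terms of elements\<close>

lemma prime_ideals_iff:
  "P \<in> prime_ideals L \<longleftrightarrow> is_mod P \<and> P \<subseteq> \<O> \<and> P \<noteq> {0} \<and> 1 \<notin> P \<and>
     (\<forall>a\<in>\<O>. \<forall>b\<in>\<O>. a * b \<in> P \<longrightarrow> a \<in> P \<or> b \<in> P)"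
proof -
  let ?R = "subring_of \<O>"
  have cr: "cring ?R"
  proof (rule cringI)
    show "abelian_group ?R"
    proof (rule abelian_groupI)
      fix x assume "x \<in> carrier ?R"
      thus "\<exists>y\<in>carrier ?R. y \<oplus>\<^bsub>?R\<^esub> x = \<zero>\<^bsub>?R\<^esub>"
        using zm.subspace_neg[OF O_subspace, of x] by (auto intro!: bexI[of _ "- x"])
    qed (auto simp: O_add O_0 algebra_simps)
    show "Group.comm_monoid ?R"
      by (rule comm_monoidI) (auto simp: O_1 O_mult algebra_simps)
  qed (auto simp: algebra_simps)
  interpret R: cring ?R by (rule cr)
  have ainv: "inv\<^bsub>add_monoid ?R\<^esub> x = - x" if "x \<in> \<O>" for x
    using R.minus_equality[of "- x" x] that zm.subspace_neg[OF O_subspace, of x]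
    by (simp add: a_inv_def)
  show ?thesis
  proof
    assume "P \<in> prime_ideals L"
    hence P: "primeideal P ?R" "P \<noteq> {0}" by (auto simp: prime_ideals_def)
    interpret P: primeideal P ?R by (rule P(1))
    have PO: "P \<subseteq> \<O>" using P.a_subset by simp
    have mod: "is_mod P"
      using PO O_subset P.zero_closed P.a_closed P.I_l_closed by (intro is_modI) auto
    have "1 \<notin> P" using P.one_imp_carrier P.I_notcarr by auto
    thus "is_mod P \<and> P \<subseteq> \<O> \<and> P \<noteq> {0} \<and> 1 \<notin> P \<and> (\<forall>a\<in>\<O>. \<forall>b\<in>\<O>. a * b \<in> P \<longrightarrow> a \<in> P \<or> b \<in> P)"
      using PO mod P(2) P.I_prime by auto
  next
    assume P: "is_mod P \<and> P \<subseteq> \<O> \<and> P \<noteq> {0} \<and> 1 \<notin> P \<and> (\<forall>a\<in>\<O>. \<forall>b\<in>\<O>. a * b \<in> P \<longrightarrow> a \<in> P \<or> b \<in> P)"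
    have PO: "x \<in> \<O>" if "x \<in> P" for x using P that by blast
    have "ideal P ?R"
    proof (rule idealI)
      show "subgroup P (add_monoid ?R)"
        by (rule subgroup.intro) (use P in \<open>auto simp: ainv[simplified] PO is_modD(4,5,7)\<close>)
      fix a x assume "a \<in> P" "x \<in> carrier ?R"
      hence "x * a \<in> P" using P is_modD(3)[of P x a] by simp
      thus "x \<otimes>\<^bsub>?R\<^esub> a \<in> P" "a \<otimes>\<^bsub>?R\<^esub> x \<in> P" by (simp_all add: mult.commute)
    qed (rule R.ring_axioms)
    hence "primeideal P ?R"
      by (rule primeidealI[OF _ cr]) (use P O_1 in auto)
    thus "P \<in> prime_ideals L" using P by (auto simp: prime_ideals_def)
  qed
qed

lemma primeD:
  assumes "P \<in> prime_ideals L"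
  shows "is_mod P" "P \<subseteq> \<O>" "P \<noteq> {0}" "1 \<notin> P" "a \<in> \<O> \<Longrightarrow> b \<in> \<O> \<Longrightarrow> a * b \<in> P \<Longrightarrow> a \<in> P \<or> b \<in> P"
  using assms unfolding prime_ideals_iff by auto

lemma prime_power:
  assumes "P \<in> prime_ideals L" "a \<in> \<O>" "a ^ n \<in> P" shows "a \<in> P"
  using assms(3)
proof (induction n)
  case 0 thus ?case using primeD(4)[OF assms(1)] by simp
next
  case (Suc n) thus ?case using primeD(5)[OF assms(1,2), of "a ^ n"] O_power[OF assms(2)] by auto
qed

lemma prime_prod:
  assumes "P \<in> prime_ideals L" "finite A" "\<And>i. i \<in> A \<Longrightarrow> f i \<in> \<O>" "prod f A \<in> P"
  shows "\<exists>i\<in>A. f i \<in> P"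
  using assms(2-)
proof (induction A rule: finite_induct)
  case empty thus ?case using primeD(4)[OF assms(1)] by simp
next
  case (insert i A)
  have "prod f A \<in> \<O>" using insert.prems by (intro O_prod) auto
  hence "f i \<in> P \<or> prod f A \<in> P"
    using insert primeD(5)[OF assms(1), of "f i" "prod f A"] by auto
  thus ?case using insert by auto
qed

definition isum :: "complex set \<Rightarrow> complex set \<Rightarrow> complex set" where
  "isum I J = {x + y | x y. x \<in> I \<and> y \<in> J}"

lemma is_mod_isum:
  assumes I: "is_mod I" and J: "is_mod J"
  shows "is_mod (isum I J)" "I \<subseteq> isum I J" "J \<subseteq> isum I J"
proof -
  show "I \<subseteq> isum I J" "J \<subseteq> isum I J"
    using is_modD(4)[OF I] is_modD(4)[OF J] by (force simp: isum_def)+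
  show "is_mod (isum I J)"
  proof (rule is_modI)
    show "isum I J \<subseteq> L" using is_modD(2)[OF I] is_modD(2)[OF J] L_add by (force simp: isum_def)
    show "0 \<in> isum I J" using \<open>I \<subseteq> isum I J\<close> is_modD(4)[OF I] by auto
    fix a x assume "x \<in> isum I J"
    then obtain u v where uv: "x = u + v" "u \<in> I" "v \<in> J" by (auto simp: isum_def)
    show "a * x \<in> isum I J" if "a \<in> \<O>"
      using is_modD(3)[OF I that uv(2)] is_modD(3)[OF J that uv(3)]
      by (auto simp: isum_def uv(1) distrib_left)
    show "x + y \<in> isum I J" if y: "y \<in> isum I J" for y
    proof -
      obtain u' v' where uv': "y = u' + v'" "u' \<in> I" "v' \<in> J" using y by (auto simp: isum_def)
      have "x + y = (u + u') + (v + v')" by (simp add: uv uv')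
      thus ?thesis using is_modD(5)[OF I uv(2) uv'(2)] is_modD(5)[OF J uv(3) uv'(3)]
        unfolding isum_def by blast
    qed
  qed
qed

lemma isum_subset_O: "I \<subseteq> \<O> \<Longrightarrow> J \<subseteq> \<O> \<Longrightarrow> isum I J \<subseteq> \<O>"
  by (auto simp: isum_def intro: O_add)

text \<open>The ideals \<open>P + (a ^ k)\<close> all contain a fixed positive integer, so two of
  them coincide. This gives \<open>b\<close> with \<open>a ^ k * (1 - b * a ^ (j - k))\<close> in
  \<open>P\<close>; as \<open>a\<close> is not in \<open>P\<close>, the second factor is, and so
  \<open>a\<close> is invertible modulo \<open>P\<close>.\<close>

lemma prime_maximal:
  assumes P: "P \<in> prime_ideals L" and I: "is_mod I" "P \<subseteq> I" "a \<in> I" "a \<notin> P" "a \<in> \<O>"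
  shows "1 \<in> I"
proof -
  note PD = primeD[OF P]
  obtain m :: nat where m: "m > 0" "of_nat m \<in> P" using O_multiple_in[OF PD(1-3)] .
  define J where "J = (\<lambda>k. isum P (principal_ideal L (a ^ k)))"
  have pm: "is_mod (principal_ideal L (a ^ k))" for k
    using is_mod_principal[OF L_power] I(5) O_subset by auto
  have JM: "is_mod (J k)" and PJ: "P \<subseteq> J k" for k
    using is_mod_isum[OF PD(1) pm] by (auto simp: J_def)
  have JO: "J k \<subseteq> \<O>" for k
    unfolding J_def
    using principal_subset[OF is_mod_O, of "a ^ k"] O_power[OF I(5)] PD(2) by (intro isum_subset_O) auto
  have mJ: "of_nat m * x \<in> J k" if "x \<in> \<O>" for k x
    using is_modD(3)[OF JM that, of "of_nat m"] m PJ by (auto simp: mult.commute)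
  obtain k j where kj: "k < j" "J k = J j"
    by (rule L_subgroup_chain_repeat[OF O_subspace O_subset m(1) is_modD(1)[OF JM] mJ JO])
  have "a ^ k \<in> principal_ideal L (a ^ k)" using principal_subset[OF pm, of "a ^ k" k] by blast
  hence "a ^ k \<in> J j" unfolding kj(2)[symmetric]
    using is_mod_isum(3)[OF PD(1) pm] by (auto simp: J_def)
  then obtain p b where pb: "p \<in> P" "b \<in> \<O>" "a ^ k = p + b * a ^ j"
    by (auto simp: J_def isum_def principal_ideal_def)
  have "a ^ j = a ^ k * a ^ (j - k)" using kj by (simp flip: power_add)
  hence "p = a ^ k * (1 - b * a ^ (j - k))" using pb(3) by (simp add: algebra_simps)
  moreover have "1 - b * a ^ (j - k) \<in> \<O>" using pb I(5) by (intro O_diff O_mult O_1 O_power)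
  ultimately have "1 - b * a ^ (j - k) \<in> P"
    using PD(5)[OF O_power[OF I(5)]] pb(1) prime_power[OF P I(5)] I(4) by blast
  moreover have "b * a ^ (j - k) \<in> I"
  proof -
    have "a ^ (j - k) = a ^ (j - k - 1) * a" using kj by (metis Suc_diff_1 power_Suc2 zero_less_diff)
    hence "b * a ^ (j - k) = (b * a ^ (j - k - 1)) * a" by (simp add: mult.assoc)
    thus ?thesis using is_modD(3)[OF I(1) O_mult[OF pb(2) O_power[OF I(5)]] I(3)] by metis
  qed
  ultimately have "(1 - b * a ^ (j - k)) + b * a ^ (j - k) \<in> I"
    using I(2) by (intro is_modD(5)[OF I(1)]) auto
  thus ?thesis by simp
qed

lemma prime_incl_eq:
  assumes "P \<in> prime_ideals L" "Q \<in> prime_ideals L" "P \<subseteq> Q" shows "P = Q"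
  using prime_maximal[OF assms(1) primeD(1)[OF assms(2)] assms(3)] primeD(2,4)[OF assms(2)] assms(3) by blast

text \<open>The ring \<open>\<O>[1/x]\<close> has only finitely many subgroups that contain a given positive integer
  multiple of it, so the chain of its subgroups \<open>x\<^sup>-\<^sup>k \<O>[1/x]\<close> is not strictly decreasing.\<close>

lemma almost_integral:
  assumes x: "x \<in> L" and m: "(m::nat) > 0" "\<And>k. of_nat m * x ^ k \<in> \<O>"
  shows "x \<in> \<O>"
proof (cases "x = 0")
  case True thus ?thesis by (simp add: O_0)
next
  case False
  define w where "w = inverse x"
  have w: "w \<noteq> 0" "w \<in> L" using False x L_inverse by (auto simp: w_def)
  define R where "R = {poly g w | g. \<forall>i. poly.coeff g i \<in> \<O>}"
  have R_add: "u + v \<in> R" if uv: "u \<in> R" "v \<in> R" for u v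
  proof -
    obtain g h where "u = poly g w" "v = poly h w" "\<forall>i. poly.coeff g i \<in> \<O>" "\<forall>i. poly.coeff h i \<in> \<O>"
      using uv unfolding R_def by blast
    thus ?thesis unfolding R_def by (intro CollectI exI[of _ "g + h"]) (auto intro: O_add)
  qed
  have R_mult: "u * v \<in> R" if uv: "u \<in> R" "v \<in> R" for u v
  proof -
    obtain g h where "u = poly g w" "v = poly h w" "\<forall>i. poly.coeff g i \<in> \<O>" "\<forall>i. poly.coeff h i \<in> \<O>"
      using uv unfolding R_def by blast
    thus ?thesis unfolding R_def
      by (intro CollectI exI[of _ "g * h"])
         (auto simp: coeff_mult intro!: zm.subspace_sum[OF O_subspace] O_mult)
  qed
  have R_O: "a \<in> R" if "a \<in> \<O>" for a
    unfolding R_def using that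
    by (intro CollectI exI[of _ "[:a:]"]) (auto simp: coeff_pCons O_0 split: nat.splits)
  have R_w: "w \<in> R"
    unfolding R_def
    by (intro CollectI exI[of _ "[:0, 1:]"]) (auto simp: coeff_pCons O_0 O_1 split: nat.splits)
  have R_wk: "w ^ k \<in> R" for k by (induction k) (auto intro: R_mult R_w R_O O_1)
  have R_sub: "zm.subspace R"
    using R_O O_0 R_add R_mult O_Ints by (intro zm.subspaceI) auto
  have RL: "R \<subseteq> L"
  proof
    fix u assume "u \<in> R"
    then obtain g where g: "u = poly g w" "\<forall>i. poly.coeff g i \<in> \<O>" unfolding R_def by blast
    show "u \<in> L" unfolding g(1) poly_altdef
      using g(2) O_subset w(2) by (intro zm.subspace_sum[OF L_subspace] L_mult L_power) auto
  qed
  define J where "J = (\<lambda>k. (\<lambda>a. w ^ k * a) ` R)"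
  have J_sub: "zm.subspace (J k)" for k
  proof (rule zm.subspaceI)
    show "0 \<in> J k" unfolding J_def using zm.subspace_0[OF R_sub] by (intro image_eqI[of _ _ 0]) auto
    show "u + v \<in> J k" if "u \<in> J k" "v \<in> J k" for u v
      using that unfolding J_def by (auto simp: distrib_left[symmetric] intro!: imageI R_add)
    show "of_int c * u \<in> J k" if "u \<in> J k" for u c
      using that unfolding J_def
      by (auto simp: mult.left_commute[of "of_int c"] intro!: imageI zm.subspace_scale[OF R_sub])
  qed
  \<comment> \<open>The common denominator \<open>m\<close> of all powers of \<open>x\<close> is
    exactly what puts \<open>m R\<close> into every \<open>J k\<close>.\<close>
  have mJ: "of_nat m * a \<in> J k" if "a \<in> R" for k a
  proof -
    have "of_nat m * a = w ^ k * ((of_nat m * x ^ k) * a)"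
      using False by (simp add: w_def field_simps)
    thus ?thesis unfolding J_def using R_mult[OF R_O[OF m(2)[of k]] that] by (rule image_eqI)
  qed
  have JR: "J k \<subseteq> R" for k
    using R_mult[OF R_wk] by (auto simp: J_def)
  obtain k j where kj: "k < j" "J k = J j"
    by (rule L_subgroup_chain_repeat[OF R_sub RL m(1) J_sub mJ JR])
  have "w ^ k \<in> J k" unfolding J_def using R_O[OF O_1] by (intro image_eqI[of _ _ 1]) auto
  then obtain a where a: "a \<in> R" "w ^ k = w ^ j * a" unfolding kj(2) by (auto simp: J_def)
  \<comment> \<open>Cancelling \<open>w ^ k\<close> in the coincidence of \<open>J k\<close> and
    \<open>J j\<close> expresses \<open>x\<close> as an element of \<open>R\<close>, that is, as a
    polynomial in its own inverse.\<close>
  have "w ^ j = w ^ k * w ^ (j - k - 1) * w" using kj by (simp flip: power_add power_Suc2)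
  hence "w ^ k = w ^ k * (w ^ (j - k - 1) * w * a)" using a(2) by (simp add: mult_ac)
  hence "w ^ (j - k - 1) * w * a = 1" using w by simp
  hence "x = w ^ (j - k - 1) * a" using False by (simp add: w_def field_simps)
  hence "x \<in> R" using R_mult R_wk a(1) by simp
  then obtain g where g: "x = poly g w" "\<forall>i. poly.coeff g i \<in> \<O>" unfolding R_def by blast
  define n where "n = Polynomial.degree g"
  \<comment> \<open>Multiplying \<open>x = g (1 / x)\<close> by \<open>x ^ n\<close> gives a monic
    equation in which the coefficients of \<open>g\<close> appear in reverse order.\<close>
  define h where "h = Polynomial.monom 1 (Suc n) - (\<Sum>i\<le>n. Polynomial.monom (poly.coeff g (n - i)) i)"
  have ch: "poly.coeff h i = (if i = Suc n then 1 else if i \<le> n then - poly.coeff g (n - i) else 0)" for i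
    by (auto simp: h_def coeff_sum)
  have deg: "Polynomial.degree h = Suc n"
    by (rule antisym) (auto intro!: degree_le le_degree simp: ch)
  have "x ^ Suc n = x ^ n * poly g w" using g(1) by simp
  also have "\<dots> = (\<Sum>i\<le>n. x ^ n * (poly.coeff g i * w ^ i))"
    by (simp add: poly_altdef n_def sum_distrib_left)
  also have "\<dots> = (\<Sum>i\<le>n. poly.coeff g i * x ^ (n - i))"
  proof (rule sum.cong)
    fix i assume "i \<in> {..n}"
    hence "x ^ n = x ^ (n - i) * x ^ i" by (simp flip: power_add)
    moreover have "x ^ i * w ^ i = 1" using False by (simp add: w_def flip: power_mult_distrib)
    ultimately show "x ^ n * (poly.coeff g i * w ^ i) = poly.coeff g i * x ^ (n - i)"
      by (simp add: mult_ac)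
  qed simp
  also have "\<dots> = (\<Sum>i\<le>n. poly.coeff g (n - i) * x ^ i)"
    using sum.nat_diff_reindex[of "\<lambda>i. poly.coeff g i * x ^ (n - i)" "Suc n"]
    by (simp add: lessThan_Suc_atMost)
  finally have "poly h x = 0" by (simp add: h_def poly_sum poly_monom)
  moreover have "algebraic_int (poly.coeff h i)" for i
    using g(2) by (auto simp: ch ints_of_def intro: int_imp_algebraic_int)
  moreover have "lead_coeff h = 1" by (simp add: deg ch)
  ultimately have "algebraic_int x" using algebraic_int_integral[of h x] by simp
  thus ?thesis using x by (simp add: ints_of_def)
qed

end

section \<open>Unique factorization of fractional ideals\<close>

context number_field
begin

text \<open>\<open>P\<close> is an associated prime of \<open>\<O>/m\<O>\<close>: it is a maximal one among the annihilators of
  elements of \<open>\<O>/m\<O>\<close> that are contained in \<open>P\<close>.\<close>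

lemma prime_colon:
  assumes P: "P \<in> prime_ideals L"
  obtains x where "x \<in> L" "x \<notin> \<O>" "\<And>b. b \<in> P \<Longrightarrow> b * x \<in> \<O>"
proof -
  note PD = primeD[OF P]
  obtain m :: nat where m: "m > 0" "of_nat m \<in> P" using O_multiple_in[OF PD(1-3)] .
  \<comment> \<open>For \<open>x = y / m\<close>, this is the annihilator of the class of
    \<open>y\<close> in the quotient of \<open>\<O>\<close> by \<open>m\<close>.\<close>
  define colon where "colon = (\<lambda>x. {b \<in> \<O>. b * x \<in> \<O>})"
  have colon_mod: "is_mod (colon x)" for x
    by (rule is_modI) (use O_subset in \<open>auto simp: colon_def O_0 O_add distrib_right O_mult mult.assoc\<close>)
  have colon_O: "colon x \<subseteq> \<O>" for x by (auto simp: colon_def)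
  define F where "F = {colon (y / of_nat m) | y. y \<in> \<O> \<and> colon (y / of_nat m) \<subseteq> P}"
  have mO: "of_nat m \<in> \<O>" by (rule O_Ints) auto
  have m_colon: "of_nat m \<in> colon (y / of_nat m)" if "y \<in> \<O>" for y
    using that m(1) mO by (simp add: colon_def)
  have "F \<subseteq> {I. is_mod I \<and> I \<subseteq> \<O> \<and> of_nat m \<in> I}"
    using colon_mod m_colon colon_O unfolding F_def by blast
  hence "finite F" by (rule finite_subset) (rule finite_ideals_containing[OF m(1)])
  \<comment> \<open>The class of 1 is annihilated only by multiples of \<open>m\<close>, which lie
    in \<open>P\<close>; so there is an annihilator to start from.\<close>
  moreover have "colon (1 / of_nat m) \<subseteq> P"
  proof
    fix b assume "b \<in> colon (1 / of_nat m)"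
    hence "b / of_nat m \<in> \<O>" by (simp add: colon_def)
    from is_modD(3)[OF PD(1) this m(2)] show "b \<in> P" using m(1) by simp
  qed
  hence "F \<noteq> {}" using O_1 by (auto simp: F_def)
  ultimately obtain A where A: "A \<in> F" "\<And>A'. A' \<in> F \<Longrightarrow> A \<subseteq> A' \<Longrightarrow> A = A'"
    using finite_has_maximal[of F] by blast
  then obtain y where y: "y \<in> \<O>" "A = colon (y / of_nat m)" "A \<subseteq> P" by (auto simp: F_def)
  define x where "x = y / of_nat m"
  have Ax: "A = colon x" by (simp add: y x_def)
  \<comment> \<open>Passing from \<open>x\<close> to \<open>d * x\<close> can only enlarge the
    annihilator, so by maximality of \<open>A\<close> it stays the same as long as it remains inside
    \<open>P\<close>.\<close>
  have step: "colon (d * x) = A" if d: "d \<in> \<O>" "colon (d * x) \<subseteq> P" for d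
  proof -
    have "colon (d * x) = colon ((d * y) / of_nat m)" by (simp add: x_def)
    moreover have "d * y \<in> \<O>" using d y by (intro O_mult)
    ultimately have "colon (d * x) \<in> F" using d(2) unfolding F_def by auto
    moreover have "A \<subseteq> colon (d * x)"
    proof
      fix b assume "b \<in> A"
      hence "b \<in> \<O>" "d * (b * x) \<in> \<O>" using O_mult[OF d(1)] by (auto simp: Ax colon_def)
      thus "b \<in> colon (d * x)" by (simp add: colon_def mult.left_commute)
    qed
    ultimately show ?thesis using A(2) by blast
  qed
  have "A \<in> prime_ideals L"
    unfolding prime_ideals_iff
  proof (intro conjI ballI impI)
    show "is_mod A" by (simp add: Ax colon_mod)
    show "A \<subseteq> \<O>" by (auto simp: Ax colon_def)
    show "A \<noteq> {0}" using m_colon[OF y(1)] m(1) by (auto simp: y(2))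
    show "1 \<notin> A" using PD(4) y(3) by auto
    fix b c assume b: "b \<in> \<O>" and c: "c \<in> \<O>" and bc: "b * c \<in> A"
    show "b \<in> A \<or> c \<in> A"
    \<comment> \<open>If \<open>colon (b * x)\<close> is not inside \<open>P\<close>, an element
      \<open>d\<close> of it outside \<open>P\<close> is used instead: primality of \<open>P\<close>
      keeps \<open>colon (d * x)\<close> inside \<open>P\<close>, and \<open>b\<close> belongs to
      it.\<close>
    proof (cases "colon (b * x) \<subseteq> P")
      case True
      have "c \<in> colon (b * x)" using bc c by (auto simp: Ax colon_def mult_ac)
      thus ?thesis using step[OF b True] by simp
    next
      case False
      then obtain d where d: "d \<in> colon (b * x)" "d \<notin> P" by auto
      hence dO: "d \<in> \<O>" by (simp add: colon_def)
      have "colon (d * x) \<subseteq> P"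
      proof
        fix u assume "u \<in> colon (d * x)"
        hence u: "u \<in> \<O>" "u * d \<in> colon x" using dO by (auto simp: colon_def O_mult mult.assoc)
        hence "u * d \<in> P" using y(3) Ax by auto
        thus "u \<in> P" using PD(5)[OF u(1) dO] d(2) by blast
      qed
      moreover have "b \<in> colon (d * x)" using d(1) b by (simp add: colon_def mult_ac)
      ultimately show ?thesis using step[OF dO] by simp
    qed
  qed
  hence AP: "A = P" using prime_incl_eq[OF _ P y(3)] by simp
  have "x \<in> L" unfolding x_def using y(1) mO O_subset by (intro L_divide) auto
  moreover have "x \<notin> \<O>" using PD(4) O_1 unfolding AP[symmetric] Ax by (auto simp: colon_def)
  moreover have "b * x \<in> \<O>" if "b \<in> P" for b
    using that unfolding AP[symmetric] Ax by (simp add: colon_def)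
  ultimately show ?thesis by (rule that)
qed

text \<open>With a positive integer \<open>m\<close> in \<open>I\<close>, all
  \<open>m * x ^ k\<close> stay in \<open>I\<close> and are integral, so the powers of
  \<open>x\<close> have bounded denominators.\<close>

lemma O_if_stabilizes_ideal:
  assumes I: "is_mod I" "I \<subseteq> \<O>" "I \<noteq> {0}" and x: "x \<in> L" "\<And>b. b \<in> I \<Longrightarrow> b * x \<in> I"
  shows "x \<in> \<O>"
proof -
  obtain m :: nat where m: "m > 0" "of_nat m \<in> I" using O_multiple_in[OF I] .
  have "of_nat m * x ^ k \<in> I" for k
  proof (induction k)
    case (Suc k)
    from x(2)[OF this] show ?case by (simp add: mult_ac)
  qed (use m in simp)
  thus ?thesis using almost_integral[OF x(1) m(1)] I(2) by blast
qed

definition pinv :: "complex set \<Rightarrow> complex set" where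
  "pinv P = {z \<in> L. \<forall>b\<in>P. b * z \<in> \<O>}"

lemma is_mod_pinv: "is_mod (pinv P)"
proof (rule is_modI)
  fix a x assume "a \<in> \<O>" "x \<in> pinv P"
  thus "a * x \<in> pinv P" using O_subset O_mult
    by (auto simp: pinv_def mult.left_commute[of _ a] intro!: L_mult)
qed (auto simp: pinv_def L_0 L_add O_0 O_add distrib_left)

text \<open>The product lies between \<open>P\<close> and \<open>\<O>\<close>, so by maximality it
  is one of the two. It is not \<open>P\<close>, because the nonintegral element given by
  \<open>prime_colon\<close> would then stabilize \<open>P\<close>.\<close>

lemma iprod_pinv:
  assumes P: "P \<in> prime_ideals L"
  shows "iprod P (pinv P) = \<O>"
proof -
  note PD = primeD[OF P]
  define M where "M = iprod P (pinv P)"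
  have M: "is_mod M" unfolding M_def by (intro is_mod_iprod PD is_mod_pinv)
  have MO: "M \<subseteq> \<O>" unfolding M_def by (intro iprod_subset_mod is_mod_O) (auto simp: pinv_def)
  have "1 \<in> pinv P" using PD(2) L_1 by (auto simp: pinv_def)
  hence PM: "P \<subseteq> M" unfolding M_def using iprod_mult[of _ P 1 "pinv P"] by auto
  have "1 \<in> M"
  proof (rule ccontr)
    assume "1 \<notin> M"
    hence MP: "M \<subseteq> P" using prime_maximal[OF P M PM] MO by blast
    obtain x where x: "x \<in> L" "x \<notin> \<O>" "\<And>b. b \<in> P \<Longrightarrow> b * x \<in> \<O>" using prime_colon[OF P] by blast
    have "b * x \<in> P" if "b \<in> P" for b
      using iprod_mult[of b P x "pinv P"] that x MP by (auto simp: pinv_def M_def)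
    thus False using O_if_stabilizes_ideal[OF PD(1-3) x(1)] x(2) by blast
  qed
  hence "\<O> \<subseteq> M" using is_modD(3)[OF M, of _ 1] by auto
  thus ?thesis using MO by (simp add: M_def)
qed

definition iprod_list :: "complex set list \<Rightarrow> complex set" where
  "iprod_list Ps = foldr iprod Ps \<O>"

lemma iprod_list_simps [simp]: "iprod_list [] = \<O>" "iprod_list (P # Ps) = iprod P (iprod_list Ps)"
  by (simp_all add: iprod_list_def)

lemma maximal_is_prime:
  assumes M: "is_mod M" "M \<subseteq> \<O>" "M \<noteq> {0}" "1 \<notin> M"
    and max: "\<And>J. is_mod J \<Longrightarrow> J \<subseteq> \<O> \<Longrightarrow> M \<subseteq> J \<Longrightarrow> 1 \<notin> J \<Longrightarrow> J = M"
  shows "M \<in> prime_ideals L"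
  unfolding prime_ideals_iff
proof (intro conjI ballI impI M)
  fix a b assume a: "a \<in> \<O>" and b: "b \<in> \<O>" and ab: "a * b \<in> M"
  show "a \<in> M \<or> b \<in> M"
  proof (rule disjCI)
    assume nb: "b \<notin> M"
    have pm: "is_mod (principal_ideal L b)" using b O_subset by (intro is_mod_principal) auto
    note S = is_mod_isum[OF M(1) pm]
    have "b \<in> principal_ideal L b" using principal_subset[OF pm, of b] by blast
    hence "isum M (principal_ideal L b) \<noteq> M" using S(3) nb by blast
    moreover have "isum M (principal_ideal L b) \<subseteq> \<O>"
      using M(2) principal_subset[OF is_mod_O, of b] b by (intro isum_subset_O) auto
    ultimately have "1 \<in> isum M (principal_ideal L b)" using max[OF S(1) _ S(2)] by blast
    then obtain u c where uc: "1 = u + c * b" "u \<in> M" "c \<in> \<O>"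
      by (auto simp: isum_def principal_ideal_def)
    have "a = a * (u + c * b)" by (simp flip: uc(1))
    also have "\<dots> = a * u + c * (a * b)" by (simp add: algebra_simps)
    also have "\<dots> \<in> M"
      by (intro is_modD(5)[OF M(1)] is_modD(3)[OF M(1) a uc(2)] is_modD(3)[OF M(1) uc(3) ab])
    finally show "a \<in> M" .
  qed
qed

lemma ideal_in_prime:
  assumes I: "is_mod I" "I \<subseteq> \<O>" "I \<noteq> {0}" "1 \<notin> I"
  obtains P where "P \<in> prime_ideals L" "I \<subseteq> P"
proof -
  obtain m :: nat where m: "m > 0" "of_nat m \<in> I" using O_multiple_in[OF I(1-3)] .
  define F where "F = {J. is_mod J \<and> J \<subseteq> \<O> \<and> I \<subseteq> J \<and> 1 \<notin> J}"
  have "finite F"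
    by (rule finite_subset[OF _ finite_ideals_containing[OF m(1)]]) (use m in \<open>auto simp: F_def\<close>)
  moreover have "I \<in> F" using I by (auto simp: F_def)
  ultimately have "\<exists>M\<in>F. I \<subseteq> M \<and> (\<forall>J\<in>F. M \<subseteq> J \<longrightarrow> M = J)" by (rule finite_has_maximal2)
  then obtain M where M: "M \<in> F" "I \<subseteq> M" "\<And>J. J \<in> F \<Longrightarrow> M \<subseteq> J \<Longrightarrow> M = J"
    by auto
  have "M \<in> prime_ideals L"
  proof (rule maximal_is_prime)
    show "M \<noteq> {0}" using M(2) I(3) is_modD(4)[OF I(1)] by blast
    show "J = M" if "is_mod J" "J \<subseteq> \<O>" "M \<subseteq> J" "1 \<notin> J" for J
      using M(3)[of J] that M(2) by (auto simp: F_def)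
  qed (use M(1) in \<open>auto simp: F_def\<close>)
  thus ?thesis using that M(2) by blast
qed

text \<open>Induction on the number of ideals that contain \<open>I\<close>, which is finite since
  \<open>I\<close> contains a positive integer. Multiplying \<open>I\<close> by
  \<open>pinv P\<close> for a prime \<open>P\<close> containing it enlarges \<open>I\<close>
  strictly, because a nonintegral element cannot stabilize \<open>I\<close>.\<close>

lemma ideal_factorization:
  assumes "is_mod I" "I \<subseteq> \<O>" "I \<noteq> {0}"
  shows "\<exists>Ps. set Ps \<subseteq> prime_ideals L \<and> I = iprod_list Ps"
  using assms
proof (induction "card {J. is_mod J \<and> J \<subseteq> \<O> \<and> I \<subseteq> J}" arbitrary: I rule: less_induct)
  case less
  note I = less.prems
  show ?case
  proof (cases "1 \<in> I")
    case True
    hence "\<O> \<subseteq> I" using is_modD(3)[OF I(1), of _ 1] by auto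
    hence "I = iprod_list []" using I(2) by simp
    moreover have "set [] \<subseteq> prime_ideals L" by simp
    ultimately show ?thesis by (intro exI conjI)
  next
    case False
    obtain P where P: "P \<in> prime_ideals L" "I \<subseteq> P" using ideal_in_prime[OF I False] .
    note PD = primeD[OF P(1)]
    define J where "J = iprod I (pinv P)"
    have J: "is_mod J" unfolding J_def by (intro is_mod_iprod I is_mod_pinv)
    have JO: "J \<subseteq> \<O>" unfolding J_def using P(2) by (intro iprod_subset_mod is_mod_O) (auto simp: pinv_def)
    have "1 \<in> pinv P" using PD(2) L_1 by (auto simp: pinv_def)
    hence IJ: "I \<subseteq> J" unfolding J_def using iprod_mult[of _ I 1 "pinv P"] by auto
    have "J \<noteq> {0}" using IJ I(3) is_modD(4)[OF I(1)] by blast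
    have "J \<noteq> I"
    proof
      assume JI: "J = I"
      obtain x where x: "x \<in> L" "x \<notin> \<O>" "\<And>b. b \<in> P \<Longrightarrow> b * x \<in> \<O>" using prime_colon[OF P(1)] by blast
      have "b * x \<in> I" if "b \<in> I" for b
        using iprod_mult[of b I x "pinv P"] that x JI by (auto simp: pinv_def J_def)
      thus False using O_if_stabilizes_ideal[OF I x(1)] x(2) by blast
    qed
    obtain m :: nat where m: "m > 0" "of_nat m \<in> I" using O_multiple_in[OF I] .
    have "finite {J. is_mod J \<and> J \<subseteq> \<O> \<and> I \<subseteq> J}"
      by (rule finite_subset[OF _ finite_ideals_containing[OF m(1)]]) (use m in auto)
    moreover have "{J'. is_mod J' \<and> J' \<subseteq> \<O> \<and> J \<subseteq> J'} \<subset> {J'. is_mod J' \<and> J' \<subseteq> \<O> \<and> I \<subseteq> J'}"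
      using IJ I(1,2) \<open>J \<noteq> I\<close> by auto
    ultimately have "card {J'. is_mod J' \<and> J' \<subseteq> \<O> \<and> J \<subseteq> J'} < card {J'. is_mod J' \<and> J' \<subseteq> \<O> \<and> I \<subseteq> J'}"
      by (rule psubset_card_mono)
    from less.hyps[OF this J JO \<open>J \<noteq> {0}\<close>] obtain Ps where Ps: "set Ps \<subseteq> prime_ideals L" "J = iprod_list Ps"
      by blast
    have "iprod P J = iprod (iprod P (pinv P)) I"
      unfolding J_def by (metis iprod_assoc iprod_commute)
    also have "\<dots> = I" by (simp add: iprod_pinv[OF P(1)] iprod_O I)
    finally have "I = iprod_list (P # Ps)" using Ps by simp
    thus ?thesis using Ps P by (intro exI[of _ "P # Ps"]) auto
  qed
qed

section \<open>The group of fractional ideals\<close>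

lemma fractional_ideal_iff:
  "fractional_ideal L I \<longleftrightarrow> is_mod I \<and> I \<noteq> {0} \<and> (\<exists>d\<in>\<O> - {0}. \<forall>y\<in>I. d * y \<in> \<O>)"
  unfolding fractional_ideal_def is_mod_def subalgebra_def subalgebra_axioms_def additive_subgroup_complex_iff
  by auto

lemma fractional_mod: "fractional_ideal L I \<Longrightarrow> is_mod I"
  by (simp add: fractional_ideal_iff)

lemma fractional_if_integral:
  "is_mod I \<Longrightarrow> I \<subseteq> \<O> \<Longrightarrow> I \<noteq> {0} \<Longrightarrow> fractional_ideal L I"
  unfolding fractional_ideal_iff using O_1 by (intro conjI bexI[of _ 1]) auto

lemma fractional_O: "fractional_ideal L \<O>"
  using O_1 by (intro fractional_if_integral is_mod_O) auto

lemma fractional_prime: "P \<in> prime_ideals L \<Longrightarrow> fractional_ideal L P"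
  by (intro fractional_if_integral primeD)

lemma fractional_pinv:
  assumes P: "P \<in> prime_ideals L"
  shows "fractional_ideal L (pinv P)"
proof -
  obtain m :: nat where m: "m > 0" "of_nat m \<in> P" using O_multiple_in[OF primeD(1-3)[OF P]] .
  have "1 \<in> pinv P" using primeD(2)[OF P] L_1 by (auto simp: pinv_def)
  hence "pinv P \<noteq> {0}" by auto
  moreover have "of_nat m \<in> \<O> - {0}" using m primeD(2)[OF P] by auto
  moreover have "\<forall>y\<in>pinv P. of_nat m * y \<in> \<O>" using m by (auto simp: pinv_def)
  ultimately show ?thesis using is_mod_pinv unfolding fractional_ideal_iff by blast
qed

lemma fractional_iprod:
  assumes "fractional_ideal L I" "fractional_ideal L J"
  shows "fractional_ideal L (iprod I J)"
proof -
  from assms have I: "is_mod I" "I \<noteq> {0}" and J: "is_mod J" "J \<noteq> {0}"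
    by (auto simp: fractional_ideal_iff)
  obtain d where d: "d \<in> \<O> - {0}" "\<And>y. y \<in> I \<Longrightarrow> d * y \<in> \<O>"
    using assms(1) by (auto simp: fractional_ideal_iff)
  obtain e where e: "e \<in> \<O> - {0}" "\<And>y. y \<in> J \<Longrightarrow> e * y \<in> \<O>"
    using assms(2) by (auto simp: fractional_ideal_iff)
  obtain a b where "a \<in> I" "a \<noteq> 0" "b \<in> J" "b \<noteq> 0"
    using I J is_modD(4)[OF I(1)] is_modD(4)[OF J(1)] by blast
  hence "a * b \<in> iprod I J" "a * b \<noteq> 0" by (auto intro: iprod_mult)
  hence "iprod I J \<noteq> {0}" by blast
  moreover have "(d * e) * y \<in> \<O>" if "y \<in> iprod I J" for y
    using that
  proof (induction rule: iprod_induct)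
    case (mult u v)
    have "(d * u) * (e * v) \<in> \<O>" using d(2)[OF mult(1)] e(2)[OF mult(2)] by (rule O_mult)
    thus ?case by (simp add: mult_ac)
  qed (auto simp: distrib_left intro: O_add)
  moreover have "d * e \<in> \<O> - {0}" using d e O_mult by auto
  ultimately show ?thesis
    unfolding fractional_ideal_iff using is_mod_iprod[OF I(1) J(1)] by blast
qed

lemma fractional_principal:
  assumes "x \<in> L" "x \<noteq> 0"
  shows "fractional_ideal L (principal_ideal L x)"
proof -
  obtain m :: nat where m: "m > 0" "of_nat m * x \<in> \<O>" using O_multiple[OF assms(1)] .
  have pm: "is_mod (principal_ideal L x)" by (rule is_mod_principal[OF assms(1)])
  have "x \<in> principal_ideal L x" using principal_subset[OF pm, of x] by blast
  hence "principal_ideal L x \<noteq> {0}" using assms(2) by auto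
  moreover have "of_nat m \<in> \<O> - {0}" using m O_Ints by auto
  moreover have "\<forall>y\<in>principal_ideal L x. of_nat m * y \<in> \<O>"
    using m O_mult by (auto simp: principal_ideal_def mult.left_commute)
  ultimately show ?thesis using pm unfolding fractional_ideal_iff by blast
qed

lemma iprod_list_inverse:
  assumes "set Ps \<subseteq> prime_ideals L"
  shows "fractional_ideal L (iprod_list Ps)"
    "\<exists>J. fractional_ideal L J \<and> iprod J (iprod_list Ps) = \<O>"
proof -
  have "fractional_ideal L (iprod_list Ps) \<and> (\<exists>J. fractional_ideal L J \<and> iprod J (iprod_list Ps) = \<O>)"
    using assms
  proof (induction Ps)
    case Nil thus ?case using fractional_O iprod_O[OF is_mod_O] by auto
  next
    case (Cons P Ps)
    then obtain J where J: "fractional_ideal L J" "iprod J (iprod_list Ps) = \<O>" "P \<in> prime_ideals L"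
      "fractional_ideal L (iprod_list Ps)"
      by auto
    have "iprod (iprod J (pinv P)) (iprod P (iprod_list Ps)) = iprod (iprod P (pinv P)) (iprod J (iprod_list Ps))"
      by (metis iprod_assoc iprod_commute)
    also have "\<dots> = \<O>" by (simp add: J iprod_pinv iprod_O is_mod_O)
    finally have "iprod (iprod J (pinv P)) (iprod_list (P # Ps)) = \<O>" by simp
    thus ?case
      using J fractional_iprod fractional_pinv fractional_prime by (intro conjI exI[of _ "iprod J (pinv P)"]) auto
  qed
  thus "fractional_ideal L (iprod_list Ps)"
    "\<exists>J. fractional_ideal L J \<and> iprod J (iprod_list Ps) = \<O>" by auto
qed

lemma fractional_denominator:
  assumes I: "fractional_ideal L I"
  obtains d Ps where "d \<in> \<O>" "d \<noteq> 0" "set Ps \<subseteq> prime_ideals L" "iprod (principal_ideal L d) I = iprod_list Ps"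
proof -
  obtain d where d: "d \<in> \<O>" "d \<noteq> 0" "\<And>y. y \<in> I \<Longrightarrow> d * y \<in> \<O>"
    using I by (auto simp: fractional_ideal_iff)
  have fr: "fractional_ideal L (iprod (principal_ideal L d) I)"
    using d O_subset by (intro fractional_iprod fractional_principal I) auto
  have "iprod (principal_ideal L d) I \<subseteq> \<O>"
  proof (rule iprod_subset_mod[OF _ is_mod_O])
    fix a b assume "a \<in> principal_ideal L d" "b \<in> I"
    thus "a * b \<in> \<O>" using d O_mult by (auto simp: principal_ideal_def mult.assoc)
  qed
  hence "\<exists>Ps. set Ps \<subseteq> prime_ideals L \<and> iprod (principal_ideal L d) I = iprod_list Ps"
    using fr by (intro ideal_factorization) (auto simp: fractional_ideal_iff)
  thus ?thesis using that d by blast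
qed

lemma fractional_inverse:
  assumes I: "fractional_ideal L I"
  shows "\<exists>J. fractional_ideal L J \<and> iprod J I = \<O>"
proof -
  obtain d Ps where d: "d \<in> \<O>" "d \<noteq> 0" "set Ps \<subseteq> prime_ideals L"
    "iprod (principal_ideal L d) I = iprod_list Ps"
    using fractional_denominator[OF I] .
  obtain J where J: "fractional_ideal L J" "iprod J (iprod_list Ps) = \<O>"
    using iprod_list_inverse(2)[OF d(3)] by blast
  have "iprod (iprod J (principal_ideal L d)) I = \<O>" using J(2) d(4) by (simp add: iprod_assoc)
  moreover have "fractional_ideal L (iprod J (principal_ideal L d))"
    using d O_subset by (intro fractional_iprod J fractional_principal) auto
  ultimately show ?thesis by blast
qed

abbreviation "\<I> \<equiv> ideal_group L"

lemma ideal_group_simps [simp]: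
  "carrier \<I> = {I. fractional_ideal L I}" "mult \<I> = iprod" "one \<I> = \<O>"
  by (simp_all add: ideal_group_def)

lemma ideal_group_comm_group: "comm_group \<I>"
proof (rule comm_groupI)
  show "\<exists>y\<in>carrier \<I>. y \<otimes>\<^bsub>\<I>\<^esub> x = \<one>\<^bsub>\<I>\<^esub>" if "x \<in> carrier \<I>" for x
    using fractional_inverse that by auto
  show "x \<otimes>\<^bsub>\<I>\<^esub> y = y \<otimes>\<^bsub>\<I>\<^esub> x" for x y by (simp add: iprod_commute)
  show "x \<otimes>\<^bsub>\<I>\<^esub> y \<otimes>\<^bsub>\<I>\<^esub> z = x \<otimes>\<^bsub>\<I>\<^esub> (y \<otimes>\<^bsub>\<I>\<^esub> z)" for x y z by (simp add: iprod_assoc)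
qed (simp_all add: fractional_iprod fractional_O iprod_O fractional_mod)

end

sublocale number_field \<subseteq> G: comm_group "ideal_group L"
  by (rule ideal_group_comm_group)

section \<open>Exponents in prime factorizations\<close>

context number_field
begin

text \<open>Together with \<open>prime_power_prod\<close> this restates the description under the
  \<open>THE\<close> in \<open>ideal_exponent\<close>.\<close>

definition valid_exponents :: "(complex set \<Rightarrow> int) \<Rightarrow> bool" where
  "valid_exponents a \<longleftrightarrow> finite {P. a P \<noteq> 0} \<and> {P. a P \<noteq> 0} \<subseteq> prime_ideals L"

definition prime_power_prod :: "(complex set \<Rightarrow> int) \<Rightarrow> complex set" where
  "prime_power_prod a = finprod \<I> (\<lambda>P. P [^]\<^bsub>\<I>\<^esub> (a P :: int)) {P. a P \<noteq> 0}"

lemma prime_int_pow_closed: "P \<in> prime_ideals L \<Longrightarrow> P [^]\<^bsub>\<I>\<^esub> (k :: int) \<in> carrier \<I>"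
  by (intro G.int_pow_closed) (simp add: fractional_prime)

lemma prime_power_prod_superset:
  assumes "finite S" "{P. a P \<noteq> 0} \<subseteq> S" "S \<subseteq> prime_ideals L"
  shows "prime_power_prod a = finprod \<I> (\<lambda>P. P [^]\<^bsub>\<I>\<^esub> (a P :: int)) S"
  unfolding prime_power_prod_def
  by (rule G.finprod_mono_neutral_cong_left)
     (use assms prime_int_pow_closed in \<open>auto simp del: ideal_group_simps simp: int_pow_0\<close>)

lemma prime_power_prod_closed: "valid_exponents a \<Longrightarrow> prime_power_prod a \<in> carrier \<I>"
  unfolding prime_power_prod_def valid_exponents_def
  by (rule G.finprod_closed) (use prime_int_pow_closed in \<open>auto simp del: ideal_group_simps\<close>)

lemma valid_exponents_subset:
  assumes "valid_exponents a" "valid_exponents b" "\<And>P. a P = 0 \<Longrightarrow> b P = 0 \<Longrightarrow> c P = 0"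
  shows "valid_exponents c"
proof -
  have "{P. c P \<noteq> 0} \<subseteq> {P. a P \<noteq> 0} \<union> {P. b P \<noteq> 0}" using assms(3) by auto
  moreover have "finite ({P. a P \<noteq> 0} \<union> {P. b P \<noteq> 0})" "{P. a P \<noteq> 0} \<union> {P. b P \<noteq> 0} \<subseteq> prime_ideals L"
    using assms(1,2) by (auto simp: valid_exponents_def)
  ultimately show ?thesis unfolding valid_exponents_def by (meson finite_subset subset_trans)
qed

lemma valid_exponents_add: "valid_exponents a \<Longrightarrow> valid_exponents b \<Longrightarrow> valid_exponents (\<lambda>P. a P + b P)"
  by (rule valid_exponents_subset[of a b]) auto

lemma valid_exponents_uminus: "valid_exponents a \<Longrightarrow> valid_exponents (\<lambda>P. - a P)"
  unfolding valid_exponents_def by auto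

lemma valid_exponents_single: "P \<in> prime_ideals L \<Longrightarrow> valid_exponents (\<lambda>Q. if Q = P then k else 0)"
  unfolding valid_exponents_def by (auto intro: finite_subset[of _ "{P}"])

lemma prime_power_prod_add:
  assumes a: "valid_exponents a" and b: "valid_exponents b"
  shows "prime_power_prod (\<lambda>P. a P + b P) = iprod (prime_power_prod a) (prime_power_prod b)"
proof -
  define S where "S = {P. a P \<noteq> 0} \<union> {P. b P \<noteq> 0}"
  have S: "finite S" "S \<subseteq> prime_ideals L" using a b by (auto simp: S_def valid_exponents_def)
  note cl = prime_int_pow_closed[OF subsetD[OF S(2)]]
  have "prime_power_prod (\<lambda>P. a P + b P) = finprod \<I> (\<lambda>P. P [^]\<^bsub>\<I>\<^esub> (a P + b P)) S"
    by (rule prime_power_prod_superset) (use S in \<open>auto simp: S_def\<close>)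
  also have "\<dots> = finprod \<I> (\<lambda>P. P [^]\<^bsub>\<I>\<^esub> a P \<otimes>\<^bsub>\<I>\<^esub> P [^]\<^bsub>\<I>\<^esub> b P) S"
  proof (rule G.finprod_cong')
    show "P [^]\<^bsub>\<I>\<^esub> (a P + b P) = P [^]\<^bsub>\<I>\<^esub> a P \<otimes>\<^bsub>\<I>\<^esub> P [^]\<^bsub>\<I>\<^esub> b P" if "P \<in> S" for P
      using that S(2) by (intro G.int_pow_mult) (auto intro: fractional_prime)
    show "(\<lambda>P. P [^]\<^bsub>\<I>\<^esub> a P \<otimes>\<^bsub>\<I>\<^esub> P [^]\<^bsub>\<I>\<^esub> b P) \<in> S \<rightarrow> carrier \<I>"
      using cl by (auto simp del: ideal_group_simps)
  qed simp
  also have "\<dots> = finprod \<I> (\<lambda>P. P [^]\<^bsub>\<I>\<^esub> a P) S \<otimes>\<^bsub>\<I>\<^esub> finprod \<I> (\<lambda>P. P [^]\<^bsub>\<I>\<^esub> b P) S"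
    by (rule G.finprod_multf) (use cl in \<open>auto simp del: ideal_group_simps\<close>)
  also have "finprod \<I> (\<lambda>P. P [^]\<^bsub>\<I>\<^esub> a P) S = prime_power_prod a"
    by (rule prime_power_prod_superset[symmetric]) (use S in \<open>auto simp: S_def\<close>)
  also have "finprod \<I> (\<lambda>P. P [^]\<^bsub>\<I>\<^esub> b P) S = prime_power_prod b"
    by (rule prime_power_prod_superset[symmetric]) (use S in \<open>auto simp: S_def\<close>)
  finally show ?thesis by simp
qed

lemma prime_power_prod_zero [simp]: "prime_power_prod (\<lambda>_. 0) = \<O>"
  by (simp add: prime_power_prod_def)

lemma prime_power_prod_single:
  assumes "P \<in> prime_ideals L"
  shows "prime_power_prod (\<lambda>Q. if Q = P then 1 else 0) = P"
proof -
  have "prime_power_prod (\<lambda>Q. if Q = P then 1 else 0)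
      = finprod \<I> (\<lambda>Q. Q [^]\<^bsub>\<I>\<^esub> (if Q = P then 1 else 0 :: int)) {P}"
    by (rule prime_power_prod_superset) (use assms in auto)
  also have "\<dots> = P" using fractional_prime[OF assms] by (simp add: iprod_commute[of P] iprod_O fractional_mod)
  finally show ?thesis .
qed

lemma iprod_list_eq_prime_power_prod:
  assumes "set Ps \<subseteq> prime_ideals L"
  shows "\<exists>a. valid_exponents a \<and> (\<forall>P. a P \<ge> 0) \<and> iprod_list Ps = prime_power_prod a"
  using assms
proof (induction Ps)
  case Nil
  have "valid_exponents (\<lambda>_. 0)" by (simp add: valid_exponents_def)
  thus ?case by (intro exI[of _ "\<lambda>_. 0"]) simp
next
  case (Cons P Ps)
  then obtain a where a: "valid_exponents a" "\<forall>P. a P \<ge> 0" "iprod_list Ps = prime_power_prod a" by auto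
  have P: "P \<in> prime_ideals L" using Cons by simp
  show ?case
    using prime_power_prod_add[OF valid_exponents_single[OF P, of 1] a(1)]
      valid_exponents_add[OF valid_exponents_single[OF P, of 1] a(1)] a prime_power_prod_single[OF P]
    by (intro exI[of _ "\<lambda>Q. (if Q = P then 1 else 0) + a Q"]) auto
qed

lemma prime_power_prod_uminus:
  assumes a: "valid_exponents a"
  shows "iprod (prime_power_prod (\<lambda>P. - a P)) (prime_power_prod a) = \<O>"
  using prime_power_prod_add[OF valid_exponents_uminus[OF a] a] by simp

lemma fractional_eq_prime_power_prod:
  assumes I: "fractional_ideal L I"
  shows "\<exists>a. valid_exponents a \<and> I = prime_power_prod a"
proof -
  obtain d Ps where d: "d \<in> \<O>" "d \<noteq> 0" "set Ps \<subseteq> prime_ideals L"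
    "iprod (principal_ideal L d) I = iprod_list Ps"
    using fractional_denominator[OF I] .
  have dL: "d \<in> L" using d O_subset by auto
  obtain a where a: "valid_exponents a" "iprod_list Ps = prime_power_prod a"
    using iprod_list_eq_prime_power_prod[OF d(3)] by blast
  have fd: "fractional_ideal L (principal_ideal L d)" using fractional_principal[OF dL d(2)] .
  have "principal_ideal L d \<subseteq> \<O>" using principal_subset[OF is_mod_O, of d] d by simp
  then obtain Qs where "set Qs \<subseteq> prime_ideals L" "principal_ideal L d = iprod_list Qs"
    using ideal_factorization[of "principal_ideal L d"] fd by (auto simp: fractional_ideal_iff)
  then obtain b where b: "valid_exponents b" "principal_ideal L d = prime_power_prod b"
    using iprod_list_eq_prime_power_prod by metis
  have "iprod (prime_power_prod (\<lambda>P. - b P)) (iprod (principal_ideal L d) I) = I"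
    using prime_power_prod_uminus[OF b(1)] I
    by (simp add: b(2) iprod_assoc[symmetric] iprod_O fractional_ideal_iff)
  hence "I = prime_power_prod (\<lambda>P. - b P + a P)"
    unfolding prime_power_prod_add[OF valid_exponents_uminus[OF b(1)] a(1)] by (simp add: d(4) a(2))
  moreover have "valid_exponents (\<lambda>P. - b P + a P)"
    by (intro valid_exponents_add valid_exponents_uminus a b)
  ultimately show ?thesis by (intro exI conjI)
qed

lemma iprod_subset_prime:
  assumes P: "P \<in> prime_ideals L" and "I \<subseteq> \<O>" "J \<subseteq> \<O>" "iprod I J \<subseteq> P"
  shows "I \<subseteq> P \<or> J \<subseteq> P"
proof (rule ccontr)
  assume "\<not> (I \<subseteq> P \<or> J \<subseteq> P)"
  then obtain a b where ab: "a \<in> I" "a \<notin> P" "b \<in> J" "b \<notin> P" by blast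
  hence "a * b \<in> P" using iprod_mult assms(4) by blast
  thus False using primeD(5)[OF P] ab assms(2,3) by blast
qed

lemma prime_nat_pow_subset:
  assumes Q: "Q \<in> prime_ideals L"
  shows "is_mod (Q [^]\<^bsub>\<I>\<^esub> (n::nat))" "Q [^]\<^bsub>\<I>\<^esub> (n::nat) \<subseteq> \<O>"
    "P \<in> prime_ideals L \<Longrightarrow> Q [^]\<^bsub>\<I>\<^esub> (n::nat) \<subseteq> P \<Longrightarrow> n > 0 \<and> Q \<subseteq> P"
proof -
  have *: "is_mod (Q [^]\<^bsub>\<I>\<^esub> (n::nat)) \<and> Q [^]\<^bsub>\<I>\<^esub> (n::nat) \<subseteq> \<O>" for n
  proof (induction n)
    case 0 thus ?case by (simp add: is_mod_O)
  next
    case (Suc n)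
    have "iprod (Q [^]\<^bsub>\<I>\<^esub> (n::nat)) Q \<subseteq> \<O>"
      using Suc primeD(2)[OF Q] O_mult by (intro iprod_subset_mod is_mod_O) blast
    thus ?case using Suc by (simp add: is_mod_iprod primeD(1)[OF Q])
  qed
  show "is_mod (Q [^]\<^bsub>\<I>\<^esub> (n::nat))" "Q [^]\<^bsub>\<I>\<^esub> (n::nat) \<subseteq> \<O>" using * by auto
  assume P: "P \<in> prime_ideals L" and "Q [^]\<^bsub>\<I>\<^esub> (n::nat) \<subseteq> P"
  thus "n > 0 \<and> Q \<subseteq> P"
  proof (induction n)
    case 0 thus ?case using primeD(4)[OF P] O_1 by auto
  next
    case (Suc n)
    thus ?case using iprod_subset_prime[OF P _ primeD(2)[OF Q], of "Q [^]\<^bsub>\<I>\<^esub> n"] * by auto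
  qed
qed

lemma finprod_prime_powers_subset:
  assumes "finite S" "S \<subseteq> prime_ideals L"
  shows "is_mod (finprod \<I> (\<lambda>Q. Q [^]\<^bsub>\<I>\<^esub> (k Q :: nat)) S)" (is "is_mod ?X")
    "finprod \<I> (\<lambda>Q. Q [^]\<^bsub>\<I>\<^esub> (k Q :: nat)) S \<subseteq> \<O>"
    "P \<in> prime_ideals L \<Longrightarrow> finprod \<I> (\<lambda>Q. Q [^]\<^bsub>\<I>\<^esub> (k Q :: nat)) S \<subseteq> P \<Longrightarrow> \<exists>Q\<in>S. k Q > 0 \<and> Q \<subseteq> P"
proof -
  have "is_mod (finprod \<I> (\<lambda>Q. Q [^]\<^bsub>\<I>\<^esub> (k Q :: nat)) S) \<and> finprod \<I> (\<lambda>Q. Q [^]\<^bsub>\<I>\<^esub> (k Q :: nat)) S \<subseteq> \<O>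
    \<and> (P \<in> prime_ideals L \<longrightarrow> finprod \<I> (\<lambda>Q. Q [^]\<^bsub>\<I>\<^esub> (k Q :: nat)) S \<subseteq> P \<longrightarrow> (\<exists>Q\<in>S. k Q > 0 \<and> Q \<subseteq> P))"
    using assms
  proof (induction rule: finite_induct)
    case empty
    show ?case using primeD(4) O_1 by (auto simp: is_mod_O)
  next
    case (insert Q S)
    have cl: "(\<lambda>Q. Q [^]\<^bsub>\<I>\<^esub> (k Q :: nat)) \<in> S \<rightarrow> carrier \<I>" "Q [^]\<^bsub>\<I>\<^esub> (k Q :: nat) \<in> carrier \<I>"
      using insert.prems fractional_prime by (auto intro!: G.nat_pow_closed[simplified])
    have Q: "Q \<in> prime_ideals L" using insert by auto
    let ?Y = "finprod \<I> (\<lambda>Q. Q [^]\<^bsub>\<I>\<^esub> (k Q :: nat)) S"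
    have eq: "finprod \<I> (\<lambda>Q. Q [^]\<^bsub>\<I>\<^esub> (k Q :: nat)) (insert Q S) = iprod (Q [^]\<^bsub>\<I>\<^esub> k Q) ?Y"
      using G.finprod_insert[OF insert.hyps cl] by simp
    have IH: "is_mod ?Y" "?Y \<subseteq> \<O>"
      "P \<in> prime_ideals L \<longrightarrow> ?Y \<subseteq> P \<longrightarrow> (\<exists>Q\<in>S. k Q > 0 \<and> Q \<subseteq> P)"
      using insert by auto
    have "iprod (Q [^]\<^bsub>\<I>\<^esub> k Q) ?Y \<subseteq> \<O>"
      using prime_nat_pow_subset(2)[OF Q, of "k Q"] IH(2) O_mult by (intro iprod_subset_mod is_mod_O) blast
    moreover have "is_mod (iprod (Q [^]\<^bsub>\<I>\<^esub> k Q) ?Y)"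
      by (intro is_mod_iprod prime_nat_pow_subset Q IH)
    moreover have "\<exists>Q\<in>insert Q S. k Q > 0 \<and> Q \<subseteq> P"
      if P: "P \<in> prime_ideals L" "iprod (Q [^]\<^bsub>\<I>\<^esub> k Q) ?Y \<subseteq> P"
      using iprod_subset_prime[OF P(1) prime_nat_pow_subset(2)[OF Q] IH(2) P(2)]
        prime_nat_pow_subset(3)[OF Q P(1)] IH(3) P(1) by blast
    ultimately show ?case unfolding eq by blast
  qed
  thus "is_mod (finprod \<I> (\<lambda>Q. Q [^]\<^bsub>\<I>\<^esub> (k Q :: nat)) S)"
    "finprod \<I> (\<lambda>Q. Q [^]\<^bsub>\<I>\<^esub> (k Q :: nat)) S \<subseteq> \<O>"
    "P \<in> prime_ideals L \<Longrightarrow> finprod \<I> (\<lambda>Q. Q [^]\<^bsub>\<I>\<^esub> (k Q :: nat)) S \<subseteq> P \<Longrightarrow> \<exists>Q\<in>S. k Q > 0 \<and> Q \<subseteq> P"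
    by auto
qed

text \<open>Containment in primes makes the support of the exponents visible in the product, because
  distinct nonzero primes do not contain each other. Uniqueness of factorization rests on
  this.\<close>

lemma nonneg_prime_power_prod:
  assumes a: "valid_exponents a" "\<And>P. a P \<ge> 0"
  shows "prime_power_prod a \<subseteq> \<O>"
    "P \<in> prime_ideals L \<Longrightarrow> prime_power_prod a \<subseteq> P \<longleftrightarrow> a P > 0"
proof -
  have nat: "prime_power_prod a = finprod \<I> (\<lambda>Q. Q [^]\<^bsub>\<I>\<^esub> nat (a Q)) {P. a P \<noteq> 0}"
    if "\<And>P. a P \<ge> 0" for a
  proof -
    have "P [^]\<^bsub>\<I>\<^esub> a P = P [^]\<^bsub>\<I>\<^esub> nat (a P)" for P
      using int_pow_int[of \<I> P "nat (a P)"] that[of P] by simp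
    thus ?thesis by (simp only: prime_power_prod_def)
  qed
  have sub: "prime_power_prod a \<subseteq> \<O>" if a: "valid_exponents a" "\<And>P. a P \<ge> 0" for a
    unfolding nat[OF a(2)]
    by (rule finprod_prime_powers_subset) (use a in \<open>auto simp: valid_exponents_def\<close>)
  show "prime_power_prod a \<subseteq> \<O>" by (rule sub[OF a])
  assume P: "P \<in> prime_ideals L"
  show "prime_power_prod a \<subseteq> P \<longleftrightarrow> a P > 0"
  proof
    assume sub_P: "prime_power_prod a \<subseteq> P"
    have v: "finite {P. a P \<noteq> 0}" "{P. a P \<noteq> 0} \<subseteq> prime_ideals L"
      using a(1) by (simp_all add: valid_exponents_def)
    obtain Q where Q: "Q \<in> {P. a P \<noteq> 0}" "nat (a Q) > 0" "Q \<subseteq> P"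
      using finprod_prime_powers_subset(3)[OF v P sub_P[unfolded nat[OF a(2)]]] by auto
    have "Q \<in> prime_ideals L" using v(2) Q(1) by (rule subsetD)
    hence "Q = P" using prime_incl_eq[OF _ P Q(3)] by simp
    thus "a P > 0" using Q(2) by simp
  next
    assume aP: "a P > 0"
    define b where "b = (\<lambda>Q. a Q + (if Q = P then - 1 else 0))"
    have b: "valid_exponents b" "\<And>Q. b Q \<ge> 0"
      unfolding b_def using a aP by (auto intro: valid_exponents_add valid_exponents_single[OF P])
    have "a = (\<lambda>Q. (if Q = P then 1 else 0) + b Q)" by (auto simp: b_def)
    hence "prime_power_prod a = iprod P (prime_power_prod b)"
      using prime_power_prod_add[OF valid_exponents_single[OF P, of 1] b(1)] prime_power_prod_single[OF P] by simp
    also have "\<dots> \<subseteq> P"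
    proof (rule iprod_subset_mod[OF _ primeD(1)[OF P]])
      fix u v assume "u \<in> P" "v \<in> prime_power_prod b"
      thus "u * v \<in> P" using sub[OF b] is_modD(3)[OF primeD(1)[OF P], of v u] by (auto simp: mult.commute)
    qed
    finally show "prime_power_prod a \<subseteq> P" .
  qed
qed

text \<open>Cancelling the common part leaves nonnegative exponents \<open>u\<close> and
  \<open>v\<close> that are never both positive but have the same product. A prime contains this
  product iff \<open>u\<close> is positive there, and iff \<open>v\<close> is; hence both
  vanish.\<close>

lemma prime_power_prod_inj:
  assumes a: "valid_exponents a" and b: "valid_exponents b" and eq: "prime_power_prod a = prime_power_prod b"
  shows "a = b"
proof
  fix P
  define u where "u = (\<lambda>P. max (a P - b P) 0)"
  define v where "v = (\<lambda>P. max (b P - a P) 0)"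
  have uv: "valid_exponents u" "valid_exponents v"
    using valid_exponents_subset[OF a b] by (auto simp: u_def v_def)
  have "(\<lambda>P. u P + b P) = (\<lambda>P. v P + a P)" by (auto simp: u_def v_def fun_eq_iff)
  hence "iprod (prime_power_prod u) (prime_power_prod a) = iprod (prime_power_prod v) (prime_power_prod a)"
    using prime_power_prod_add[OF uv(1) b] prime_power_prod_add[OF uv(2) a] eq by simp
  hence E: "prime_power_prod u = prime_power_prod v"
    using G.right_cancel[of "prime_power_prod a" "prime_power_prod u" "prime_power_prod v"]
      prime_power_prod_closed a uv by auto
  show "a P = b P"
  proof (cases "P \<in> prime_ideals L")
    case True
    have "u P > 0 \<longleftrightarrow> v P > 0"
      using nonneg_prime_power_prod(2)[OF uv(1) _ True] nonneg_prime_power_prod(2)[OF uv(2) _ True] E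
      by (simp add: u_def v_def)
    thus ?thesis by (auto simp: u_def v_def split: if_splits)
  next
    case False
    hence "a P = 0" "b P = 0" using a b unfolding valid_exponents_def by blast+
    thus ?thesis by simp
  qed
qed

lemma ideal_exponent_prime_power_prod:
  assumes "valid_exponents a"
  shows "ideal_exponent L (prime_power_prod a) = a"
  unfolding ideal_exponent_def
proof (rule the_equality)
  show "finite {P. a P \<noteq> 0} \<and> {P. a P \<noteq> 0} \<subseteq> prime_ideals L \<and>
    prime_power_prod a = finprod \<I> (\<lambda>P. P [^]\<^bsub>\<I>\<^esub> a P) {P. a P \<noteq> 0}"
    using assms by (auto simp: valid_exponents_def prime_power_prod_def)
  fix b :: "complex set \<Rightarrow> int"
  assume "finite {P. b P \<noteq> 0} \<and> {P. b P \<noteq> 0} \<subseteq> prime_ideals L \<and>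
    prime_power_prod a = finprod \<I> (\<lambda>P. P [^]\<^bsub>\<I>\<^esub> b P) {P. b P \<noteq> 0}"
  thus "b = a" using prime_power_prod_inj[OF assms, of b]
    by (auto simp: valid_exponents_def prime_power_prod_def)
qed

lemma ideal_exponent_valid:
  assumes "fractional_ideal L I"
  shows "valid_exponents (ideal_exponent L I)" "prime_power_prod (ideal_exponent L I) = I"
proof -
  obtain a where "valid_exponents a" "I = prime_power_prod a"
    using fractional_eq_prime_power_prod[OF assms] by blast
  thus "valid_exponents (ideal_exponent L I)" "prime_power_prod (ideal_exponent L I) = I"
    using ideal_exponent_prime_power_prod by auto
qed

lemma ideal_exponent_one: "ideal_exponent L \<O> P = 0"
  using ideal_exponent_prime_power_prod[of "\<lambda>_. 0"] by (simp add: valid_exponents_def)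

lemma ideal_exponent_mult:
  assumes "fractional_ideal L I" "fractional_ideal L J"
  shows "ideal_exponent L (iprod I J) P = ideal_exponent L I P + ideal_exponent L J P"
proof -
  note I = ideal_exponent_valid[OF assms(1)] and J = ideal_exponent_valid[OF assms(2)]
  have "iprod I J = prime_power_prod (\<lambda>P. ideal_exponent L I P + ideal_exponent L J P)"
    using prime_power_prod_add[OF I(1) J(1)] I(2) J(2) by simp
  thus ?thesis using ideal_exponent_prime_power_prod[OF valid_exponents_add[OF I(1) J(1)]] by simp
qed

lemma ideal_exponent_prime:
  assumes "P \<in> prime_ideals L"
  shows "ideal_exponent L P Q = (if Q = P then 1 else 0)"
  using ideal_exponent_prime_power_prod[OF valid_exponents_single[OF assms, of 1]]
    prime_power_prod_single[OF assms] by simp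

lemma ideal_exponent_hom: "(\<lambda>I. ideal_exponent L I P) \<in> hom \<I> integer_group"
  by (rule homI) (auto simp: ideal_exponent_mult integer_group_def)

lemma ideal_exponent_int_pow:
  assumes "fractional_ideal L I"
  shows "ideal_exponent L (I [^]\<^bsub>\<I>\<^esub> (k::int)) P = k * ideal_exponent L I P"
  using hom_int_pow[OF ideal_exponent_hom _ G.is_group, of I k P] assms by simp

lemma ideal_exponent_finprod:
  assumes "\<And>i. i \<in> A \<Longrightarrow> fractional_ideal L (f i)" "finite A"
  shows "ideal_exponent L (finprod \<I> f A) P = (\<Sum>i\<in>A. ideal_exponent L (f i) P)"
    "fractional_ideal L (finprod \<I> f A)"
proof -
  have *: "fractional_ideal L (finprod \<I> f A)" if "\<And>i. i \<in> A \<Longrightarrow> fractional_ideal L (f i)" for A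
    using G.finprod_closed[of f A] that by auto
  show "fractional_ideal L (finprod \<I> f A)" using * assms(1) .
  show "ideal_exponent L (finprod \<I> f A) P = (\<Sum>i\<in>A. ideal_exponent L (f i) P)"
    using assms(2,1)
  proof (induction rule: finite_induct)
    case empty thus ?case by (simp add: ideal_exponent_one)
  next
    case (insert i A)
    have "finprod \<I> f (insert i A) = iprod (f i) (finprod \<I> f A)"
      using G.finprod_insert[OF insert.hyps, of f] insert.prems by auto
    thus ?case using insert * by (simp add: ideal_exponent_mult)
  qed
qed

end

section \<open>Completely split primes\<close>

lemma ints_of_Rats: "ints_of \<rat> = \<int>"
  unfolding ints_of_def using rational_algebraic_int_is_int int_imp_algebraic_int Ints_subset_Rats by blast

lemma of_int_in_principal_Rats:
  "of_int k \<in> principal_ideal \<rat> (of_nat q) \<longleftrightarrow> int q dvd k"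
proof
  assume "of_int k \<in> principal_ideal \<rat> (of_nat q)"
  then obtain j :: int where "(of_int k :: complex) = of_int j * of_nat q"
    by (auto simp: principal_ideal_def ints_of_Rats Ints_def)
  hence "(of_int k :: complex) = of_int (j * int q)" by simp
  hence "k = j * int q" by (simp only: of_int_eq_iff)
  thus "int q dvd k" by simp
next
  assume "int q dvd k"
  then obtain j where "k = int q * j" by auto
  thus "of_int k \<in> principal_ideal \<rat> (of_nat q)"
    unfolding principal_ideal_def ints_of_Rats by (intro image_eqI[of _ _ "of_int j"]) auto
qed

context number_field
begin

lemma primes_above_natD:
  assumes "P \<in> primes_above_nat L q"
  shows "P \<in> prime_ideals L" "of_int k \<in> P \<longleftrightarrow> int q dvd k"
proof -
  show "P \<in> prime_ideals L" using assms by (auto simp: primes_above_def)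
  have P: "P \<inter> \<int> = principal_ideal \<rat> (of_nat q)"
    using assms unfolding primes_above_def ints_of_Rats by blast
  have "of_int k \<in> P \<longleftrightarrow> of_int k \<in> P \<inter> \<int>" by simp
  thus "of_int k \<in> P \<longleftrightarrow> int q dvd k" unfolding P of_int_in_principal_Rats .
qed

lemma finite_primes_above_nat: "q > 0 \<Longrightarrow> finite (primes_above_nat L q)"
proof (rule finite_subset[OF _ finite_ideals_containing])
  assume "q > 0"
  show "primes_above_nat L q \<subseteq> {I. is_mod I \<and> I \<subseteq> \<O> \<and> of_nat q \<in> I}"
  proof
    fix P assume P: "P \<in> primes_above_nat L q"
    thus "P \<in> {I. is_mod I \<and> I \<subseteq> \<O> \<and> of_nat q \<in> I}"
      using primes_above_natD(2)[OF P, of "int q"] primeD(1,2)[OF primes_above_natD(1)[OF P]] by simp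
  qed
qed

lemma pow_in_ideal_pow:
  assumes "P \<in> prime_ideals L" "w \<in> P"
  shows "w ^ k \<in> P [^]\<^bsub>\<I>\<^esub> (k::nat)"
  by (induction k) (use assms in \<open>auto simp: O_1 power_Suc2 simp del: power_Suc intro: iprod_mult\<close>)

lemma ideal_pow_subset:
  assumes P: "P \<in> prime_ideals L" and "k > 0"
  shows "P [^]\<^bsub>\<I>\<^esub> (k::nat) \<subseteq> P"
proof -
  obtain n where k: "k = Suc n" using assms(2) by (cases k) auto
  have "iprod (P [^]\<^bsub>\<I>\<^esub> n) P \<subseteq> P"
    using prime_nat_pow_subset(2)[OF P, of n] primeD(1)[OF P] by (intro iprod_subset_mod is_modD(3)) auto
  thus ?thesis by (simp add: k)
qed

lemma primes_comaximal:
  assumes P: "P \<in> prime_ideals L" and Q: "Q \<in> prime_ideals L" and "P \<noteq> Q"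
  obtains w where "w \<in> Q" "1 - w \<in> P" "w \<in> \<O>"
proof -
  obtain a where a: "a \<in> Q" "a \<notin> P" using prime_incl_eq[OF Q P] assms(3) by blast
  note S = is_mod_isum[OF primeD(1)[OF P] primeD(1)[OF Q]]
  have "1 \<in> isum P Q"
    using prime_maximal[OF P S(1,2)] a S(3) primeD(2)[OF Q] by blast
  then obtain u w where uw: "1 = u + w" "u \<in> P" "w \<in> Q" by (auto simp: isum_def)
  have "1 - w = u" by (simp add: uw(1))
  thus ?thesis using that[of w] uw primeD(2)[OF Q] by auto
qed

lemma one_minus_prod:
  assumes I: "is_mod I" and "\<And>i. i \<in> A \<Longrightarrow> f i \<in> \<O>" "\<And>i. i \<in> A \<Longrightarrow> 1 - f i \<in> I" "finite A"
  shows "1 - prod f A \<in> I"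
  using assms(4,2,3)
proof (induction rule: finite_induct)
  case empty thus ?case using is_modD(4)[OF I] by simp
next
  case (insert i A)
  have "1 - prod f A \<in> I" "f i \<in> \<O>" "1 - f i \<in> I" using insert by auto
  hence "f i * (1 - prod f A) + (1 - f i) \<in> I" using is_modD(3,5)[OF I] by blast
  thus ?case using insert.hyps by (simp add: algebra_simps)
qed

text \<open>An element \<open>b\<close> that is 1 modulo \<open>P\<close> and lies in all the other
  \<open>Q ^ k\<close> is corrected to \<open>1 - (1 - b) ^ k\<close>: this is 1 modulo
  \<open>P ^ k\<close> and still a multiple of \<open>b\<close>.\<close>

lemma crt_idempotent:
  assumes S: "finite S" "S \<subseteq> prime_ideals L" and P: "P \<in> S"
  obtains e where "e \<in> \<O>" "1 - e \<in> P [^]\<^bsub>\<I>\<^esub> (k::nat)" "\<And>Q. Q \<in> S - {P} \<Longrightarrow> e \<in> Q [^]\<^bsub>\<I>\<^esub> k"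
proof -
  have PP: "P \<in> prime_ideals L" using S P by auto
  have "\<exists>w. w \<in> Q \<and> 1 - w \<in> P \<and> w \<in> \<O>" if Q: "Q \<in> S - {P}" for Q
    using primes_comaximal[of P Q] S P Q by blast
  then obtain w where w: "\<And>Q. Q \<in> S - {P} \<Longrightarrow> w Q \<in> Q" "\<And>Q. Q \<in> S - {P} \<Longrightarrow> 1 - w Q \<in> P"
    "\<And>Q. Q \<in> S - {P} \<Longrightarrow> w Q \<in> \<O>" by metis
  define b where "b = (\<Prod>Q\<in>S - {P}. w Q ^ k)"
  have bO: "b \<in> \<O>" unfolding b_def using w by (intro O_prod O_power)
  have "1 - w Q ^ k \<in> P" if Q: "Q \<in> S - {P}" for Q
    using one_minus_prod[OF primeD(1)[OF PP], of "{..<k}" "\<lambda>_. w Q"] w Q by simp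
  hence "1 - b \<in> P"
    unfolding b_def using w S(1) by (intro one_minus_prod[OF primeD(1)[OF PP]] O_power) auto
  hence c: "(1 - b) ^ k \<in> P [^]\<^bsub>\<I>\<^esub> k" by (rule pow_in_ideal_pow[OF PP])
  define g where "g = (\<Sum>i<k. (1 - b) ^ i)"
  have gO: "g \<in> \<O>" unfolding g_def using O_diff[OF O_1 bO] by (intro zm.subspace_sum[OF O_subspace] O_power)
  have e: "1 - (1 - b) ^ k = b * g" using one_diff_power_eq[of "1 - b" k] by (simp add: g_def)
  have "b * g \<in> Q [^]\<^bsub>\<I>\<^esub> k" if Q: "Q \<in> S - {P}" for Q
  proof -
    have QP: "Q \<in> prime_ideals L" using S Q by auto
    have "b = (\<Prod>Q\<in>S - {P} - {Q}. w Q ^ k) * w Q ^ k"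
      unfolding b_def using Q S(1) by (subst prod.remove[of _ Q]) (auto simp: mult.commute)
    moreover have "(\<Prod>Q\<in>S - {P} - {Q}. w Q ^ k) \<in> \<O>" using w by (intro O_prod O_power) auto
    moreover have "w Q ^ k \<in> Q [^]\<^bsub>\<I>\<^esub> k" using pow_in_ideal_pow[OF QP w(1)[OF Q]] .
    ultimately have "b \<in> Q [^]\<^bsub>\<I>\<^esub> k" using is_modD(3)[OF prime_nat_pow_subset(1)[OF QP]] by metis
    from is_modD(3)[OF prime_nat_pow_subset(1)[OF QP] gO this] show ?thesis by (simp add: mult.commute)
  qed
  moreover have "1 - b * g \<in> P [^]\<^bsub>\<I>\<^esub> k" using c by (simp flip: e)
  ultimately show ?thesis using that[of "b * g"] O_mult[OF bO gO] by blast
qed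

text \<open>The idempotents modulo the primes above \<open>q\<close> are independent modulo \<open>q\<close>, and there are as
  many of them as the degree allows, hence every algebraic integer is a combination of them with
  rational coefficients whose denominators are prime to \<open>q\<close>.\<close>

lemma split_approximation:
  assumes q: "prime q" and card: "card (primes_above_nat L q) \<ge> card B"
    and P: "P \<in> primes_above_nat L q" and a: "a \<in> \<O>" and k: "k > 0"
  obtains m c :: int where "\<not> int q dvd m" "of_int m * a - of_int c \<in> P [^]\<^bsub>\<I>\<^esub> (k::nat)"
proof -
  define S where "S = primes_above_nat L q"
  have S: "finite S" "S \<subseteq> prime_ideals L"
    using finite_primes_above_nat prime_gt_0_nat[OF q] primes_above_natD(1) by (auto simp: S_def)
  have "\<exists>e. e \<in> \<O> \<and> 1 - e \<in> Q [^]\<^bsub>\<I>\<^esub> k \<and> (\<forall>R\<in>S - {Q}. e \<in> R [^]\<^bsub>\<I>\<^esub> k)" if Q: "Q \<in> S" for Q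
    by (rule crt_idempotent[OF S Q, of k]) blast
  hence "\<exists>e. \<forall>Q\<in>S. e Q \<in> \<O> \<and> 1 - e Q \<in> Q [^]\<^bsub>\<I>\<^esub> k \<and> (\<forall>R\<in>S - {Q}. e Q \<in> R [^]\<^bsub>\<I>\<^esub> k)"
    by (intro bchoice ballI)
  then obtain e where "\<forall>Q\<in>S. e Q \<in> \<O> \<and> 1 - e Q \<in> Q [^]\<^bsub>\<I>\<^esub> k \<and> (\<forall>R\<in>S - {Q}. e Q \<in> R [^]\<^bsub>\<I>\<^esub> k)" ..
  hence e: "\<And>Q. Q \<in> S \<Longrightarrow> e Q \<in> \<O>" "\<And>Q. Q \<in> S \<Longrightarrow> 1 - e Q \<in> Q [^]\<^bsub>\<I>\<^esub> k"
    "\<And>Q R. Q \<in> S \<Longrightarrow> R \<in> S - {Q} \<Longrightarrow> e Q \<in> R [^]\<^bsub>\<I>\<^esub> k" by auto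
  \<comment> \<open>The index \<open>None\<close> stands for \<open>a\<close> and
    \<open>Some Q\<close> for the idempotent of \<open>Q\<close>. Together they are more than
    \<open>card B\<close> elements of the span of \<open>B\<close>, hence dependent.\<close>
  define u where "u = (\<lambda>j. case j of None \<Rightarrow> a | Some Q \<Rightarrow> e Q)"
  define J where "J = insert None (Some ` S)"
  have cJ: "card J > card B" and fJ: "finite J"
    using S(1) card by (auto simp: J_def S_def card_image)
  have uO: "u j \<in> \<O>" if "j \<in> J" for j using that e a by (auto simp: J_def u_def)
  have uB: "u j \<in> qv.span B" if "j \<in> J" for j using uO[OF that] O_subset L_span by blast
  obtain c where c: "\<exists>j\<in>J. \<not> int q dvd c j" "(\<Sum>j\<in>J. of_int (c j) * u j) = 0"
    by (rule int_dependent_not_dvd[OF finite_B fJ cJ uB prime_gt_1_nat[OF q]])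
  have sum: "(\<Sum>j\<in>J. of_int (c j) * u j) = of_int (c None) * a + (\<Sum>Q\<in>S. of_int (c (Some Q)) * e Q)"
    unfolding J_def using S(1) by (subst sum.insert) (auto simp: u_def sum.reindex)
  \<comment> \<open>Modulo \<open>Q ^ k\<close> every idempotent but \<open>e Q\<close> vanishes,
    and \<open>e Q\<close> becomes 1.\<close>
  have rel: "of_int (c None) * a + of_int (c (Some Q)) \<in> Q [^]\<^bsub>\<I>\<^esub> k" if Q: "Q \<in> S" for Q
  proof -
    have QP: "Q \<in> prime_ideals L" using S Q by auto
    note M = prime_nat_pow_subset(1)[OF QP, of k]
    have "of_int (c None) * a + of_int (c (Some Q)) =
      of_int (c (Some Q)) * (1 - e Q) - (\<Sum>R\<in>S - {Q}. of_int (c (Some R)) * e R)"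
      using c(2) S(1) Q unfolding sum by (simp add: sum.remove[of S Q] algebra_simps add_eq_0_iff2)
    also have "\<dots> \<in> Q [^]\<^bsub>\<I>\<^esub> k"
    proof (rule is_modD(6)[OF M])
      show "of_int (c (Some Q)) * (1 - e Q) \<in> Q [^]\<^bsub>\<I>\<^esub> k"
        by (rule is_modD(3)[OF M O_Ints e(2)[OF Q]]) simp
      show "(\<Sum>R\<in>S - {Q}. of_int (c (Some R)) * e R) \<in> Q [^]\<^bsub>\<I>\<^esub> k"
        using e(3) Q by (intro zm.subspace_sum[OF is_modD(1)[OF M]] is_modD(3)[OF M] O_Ints) auto
    qed
    finally show ?thesis .
  qed
  \<comment> \<open>If \<open>q\<close> divided the coefficient of \<open>a\<close>, reading the
    relation modulo each \<open>Q\<close> would make \<open>q\<close> divide all the other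
    coefficients too.\<close>
  have "\<not> int q dvd c None"
  proof
    assume qd: "int q dvd c None"
    have "int q dvd c (Some Q)" if Q: "Q \<in> S" for Q
    proof -
      have QP: "Q \<in> prime_ideals L" using S Q by auto
      have "of_int (c None) \<in> Q" using primes_above_natD(2)[of Q q "c None"] Q qd by (simp add: S_def)
      hence "a * of_int (c None) \<in> Q" using is_modD(3)[OF primeD(1)[OF QP] a] by blast
      moreover have "of_int (c None) * a + of_int (c (Some Q)) \<in> Q"
        using rel[OF Q] ideal_pow_subset[OF QP k] by blast
      ultimately have "of_int (c None) * a + of_int (c (Some Q)) - a * of_int (c None) \<in> Q"
        by (intro is_modD(6)[OF primeD(1)[OF QP]])
      thus ?thesis using primes_above_natD(2)[of Q q] Q by (simp add: S_def mult.commute)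
    qed
    thus False using c(1) qd by (auto simp: J_def)
  qed
  moreover have "of_int (c None) * a - of_int (- c (Some P)) \<in> P [^]\<^bsub>\<I>\<^esub> k"
    using rel[of P] P by (simp add: S_def)
  ultimately show ?thesis by (rule that)
qed

text \<open>\<open>q ^ k\<close> lies in \<open>P ^ k\<close>, so an integer prime to
  \<open>q\<close> is invertible modulo \<open>P ^ k\<close>.\<close>

lemma coprime_ideal_pow_cancel:
  assumes q: "prime q" and P: "P \<in> primes_above_nat L q" and m: "\<not> int q dvd m"
    and d: "d \<in> \<O>" "of_int m * d \<in> P [^]\<^bsub>\<I>\<^esub> (k::nat)"
  shows "d \<in> P [^]\<^bsub>\<I>\<^esub> k"
proof -
  have PP: "P \<in> prime_ideals L" using primes_above_natD(1)[OF P] .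
  note M = prime_nat_pow_subset(1)[OF PP, of k]
  have "coprime (int q) m" using q m prime_imp_coprime[of "int q" m] by simp
  hence "coprime m (int q ^ k)" by (simp add: coprime_commute)
  then obtain u v where uv: "u * m + v * int q ^ k = 1"
    using bezout_int[of m "int q ^ k"] by (auto simp: coprime_iff_gcd_eq_1)
  have "of_nat q \<in> P" using primes_above_natD(2)[OF P, of "int q"] by simp
  hence qk: "of_nat q ^ k \<in> P [^]\<^bsub>\<I>\<^esub> k" by (rule pow_in_ideal_pow[OF PP])
  have "of_int u * (of_int m * d) + (of_int v * d) * of_nat q ^ k \<in> P [^]\<^bsub>\<I>\<^esub> k"
    by (rule is_modD(5)[OF M is_modD(3)[OF M O_Ints d(2)] is_modD(3)[OF M O_mult[OF O_Ints d(1)] qk]]) auto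
  also have "of_int u * (of_int m * d) + (of_int v * d) * of_nat q ^ k
      = (of_int u * of_int m + of_int v * of_nat q ^ k) * d" by (simp add: algebra_simps)
  also have "of_int u * of_int m + of_int v * of_nat q ^ k = (1::complex)"
    using arg_cong[OF uv, of "of_int :: int \<Rightarrow> complex"] by simp
  finally show ?thesis by simp
qed

text \<open>The case \<open>k = 1\<close> of the approximation, with \<open>m\<close> inverted
  modulo \<open>q\<close>: the residue field is the prime field.\<close>

lemma split_residue_int:
  assumes q: "prime q" and card: "card (primes_above_nat L q) \<ge> card B"
    and P: "P \<in> primes_above_nat L q" and a: "a \<in> \<O>"
  obtains c :: int where "a - of_int c \<in> P"
proof -
  have PP: "P \<in> prime_ideals L" using primes_above_natD(1)[OF P] .
  have P1: "P [^]\<^bsub>\<I>\<^esub> (1::nat) = P" using fractional_prime[OF PP] G.nat_pow_eone[of P] by simp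
  obtain m c :: int where mc: "\<not> int q dvd m" "of_int m * a - of_int c \<in> P"
    using split_approximation[OF q card P a, of 1] P1 by auto
  have "coprime m (int q)" using q mc(1) prime_imp_coprime[of "int q" m] by (simp add: coprime_commute)
  then obtain u v where uv: "u * m + v * int q = 1"
    using bezout_int[of m "int q"] by (auto simp: coprime_iff_gcd_eq_1)
  note M = primeD(1)[OF PP]
  have qP: "of_nat q \<in> P" using primes_above_natD(2)[OF P, of "int q"] by simp
  have "of_int u * (of_int m * a - of_int c) + (of_int v * a) * of_nat q \<in> P"
    by (rule is_modD(5)[OF M is_modD(3)[OF M O_Ints mc(2)] is_modD(3)[OF M O_mult[OF O_Ints a] qP]]) auto
  also have "of_int u * (of_int m * a - of_int c) + (of_int v * a) * of_nat q
      = (of_int u * of_int m + of_int v * of_nat q) * a - of_int (u * c)" by (simp add: algebra_simps)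
  also have "of_int u * of_int m + of_int v * of_nat q = (1::complex)"
    using arg_cong[OF uv, of "of_int :: int \<Rightarrow> complex"] by simp
  finally show ?thesis using that[of "u * c"] by simp
qed

text \<open>The integers already meet every residue class, so the image of the ring of integers of
  \<open>K\<close> is the whole residue field, and the dimension is that of a field over
  itself.\<close>

lemma residue_degree_one:
  assumes P: "P \<in> prime_ideals L" and res: "\<And>a. a \<in> \<O> \<Longrightarrow> \<exists>c::int. a - of_int c \<in> P"
    and K: "\<int> \<subseteq> ints_of K" "ints_of K \<subseteq> \<O>"
  shows "residue_degree K L P = 1"
proof -
  let ?R = "subring_of \<O>"
  have pr: "primeideal P ?R" using P by (auto simp: prime_ideals_def)
  interpret P: primeideal P ?R by (rule pr)
  have "maximalideal P ?R"
  proof (rule maximalidealI)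
    show "ideal P ?R" by (rule P.is_ideal)
    show "carrier ?R \<noteq> P" by (rule P.I_notcarr)
    fix J assume J: "ideal J ?R" "P \<subseteq> J" "J \<subseteq> carrier ?R"
    interpret J: ideal J ?R by (rule J(1))
    have mod: "is_mod J"
      using J(3) O_subset J.zero_closed J.a_closed J.I_l_closed by (intro is_modI) auto
    show "J = P \<or> J = carrier ?R"
    proof (cases "J \<subseteq> P")
      case False
      then obtain a where "a \<in> J" "a \<notin> P" by blast
      hence "1 \<in> J" using prime_maximal[OF P mod J(2)] J(3) by auto
      thus ?thesis using J.one_imp_carrier by simp
    qed (use J in auto)
  qed
  then interpret M: maximalideal P ?R .
  have fld: "field (?R Quot P)" by (rule M.quotient_is_field[OF P.is_cring])
  then interpret Q: field "?R Quot P" .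
  have "(\<lambda>a. P +>\<^bsub>?R\<^esub> a) ` ints_of K = carrier (?R Quot P)"
  proof
    show "(\<lambda>a. P +>\<^bsub>?R\<^esub> a) ` ints_of K \<subseteq> carrier (?R Quot P)"
      using K(2) P.a_rcosetsI[OF P.a_subset] by (auto simp: FactRing_def)
    show "carrier (?R Quot P) \<subseteq> (\<lambda>a. P +>\<^bsub>?R\<^esub> a) ` ints_of K"
    proof
      fix X assume "X \<in> carrier (?R Quot P)"
      then obtain a where a: "a \<in> \<O>" "X = P +>\<^bsub>?R\<^esub> a"
        by (auto simp: FactRing_def A_RCOSETS_def')
      obtain c :: int where c: "a - of_int c \<in> P" using res[OF a(1)] by blast
      have cK: "of_int c \<in> ints_of K" using K(1) by auto
      have "a \<in> P +>\<^bsub>?R\<^esub> of_int c"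
        using c by (auto simp: a_r_coset_def' intro!: bexI[of _ "a - of_int c"])
      moreover have "of_int c \<in> carrier ?R" using K(2) cK by auto
      ultimately have "P +>\<^bsub>?R\<^esub> of_int c = P +>\<^bsub>?R\<^esub> a"
        using P.a_subgroup by (rule P.a_repr_independence)
      thus "X \<in> (\<lambda>a. P +>\<^bsub>?R\<^esub> a) ` ints_of K" using a(2) cK by auto
    qed
  qed
  moreover have "subfield (carrier (?R Quot P)) (?R Quot P)" by (rule Q.carrier_is_subfield)
  hence "Q.dim (carrier (?R Quot P)) (carrier (?R Quot P)) = 1"
    using Q.dimI[OF _ Q.dimension_one] by (simp add: over_def)
  ultimately show ?thesis by (simp add: residue_degree_def Let_def)
qed

end

section \<open>Automorphisms and valuations\<close>

context number_field
begin

text \<open>Values outside \<open>L\<close> are left free, so that composites and the iterates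
  \<open>\<sigma> ^^ j\<close> are automorphisms without being restricted again.\<close>

definition automorphism :: "(complex \<Rightarrow> complex) \<Rightarrow> bool" where
  "automorphism s \<longleftrightarrow> bij_betw s L L \<and>
     (\<forall>x\<in>L. \<forall>y\<in>L. s (x + y) = s x + s y) \<and> (\<forall>x\<in>L. \<forall>y\<in>L. s (x * y) = s x * s y)"

lemma automorphismD:
  assumes "automorphism s"
  shows aut_bij: "bij_betw s L L"
    and aut_add: "x \<in> L \<Longrightarrow> y \<in> L \<Longrightarrow> s (x + y) = s x + s y"
    and aut_mult: "x \<in> L \<Longrightarrow> y \<in> L \<Longrightarrow> s (x * y) = s x * s y"
    and aut_closed: "x \<in> L \<Longrightarrow> s x \<in> L"
    and aut_inj: "inj_on s L"
    and aut_surj: "s ` L = L"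
  using assms by (auto simp: automorphism_def bij_betw_def)

lemma aut_0:
  assumes "automorphism s" shows "s 0 = 0"
  using aut_add[OF assms L_0 L_0] by simp

lemma aut_nonzero:
  assumes s: "automorphism s" and x: "x \<in> L" "x \<noteq> 0"
  shows "s x \<noteq> 0"
  using inj_onD[OF aut_inj[OF s], of x 0] aut_0[OF s] x L_0 by auto

lemma aut_1:
  assumes s: "automorphism s" shows "s 1 = 1"
  using aut_mult[OF s L_1 L_1] aut_nonzero[OF s L_1] by simp

lemma aut_minus:
  assumes s: "automorphism s" and x: "x \<in> L" shows "s (- x) = - s x"
  using aut_add[OF s x L_minus[OF x]] aut_0[OF s] by (simp add: eq_neg_iff_add_eq_0 add.commute)

lemma aut_diff:
  assumes s: "automorphism s" and x: "x \<in> L" "y \<in> L" shows "s (x - y) = s x - s y"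
  using aut_add[OF s x(1) L_minus[OF x(2)]] aut_minus[OF s x(2)] by simp

lemma aut_power:
  assumes s: "automorphism s" and x: "x \<in> L" shows "s (x ^ n) = s x ^ n"
  by (induction n) (auto simp: aut_1[OF s] aut_mult[OF s x L_power[OF x]])

lemma aut_sum:
  assumes s: "automorphism s" and f: "\<And>i. i \<in> A \<Longrightarrow> f i \<in> L" shows "s (sum f A) = (\<Sum>i\<in>A. s (f i))"
  using f
  by (induction A rule: infinite_finite_induct)
     (auto simp: aut_0[OF s] aut_add[OF s] zm.subspace_sum[OF L_subspace])

lemma L_prod: "(\<And>i. i \<in> A \<Longrightarrow> f i \<in> L) \<Longrightarrow> prod f A \<in> L"
  by (induction A rule: infinite_finite_induct) (auto intro: L_1 L_mult)

lemma aut_prod: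
  assumes s: "automorphism s" and f: "\<And>i. i \<in> A \<Longrightarrow> f i \<in> L" shows "s (prod f A) = (\<Prod>i\<in>A. s (f i))"
  using f
  by (induction A rule: infinite_finite_induct)
     (auto simp: aut_1[OF s] aut_mult[OF s] L_prod)

lemma aut_of_int:
  assumes s: "automorphism s" shows "s (of_int k) = of_int k"
proof -
  have nat: "s (of_nat n) = of_nat n" for n
    using aut_sum[OF s, of "{..<n}" "\<lambda>_. 1"] L_1 aut_1[OF s] by simp
  show ?thesis
  proof (cases "k \<ge> 0")
    case True thus ?thesis using nat[of "nat k"] by simp
  next
    case False thus ?thesis using nat[of "nat (- k)"] aut_minus[OF s, of "of_nat (nat (- k))"] L_Ints by simp
  qed
qed

lemma aut_Ints: "automorphism s \<Longrightarrow> c \<in> \<int> \<Longrightarrow> s c = c"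
  by (auto simp: aut_of_int elim: Ints_cases)

lemma aut_inv:
  assumes s: "automorphism s" shows "automorphism (inv_into L s)"
proof -
  let ?t = "inv_into L s"
  have bij: "bij_betw ?t L L" using bij_betw_inv_into[OF aut_bij[OF s]] .
  have tL: "?t x \<in> L" if "x \<in> L" for x using bij that by (auto simp: bij_betw_def)
  have st: "s (?t x) = x" if "x \<in> L" for x
    using that aut_surj[OF s] by (simp add: f_inv_into_f)
  have ts: "?t (s x) = x" if "x \<in> L" for x
    using that aut_inj[OF s] by (simp add: inv_into_f_f)
  have "?t (x + y) = ?t x + ?t y" "?t (x * y) = ?t x * ?t y" if "x \<in> L" "y \<in> L" for x y
    using ts[OF L_add[OF tL[OF that(1)] tL[OF that(2)]]] ts[OF L_mult[OF tL[OF that(1)] tL[OF that(2)]]]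
    by (simp_all add: aut_add[OF s] aut_mult[OF s] tL st that)
  thus ?thesis using bij by (simp add: automorphism_def)
qed

lemma aut_inv_right: "automorphism s \<Longrightarrow> x \<in> L \<Longrightarrow> s (inv_into L s x) = x"
  by (simp add: f_inv_into_f aut_surj)

lemma aut_inv_left: "automorphism s \<Longrightarrow> x \<in> L \<Longrightarrow> inv_into L s (s x) = x"
  by (simp add: inv_into_f_f aut_inj)

lemma aut_comp:
  assumes s: "automorphism s" and t: "automorphism t" shows "automorphism (\<lambda>x. s (t x))"
proof -
  have "bij_betw (\<lambda>x. s (t x)) L L"
    using bij_betw_trans[OF aut_bij[OF t] aut_bij[OF s]] by (simp add: o_def)
  thus ?thesis
    by (auto simp: automorphism_def aut_add[OF s] aut_add[OF t] aut_mult[OF s] aut_mult[OF t] aut_closed[OF t])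
qed

lemma aut_O:
  assumes s: "automorphism s" and x: "x \<in> \<O>" shows "s x \<in> \<O>"
proof -
  have xL: "x \<in> L" using x O_subset by auto
  obtain p where p: "lead_coeff p = 1" "\<forall>i. poly.coeff p i \<in> \<int>" "poly p x = 0"
    using x by (auto simp: ints_of_def elim: algebraic_int.cases)
  have "0 = s (poly p x)" using p(3) aut_0[OF s] by simp
  also have "\<dots> = (\<Sum>i\<le>Polynomial.degree p. s (poly.coeff p i * x ^ i))"
    unfolding poly_altdef
    by (rule aut_sum[OF s], rule L_mult[OF L_Ints L_power[OF xL]]) (use p(2) in blast)
  also have "\<dots> = poly p (s x)"
    unfolding poly_altdef using p(2) xL
    by (intro sum.cong refl) (simp add: aut_mult[OF s] aut_power[OF s] aut_Ints[OF s] L_power L_Ints)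
  finally have "algebraic_int (s x)" using p by (intro algebraic_int.intros[of p]) auto
  thus ?thesis using aut_closed[OF s xL] by (simp add: ints_of_def)
qed

lemma aut_image_O: assumes s: "automorphism s" shows "s ` \<O> = \<O>"
proof
  show "s ` \<O> \<subseteq> \<O>" using aut_O[OF s] by auto
  show "\<O> \<subseteq> s ` \<O>"
  proof
    fix x assume x: "x \<in> \<O>"
    hence "x \<in> L" using O_subset by auto
    moreover have "inv_into L s x \<in> \<O>" using aut_O[OF aut_inv[OF s] x] .
    ultimately show "x \<in> s ` \<O>" using aut_inv_right[OF s, of x] by (metis imageI)
  qed
qed

lemma is_mod_image:
  assumes s: "automorphism s" and I: "is_mod I" shows "is_mod (s ` I)"
proof (rule is_modI)
  note IL = subsetD[OF is_modD(2)[OF I]]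
  show "s ` I \<subseteq> L" using IL aut_closed[OF s] by auto
  show "0 \<in> s ` I" using is_modD(4)[OF I] aut_0[OF s] by (metis imageI)
  fix x assume "x \<in> s ` I"
  then obtain u where u: "x = s u" "u \<in> I" by auto
  show "x + y \<in> s ` I" if y: "y \<in> s ` I" for y
  proof -
    obtain v where v: "y = s v" "v \<in> I" using y by auto
    have "x + y = s (u + v)" using aut_add[OF s] IL u v by simp
    thus ?thesis using is_modD(5)[OF I u(2) v(2)] by simp
  qed
  show "a * x \<in> s ` I" if a: "a \<in> \<O>" for a
  proof -
    have "a \<in> s ` \<O>" using a by (simp add: aut_image_O[OF s])
    then obtain b where b: "b \<in> \<O>" "a = s b" by (elim imageE)
    have "a * x = s (b * u)" using aut_mult[OF s, of b u] IL u b O_subset by auto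
    thus ?thesis using is_modD(3)[OF I b(1) u(2)] by simp
  qed
qed

lemma iprod_image:
  assumes s: "automorphism s" and "I \<subseteq> L" "J \<subseteq> L"
  shows "s ` iprod I J = iprod (s ` I) (s ` J)"
proof
  have IJ: "iprod I J \<subseteq> L" using assms(2,3) L_mult by (intro iprod_subset L_subspace) auto
  show "s ` iprod I J \<subseteq> iprod (s ` I) (s ` J)"
  proof (rule image_subsetI)
    fix x assume "x \<in> iprod I J"
    hence "x \<in> L \<and> s x \<in> iprod (s ` I) (s ` J)"
    proof (induction rule: iprod_induct)
      case (mult a b)
      hence "a \<in> L" "b \<in> L" using assms by auto
      thus ?case using iprod_mult[of "s a" "s ` I" "s b" "s ` J"] mult by (simp add: aut_mult[OF s] L_mult)
    next
      case (add x y)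
      thus ?case by (simp add: aut_add[OF s] L_add iprod_add)
    qed
    thus "s x \<in> iprod (s ` I) (s ` J)" by simp
  qed
  show "iprod (s ` I) (s ` J) \<subseteq> s ` iprod I J"
  proof
    fix y assume "y \<in> iprod (s ` I) (s ` J)"
    thus "y \<in> s ` iprod I J"
    proof (induction rule: iprod_induct)
      case (mult a b)
      then obtain u v where uv: "a = s u" "u \<in> I" "b = s v" "v \<in> J" by auto
      have "u \<in> L" "v \<in> L" using uv assms(2,3) by auto
      hence "a * b = s (u * v)" by (simp add: uv(1,3) aut_mult[OF s])
      thus ?case using iprod_mult[OF uv(2,4)] by simp
    next
      case (add x y)
      then obtain u v where uv: "x = s u" "u \<in> iprod I J" "y = s v" "v \<in> iprod I J" by auto
      have "u \<in> L" "v \<in> L" using uv IJ by auto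
      hence "x + y = s (u + v)" by (simp add: uv(1,3) aut_add[OF s])
      thus ?case using iprod_add[OF uv(2,4)] by simp
    qed
  qed
qed

lemma image_ne_zero:
  assumes s: "automorphism s" and I: "is_mod I" "I \<noteq> {0}" shows "s ` I \<noteq> {0}"
proof -
  obtain a where a: "a \<in> I" "a \<noteq> 0" using I is_modD(4)[OF I(1)] by blast
  hence "s a \<noteq> 0" using aut_nonzero[OF s] is_modD(2)[OF I(1)] by auto
  thus ?thesis using a(1) by blast
qed

lemma fractional_image:
  assumes s: "automorphism s" and I: "fractional_ideal L I" shows "fractional_ideal L (s ` I)"
proof -
  have mod: "is_mod I" "I \<noteq> {0}" using I by (auto simp: fractional_ideal_iff)
  obtain d where d: "d \<in> \<O>" "d \<noteq> 0" "\<And>y. y \<in> I \<Longrightarrow> d * y \<in> \<O>"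
    using I by (auto simp: fractional_ideal_iff)
  have "s d * s y \<in> \<O>" if "y \<in> I" for y
  proof -
    have "d \<in> L" "y \<in> L" using d(1) O_subset is_modD(2)[OF mod(1)] that by auto
    thus ?thesis using aut_O[OF s d(3)[OF that]] aut_mult[OF s] by simp
  qed
  moreover have "s d \<in> \<O> - {0}" using aut_O[OF s d(1)] aut_nonzero[OF s] d O_subset by auto
  ultimately have "\<exists>d\<in>\<O> - {0}. \<forall>y\<in>s ` I. d * y \<in> \<O>" by blast
  thus ?thesis using is_mod_image[OF s mod(1)] image_ne_zero[OF s mod] by (simp add: fractional_ideal_iff)
qed

lemma prime_image:
  assumes s: "automorphism s" and P: "P \<in> prime_ideals L" shows "s ` P \<in> prime_ideals L"
  unfolding prime_ideals_iff
proof (intro conjI ballI impI)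
  note PD = primeD[OF P]
  show "is_mod (s ` P)" by (rule is_mod_image[OF s PD(1)])
  show "s ` P \<subseteq> \<O>" using PD(2) aut_O[OF s] by auto
  show "s ` P \<noteq> {0}" by (rule image_ne_zero[OF s PD(1,3)])
  have mem: "s x \<in> s ` P \<longleftrightarrow> x \<in> P" if "x \<in> L" for x
    using inj_on_image_mem_iff[OF aut_inj[OF s] that] is_modD(2)[OF PD(1)] by blast
  show "1 \<notin> s ` P" using mem[OF L_1] PD(4) by (simp add: aut_1[OF s])
  fix a b assume "a \<in> \<O>" "b \<in> \<O>" and ab: "a * b \<in> s ` P"
  hence "a \<in> s ` \<O>" "b \<in> s ` \<O>" by (simp_all add: aut_image_O[OF s])
  then obtain u v where uv: "u \<in> \<O>" "a = s u" "v \<in> \<O>" "b = s v" by (elim imageE)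
  have "u \<in> L" "v \<in> L" using uv O_subset by auto
  hence "u * v \<in> P" using ab uv mem[of "u * v"] by (simp add: aut_mult[OF s] L_mult)
  thus "a \<in> s ` P \<or> b \<in> s ` P" using PD(5)[OF uv(1,3)] uv by blast
qed

lemma prime_above_image:
  assumes s: "automorphism s" and P: "P \<in> primes_above_nat L q" shows "s ` P \<in> primes_above_nat L q"
proof -
  have PL: "P \<subseteq> L" using primeD(2)[OF primes_above_natD(1)[OF P]] O_subset by blast
  have "x \<in> s ` P \<longleftrightarrow> x \<in> P" if "x \<in> \<int>" for x
  proof -
    have "s x \<in> s ` P \<longleftrightarrow> x \<in> P"
      using inj_on_image_mem_iff[OF aut_inj[OF s] L_Ints[OF that]] PL by blast
    thus ?thesis by (simp add: aut_Ints[OF s that])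
  qed
  hence "s ` P \<inter> \<int> = P \<inter> \<int>" by blast
  thus ?thesis using P prime_image[OF s] by (simp add: primes_above_def ints_of_Rats)
qed

lemma pow_image:
  assumes s: "automorphism s" and P: "P \<in> prime_ideals L"
  shows "s ` (P [^]\<^bsub>\<I>\<^esub> (k::nat)) = (s ` P) [^]\<^bsub>\<I>\<^esub> k"
proof (induction k)
  case 0 thus ?case by (simp add: aut_image_O[OF s])
next
  case (Suc k)
  thus ?case using iprod_image[OF s is_modD(2)[OF prime_nat_pow_subset(1)[OF P]] is_modD(2)[OF primeD(1)[OF P]]]
    by simp
qed

lemma principal_image:
  assumes s: "automorphism s" and x: "x \<in> L"
  shows "s ` principal_ideal L x = principal_ideal L (s x)"
proof -
  have "s ` principal_ideal L x = (\<lambda>a. s (a * x)) ` \<O>" by (simp add: principal_ideal_def image_image)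
  also have "\<dots> = (\<lambda>a. s a * s x) ` \<O>"
    using aut_mult[OF s _ x] O_subset by (intro image_cong) auto
  also have "\<dots> = (\<lambda>a. a * s x) ` (s ` \<O>)" by (simp add: image_image)
  finally show ?thesis by (simp add: aut_image_O[OF s] principal_ideal_def)
qed

text \<open>If \<open>d\<close> is nonzero, some positive integer \<open>m\<close> is an integral
  multiple of \<open>d\<close> and so lies in all powers of \<open>P\<close>. These are pairwise
  distinct, but only finitely many ideals contain \<open>m\<close>.\<close>

lemma zero_if_in_all_powers:
  assumes P: "P \<in> prime_ideals L" and d: "d \<in> \<O>" "\<And>k. k > 0 \<Longrightarrow> d \<in> P [^]\<^bsub>\<I>\<^esub> (k::nat)"
  shows "d = 0"
proof (rule ccontr)
  assume "d \<noteq> 0"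
  obtain m :: nat where m: "m > 0" "of_nat m * inverse d \<in> \<O>"
    using O_multiple[OF L_inverse] d(1) O_subset by blast
  have mem: "of_nat m \<in> P [^]\<^bsub>\<I>\<^esub> k" for k :: nat
  proof (cases "k = 0")
    case False
    hence "of_nat m * inverse d * d \<in> P [^]\<^bsub>\<I>\<^esub> k"
      using is_modD(3)[OF prime_nat_pow_subset(1)[OF P] m(2) d(2)] by blast
    also have "of_nat m * inverse d * d = of_nat m" using \<open>d \<noteq> 0\<close> by simp
    finally show ?thesis .
  qed (auto intro: O_Ints)
  have "range (\<lambda>k::nat. P [^]\<^bsub>\<I>\<^esub> k) \<subseteq> {I. is_mod I \<and> I \<subseteq> \<O> \<and> of_nat m \<in> I}"
    using mem prime_nat_pow_subset(1,2)[OF P] by auto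
  hence "finite (range (\<lambda>k::nat. P [^]\<^bsub>\<I>\<^esub> k))" by (rule finite_subset) (rule finite_ideals_containing[OF m(1)])
  moreover have "inj (\<lambda>k::nat. P [^]\<^bsub>\<I>\<^esub> k)"
  proof (rule injI)
    fix j k :: nat assume jk: "P [^]\<^bsub>\<I>\<^esub> j = P [^]\<^bsub>\<I>\<^esub> k"
    have e: "ideal_exponent L (P [^]\<^bsub>\<I>\<^esub> n) P = int n" for n :: nat
      using ideal_exponent_int_pow[OF fractional_prime[OF P], of "int n" P]
      by (simp add: int_pow_int ideal_exponent_prime[OF P])
    have "int j = int k" using e[of j] e[of k] unfolding jk by linarith
    thus "j = k" by simp
  qed
  ultimately show False using finite_imageD infinite_UNIV_nat by blast
qed

text \<open>An automorphism that fixes a completely split prime is continuous for the adic topology of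
  that prime, in which the rational numbers with denominators prime to it are dense.\<close>

lemma aut_eq_id_if_fixes_split_prime:
  assumes q: "prime q" and card: "card (primes_above_nat L q) \<ge> card B"
    and P: "P \<in> primes_above_nat L q" and s: "automorphism s" "s ` P = P" and x: "x \<in> L"
  shows "s x = x"
proof -
  have PP: "P \<in> prime_ideals L" using primes_above_natD(1)[OF P] .
  have main: "s a = a" if a: "a \<in> \<O>" for a
  proof -
    have aL: "a \<in> L" using a O_subset by auto
    have "s a - a \<in> P [^]\<^bsub>\<I>\<^esub> k" if k: "k > 0" for k :: nat
    proof -
      note M = prime_nat_pow_subset(1)[OF PP, of k]
      obtain m c :: int where mc: "\<not> int q dvd m" "of_int m * a - of_int c \<in> P [^]\<^bsub>\<I>\<^esub> k"
        using split_approximation[OF q card P a k] by blast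
      \<comment> \<open>\<open>s\<close> fixes integers and maps \<open>P ^ k\<close> to itself, so
        \<open>m * a\<close> and its image are congruent to the same integer
        \<open>c\<close>.\<close>
      have "s (of_int m * a - of_int c) \<in> s ` (P [^]\<^bsub>\<I>\<^esub> k)" using mc(2) by simp
      also have "s ` (P [^]\<^bsub>\<I>\<^esub> k) = P [^]\<^bsub>\<I>\<^esub> k" using pow_image[OF s(1) PP] s(2) by simp
      also have "s (of_int m * a - of_int c) = of_int m * s a - of_int c"
        using aL by (simp add: aut_diff[OF s(1)] aut_mult[OF s(1)] aut_of_int[OF s(1)] L_mult L_Ints)
      finally have "of_int m * s a - of_int c - (of_int m * a - of_int c) \<in> P [^]\<^bsub>\<I>\<^esub> k"
        using mc(2) by (rule is_modD(6)[OF M])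
      hence "of_int m * (s a - a) \<in> P [^]\<^bsub>\<I>\<^esub> k" by (simp add: algebra_simps)
      thus ?thesis using coprime_ideal_pow_cancel[OF q P mc(1)] O_diff[OF aut_O[OF s(1) a] a] by blast
    qed
    hence "s a - a = 0" using zero_if_in_all_powers[OF PP] O_diff[OF aut_O[OF s(1) a] a] by blast
    thus ?thesis by simp
  qed
  obtain m :: nat where m: "m > 0" "of_nat m * x \<in> \<O>" using O_multiple[OF x] .
  have "of_nat m * s x = s (of_nat m * x)"
    using aut_mult[OF s(1), of "of_nat m" x] aut_Ints[OF s(1), of "of_nat m"] x L_Ints by simp
  also have "\<dots> = of_nat m * x" by (rule main[OF m(2)])
  finally show ?thesis using m(1) by simp
qed

text \<open>The primes generate the ideal group, so homomorphisms from it to the integers need to be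
  compared at primes only.\<close>

lemma hom_prime_power_prod:
  assumes h: "h \<in> hom \<I> integer_group" and a: "valid_exponents a"
  shows "h (prime_power_prod a) = (\<Sum>P | a P \<noteq> 0. a P * h P)"
proof -
  have fin: "h (finprod \<I> f A) = (\<Sum>i\<in>A. h (f i))"
    if "finite A" "\<And>i. i \<in> A \<Longrightarrow> f i \<in> carrier \<I>" for f :: "complex set \<Rightarrow> complex set" and A
    using that
  proof (induction rule: finite_induct)
    case empty
    have "h \<one>\<^bsub>\<I>\<^esub> = \<one>\<^bsub>integer_group\<^esub>" by (rule hom_one[OF h G.is_group]) simp
    thus ?case by simp
  next
    case (insert i A)
    have "finprod \<I> f (insert i A) = f i \<otimes>\<^bsub>\<I>\<^esub> finprod \<I> f A"
      using insert by (intro G.finprod_insert) auto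
    moreover have "h (f i \<otimes>\<^bsub>\<I>\<^esub> finprod \<I> f A) = h (f i) + h (finprod \<I> f A)"
      using hom_mult[OF h, of "f i" "finprod \<I> f A"] insert.prems G.finprod_closed[of f A] by fastforce
    ultimately show ?case using insert by simp
  qed
  have "h (prime_power_prod a) = (\<Sum>P | a P \<noteq> 0. h (P [^]\<^bsub>\<I>\<^esub> a P))"
    unfolding prime_power_prod_def using a prime_int_pow_closed
    by (intro fin) (auto simp: valid_exponents_def simp del: ideal_group_simps)
  also have "\<dots> = (\<Sum>P | a P \<noteq> 0. a P * h P)"
  proof (rule sum.cong)
    fix P assume "P \<in> {P. a P \<noteq> 0}"
    hence "P \<in> carrier \<I>" using a fractional_prime by (auto simp: valid_exponents_def)
    thus "h (P [^]\<^bsub>\<I>\<^esub> a P) = a P * h P"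
      using hom_int_pow[OF h _ G.is_group, of P "a P"] by simp
  qed simp
  finally show ?thesis .
qed

text \<open>As functions of \<open>I\<close> both sides are homomorphisms to the integers. They
  agree on primes since \<open>s\<close>, being injective on \<open>L\<close>, keeps distinct primes
  distinct.\<close>

lemma ideal_exponent_image:
  assumes s: "automorphism s" and I: "fractional_ideal L I" and P: "P \<in> prime_ideals L"
  shows "ideal_exponent L (s ` I) (s ` P) = ideal_exponent L I P"
proof -
  have h: "(\<lambda>I. ideal_exponent L (s ` I) (s ` P)) \<in> hom \<I> integer_group"
    by (rule homI)
       (auto simp: ideal_exponent_mult fractional_image[OF s] integer_group_def
         iprod_image[OF s is_modD(2)[OF fractional_mod] is_modD(2)[OF fractional_mod]])
  have eq: "ideal_exponent L (s ` Q) (s ` P) = ideal_exponent L Q P" if Q: "Q \<in> prime_ideals L" for Q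
  proof -
    have "s ` P = s ` Q \<longleftrightarrow> P = Q"
      using inj_on_image_eq_iff[OF aut_inj[OF s] is_modD(2)[OF primeD(1)[OF P]] is_modD(2)[OF primeD(1)[OF Q]]] .
    thus ?thesis using ideal_exponent_prime[OF Q] ideal_exponent_prime[OF prime_image[OF s Q]] by simp
  qed
  note v = ideal_exponent_valid[OF I]
  have "ideal_exponent L (s ` I) (s ` P) = (\<Sum>Q | ideal_exponent L I Q \<noteq> 0. ideal_exponent L I Q * ideal_exponent L (s ` Q) (s ` P))"
    using hom_prime_power_prod[OF h v(1)] unfolding v(2) .
  also have "\<dots> = (\<Sum>Q | ideal_exponent L I Q \<noteq> 0. ideal_exponent L I Q * ideal_exponent L Q P)"
    using v(1) eq by (intro sum.cong) (auto simp: valid_exponents_def)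
  also have "\<dots> = ideal_exponent L I P"
    using hom_prime_power_prod[OF ideal_exponent_hom[of P] v(1)] unfolding v(2) by simp
  finally show ?thesis .
qed

section \<open>Valuations of elements\<close>

definition val :: "complex set \<Rightarrow> complex \<Rightarrow> int" where
  "val P x = ideal_exponent L (principal_ideal L x) P"

lemma val_mult:
  "x \<in> L \<Longrightarrow> x \<noteq> 0 \<Longrightarrow> y \<in> L \<Longrightarrow> y \<noteq> 0 \<Longrightarrow> val P (x * y) = val P x + val P y"
  by (simp add: val_def iprod_principal[symmetric] ideal_exponent_mult fractional_principal)

lemma val_1: "val P 1 = 0"
  by (simp add: val_def principal_ideal_def ideal_exponent_one)

lemma val_power: "x \<in> L \<Longrightarrow> x \<noteq> 0 \<Longrightarrow> val P (x ^ n) = int n * val P x"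
  by (induction n) (auto simp: val_1 val_mult L_power algebra_simps)

lemma val_prod:
  "(\<And>i. i \<in> A \<Longrightarrow> f i \<in> L \<and> f i \<noteq> 0) \<Longrightarrow> finite A \<Longrightarrow> val P (prod f A) = (\<Sum>i\<in>A. val P (f i))"
proof (induction A rule: infinite_finite_induct)
  case (insert i A)
  have "prod f A \<in> L" "prod f A \<noteq> 0" using insert by (auto intro!: L_prod)
  thus ?case using insert by (simp add: val_mult)
qed (auto simp: val_1)

lemma val_image:
  assumes "automorphism s" "x \<in> L" "x \<noteq> 0" "P \<in> prime_ideals L"
  shows "val (s ` P) (s x) = val P x"
  unfolding val_def principal_image[OF assms(1,2), symmetric]
  using assms by (intro ideal_exponent_image fractional_principal)

lemma val_root_of_unity:
  assumes "x \<in> L" "x ^ n = 1" "n > 0" shows "val P x = 0"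
proof -
  have "x \<noteq> 0" using assms(2,3) by (auto simp: power_0_left)
  thus ?thesis using val_power[OF assms(1), of P n] assms by (simp add: val_1)
qed

end

section \<open>Subfields of the complex numbers of finite degree\<close>

lemma complex_subfieldI:
  assumes "1 \<in> A" "\<And>x y. x \<in> A \<Longrightarrow> y \<in> A \<Longrightarrow> x + y \<in> A" "\<And>x y. x \<in> A \<Longrightarrow> y \<in> A \<Longrightarrow> x * y \<in> A"
    "\<And>x. x \<in> A \<Longrightarrow> - x \<in> A" "\<And>x. x \<in> A \<Longrightarrow> x \<noteq> 0 \<Longrightarrow> inverse x \<in> A"
  shows "subfield A complex_ring"
proof (rule field.subfieldI'[OF complex_ring_field])
  show "subring A complex_ring" by (rule cx.subringI) (use assms in auto)
  show "inv\<^bsub>complex_ring\<^esub> k \<in> A" if "k \<in> A - {\<zero>\<^bsub>complex_ring\<^esub>}" for k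
    using that assms(5)[of k] by (simp add: complex_ring_m_inv)
qed

lemma subfield_Rats: "subfield \<rat> complex_ring"
  by (rule complex_subfieldI) auto

lemma generate_field_least:
  "subfield E complex_ring \<Longrightarrow> H \<subseteq> E \<Longrightarrow> generate_field complex_ring H \<subseteq> E"
  using field.generate_field_min_subfield1[OF complex_ring_field, of H E] by simp

lemma generate_field_subset: "H \<subseteq> generate_field complex_ring H"
  by (auto intro: generate_field.incl)

lemma generate_field_subfield: "subfield (generate_field complex_ring H) complex_ring"
  using field.generate_field_is_subfield[OF complex_ring_field, of H] by simp

text \<open>A bridge from the inductively defined dimension to the spans of \<open>qv\<close>, in
  which the dependence arguments are carried out.\<close>

lemma dimension_Rats_span:
  assumes "cx.dimension n \<rat> E"
  shows "\<exists>B. finite B \<and> card B \<le> n \<and> E \<subseteq> qv.span B"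
proof -
  have "K = \<rat> \<Longrightarrow> \<exists>B. finite B \<and> card B \<le> n \<and> E \<subseteq> qv.span B" if "cx.dimension n K E" for K
    using that
  proof (induction rule: cx.dimension.induct)
    case (zero_dim K)
    thus ?case by (intro exI[of _ "{}"]) auto
  next
    case (Suc_dim v E n K)
    then obtain B where B: "finite B" "card B \<le> n" "E \<subseteq> qv.span B" by auto
    have "cx.line_extension K v E \<subseteq> qv.span (insert v B)"
    proof
      fix u assume "u \<in> cx.line_extension K v E"
      then obtain k w where u: "k \<in> K" "w \<in> E" "u = k * v + w"
        by (auto simp: cx.line_extension_mem_iff)
      obtain r where "k = of_rat r" using u(1) Suc_dim.prems by (auto elim: Rats_cases)
      moreover have "v \<in> qv.span (insert v B)" by (rule qv.span_base) simp
      moreover have "w \<in> qv.span (insert v B)" using u(2) B(3) qv.span_mono[of B "insert v B"] by blast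
      ultimately show "u \<in> qv.span (insert v B)" unfolding u(3)
        by (auto intro: qv.span_add qv.span_scale)
    qed
    moreover have "finite (insert v B)" "card (insert v B) \<le> Suc n"
      using B card_insert_le_m1[of "Suc n" B v] by auto
    ultimately show ?case by blast
  qed
  thus ?thesis using assms by blast
qed

lemma (in number_field) L_Rats: "x \<in> \<rat> \<Longrightarrow> x \<in> L"
proof -
  assume "x \<in> \<rat>"
  then obtain a b where "x = of_int a / of_int b" by (auto elim: Rats_cases')
  thus "x \<in> L" using L_divide[of "of_int a" "of_int b"] L_Ints by simp
qed

text \<open>Needed for \<open>L\<close>, whose finite dimension is not given. Only once it is known
  can \<open>degree_ext\<close> bound the size of a spanning set.\<close>

lemma finite_dimension_if_span:
  assumes L: "subfield L complex_ring" and B: "finite B" "L \<subseteq> qv.span B"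
  shows "cx.finite_dimension \<rat> L"
proof -
  obtain Us where Us: "set Us = B" using finite_list[OF B(1)] by blast
  define V where "V = cx.Span \<rat> Us"
  have V: "zm.subspace V"
    using cx.Span_is_add_subgroup[OF subfield_Rats, of Us]
    by (simp add: V_def flip: additive_subgroup_complex_iff)
  have "qv.subspace V"
  proof (rule qv.subspaceI)
    show "of_rat c * x \<in> V" if "x \<in> V" for c x
      using cx.Span_smult_closed[OF subfield_Rats, of Us "of_rat c" x] that by (simp add: V_def)
  qed (use zm.subspace_0[OF V] zm.subspace_add[OF V] in auto)
  moreover have "B \<subseteq> V"
    using cx.Span_base_incl[OF subfield_Rats, of Us] by (simp add: V_def Us)
  ultimately have "L \<subseteq> V" using B(2) qv.span_minimal by blast
  moreover have "cx.finite_dimension \<rat> V"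
    unfolding V_def by (rule cx.Span_finite_dimension[OF subfield_Rats]) simp
  moreover have "subalgebra \<rat> L complex_ring"
  proof -
    interpret number_field L B by (rule number_field.intro) (fact L B)+
    have "k * v \<in> L" if "k \<in> \<rat>" "v \<in> L" for k v
      using L_mult L_Rats that by simp
    moreover have "subgroup L (add_monoid complex_ring)"
      using L_subspace unfolding additive_subgroup_complex_iff .
    ultimately show ?thesis by (simp add: subalgebra_def subalgebra_axioms_def)
  qed
  ultimately show ?thesis
    using cx.subalbegra_incl_imp_finite_dimension[OF subfield_Rats] by blast
qed

lemma finite_dimension_span:
  assumes "cx.finite_dimension \<rat> L"
  obtains B where "finite B" "card B \<le> degree_ext \<rat> L" "L \<subseteq> qv.span B"
  using dimension_Rats_span[OF cx.finite_dimensionE[OF subfield_Rats assms]] that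
  by (auto simp: degree_ext_def over_def)

text \<open>Removing factors of the variable from an annihilating polynomial makes its constant term
  \<open>c\<close> nonzero. Then \<open>c + b * p (b) = 0\<close> displays
  \<open>- p (b) / c\<close> as the inverse of \<open>b\<close>. The induction on
  \<open>pCons\<close> carries out the removal.\<close>

lemma algebraic_inverse_poly:
  assumes b: "algebraic b" "b \<noteq> 0"
  obtains g where "\<And>i. poly.coeff g i \<in> \<rat>" "b * poly g b = 1"
proof -
  have "\<exists>g. (\<forall>i. poly.coeff g i \<in> \<rat>) \<and> b * poly g b = 1"
    if "\<forall>i. poly.coeff p i \<in> \<int>" "p \<noteq> 0" "poly p b = 0" for p
    using that
  proof (induction p)
    case (pCons c p)
    have cp: "c \<in> \<int>" "\<And>i. poly.coeff p i \<in> \<int>"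
      using pCons.prems(1)[rule_format, of 0] pCons.prems(1)[rule_format, of "Suc _"] by auto
    show ?case
    proof (cases "c = 0")
      case True
      thus ?thesis using pCons b(2) cp by auto
    next
      case False
      have "b * poly p b = - c" using pCons.prems(3) by (simp add: eq_neg_iff_add_eq_0 add.commute)
      hence "b * poly (Polynomial.smult (- 1 / c) p) b = 1" using False by (simp add: field_simps)
      moreover have "\<forall>i. poly.coeff (Polynomial.smult (- 1 / c) p) i \<in> \<rat>"
      proof
        fix i
        have "c \<in> \<rat>" "poly.coeff p i \<in> \<rat>" using cp Ints_subset_Rats by blast+
        hence "poly.coeff p i / c \<in> \<rat>" by (rule Rats_divide[rotated])
        thus "poly.coeff (Polynomial.smult (- 1 / c) p) i \<in> \<rat>" by simp
      qed
      ultimately show ?thesis by blast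
    qed
  qed simp
  thus ?thesis using that b(1) unfolding algebraic_def by blast
qed

section \<open>Polynomials over a number field and adjunction of a root of unity\<close>

context number_field
begin

definition polys :: "complex poly set" where
  "polys = {g. \<forall>i. poly.coeff g i \<in> L}"

lemma polys_add: "g \<in> polys \<Longrightarrow> h \<in> polys \<Longrightarrow> g + h \<in> polys"
  by (auto simp: polys_def L_add)

lemma polys_mult: "g \<in> polys \<Longrightarrow> h \<in> polys \<Longrightarrow> g * h \<in> polys"
  by (auto simp: polys_def coeff_mult intro!: zm.subspace_sum[OF L_subspace] L_mult)

lemma polys_minus: "g \<in> polys \<Longrightarrow> - g \<in> polys"
  by (auto simp: polys_def L_minus)

lemma polys_const: "a \<in> L \<Longrightarrow> [:a:] \<in> polys"
  by (auto simp: polys_def coeff_pCons L_0 split: nat.splits)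

lemma polys_X: "[:0, 1:] \<in> polys"
  by (auto simp: polys_def coeff_pCons L_0 L_1 split: nat.splits)

lemma polys_pcompose: "g \<in> polys \<Longrightarrow> h \<in> polys \<Longrightarrow> pcompose g h \<in> polys"
proof (induction g)
  case (pCons a g)
  have "a \<in> L" "g \<in> polys"
    using pCons.prems(1) by (auto simp: polys_def coeff_pCons split: nat.splits dest: spec[of _ 0] spec[of _ "Suc _"])
  thus ?case using pCons by (simp add: pcompose_pCons polys_add polys_mult polys_const)
qed (use L_0 in \<open>simp add: polys_def\<close>)

definition adjoin :: "complex \<Rightarrow> complex set" where
  "adjoin z = (\<lambda>g. poly g z) ` polys"

text \<open>Exponents of \<open>z\<close> reduce modulo \<open>n\<close>, so the polynomial values
  lie in a finite-dimensional space. Their elements are therefore algebraic, and inverses of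
  algebraic numbers are polynomials in them.\<close>

lemma adjoin_root_of_unity:
  assumes z: "z ^ n = 1" "n > 0"
  shows "subfield (adjoin z) complex_ring" "L \<subseteq> adjoin z" "z \<in> adjoin z"
    "adjoin z \<subseteq> qv.span ((\<lambda>(b, i). b * z ^ i) ` (B \<times> {..<n}))"
proof -
  define C where "C = (\<lambda>(b, i). b * z ^ i) ` (B \<times> {..<n})"
  have C: "finite C" by (simp add: C_def finite_B)
  have bz: "b * z ^ i \<in> qv.span C" if "b \<in> B" for b i
  proof -
    have "z ^ i = z ^ (n * (i div n) + i mod n)" by simp
    also have "\<dots> = z ^ (i mod n)" unfolding power_add power_mult z(1) by simp
    finally show ?thesis using that z(2) by (auto simp: C_def intro!: qv.span_base)
  qed
  have az: "a * z ^ i \<in> qv.span C" if "a \<in> L" for a i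
  proof -
    have "a \<in> qv.span B" using that L_span by auto
    thus ?thesis
    proof (induction rule: qv.span_induct_alt)
      case base thus ?case by (simp add: qv.span_zero)
    next
      case (step c b y)
      have "of_rat c * (b * z ^ i) + y * z ^ i \<in> qv.span C"
        by (intro qv.span_add qv.span_scale step bz)
      thus ?case by (simp add: algebra_simps)
    qed
  qed
  have sub: "adjoin z \<subseteq> qv.span C"
    by (auto simp: adjoin_def poly_altdef polys_def intro!: qv.span_sum az)
  thus "adjoin z \<subseteq> qv.span ((\<lambda>(b, i). b * z ^ i) ` (B \<times> {..<n}))" by (simp only: C_def)
  show LA: "L \<subseteq> adjoin z"
  proof
    fix a assume "a \<in> L"
    thus "a \<in> adjoin z" unfolding adjoin_def by (intro image_eqI[OF _ polys_const]) auto
  qed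
  show "z \<in> adjoin z"
    unfolding adjoin_def by (rule image_eqI[OF _ polys_X]) simp
  have mult: "x * y \<in> adjoin z" if xy: "x \<in> adjoin z" "y \<in> adjoin z" for x y
  proof -
    obtain g h where "g \<in> polys" "x = poly g z" "h \<in> polys" "y = poly h z"
      using xy by (auto simp: adjoin_def)
    thus ?thesis unfolding adjoin_def by (intro image_eqI[OF _ polys_mult[of g h]]) auto
  qed
  show "subfield (adjoin z) complex_ring"
  proof (rule complex_subfieldI)
    show "1 \<in> adjoin z" using LA L_1 by auto
    fix x assume x: "x \<in> adjoin z"
    then obtain g where g: "g \<in> polys" "x = poly g z" by (auto simp: adjoin_def)
    show "- x \<in> adjoin z"
      unfolding adjoin_def using g by (intro image_eqI[OF _ polys_minus[OF g(1)]]) auto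
    show "x * y \<in> adjoin z" if "y \<in> adjoin z" for y by (rule mult[OF x that])
    show "x + y \<in> adjoin z" if y: "y \<in> adjoin z" for y
    proof -
      obtain h where h: "h \<in> polys" "y = poly h z" using y by (auto simp: adjoin_def)
      show ?thesis
        unfolding adjoin_def using g h by (intro image_eqI[OF _ polys_add[OF g(1) h(1)]]) auto
    qed
    show "inverse x \<in> adjoin z" if "x \<noteq> 0"
    proof -
      have "x ^ k \<in> adjoin z" for k
        by (induction k) (use LA L_1 mult x in auto)
      hence "algebraic x" using sub by (intro algebraic_if_powers_in_span[OF C]) blast
      then obtain h where h: "\<And>i. poly.coeff h i \<in> \<rat>" "x * poly h x = 1"
        using algebraic_inverse_poly[OF _ \<open>x \<noteq> 0\<close>] by blast
      have "h \<in> polys" using h(1) L_Rats by (auto simp: polys_def)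
      hence "poly (pcompose h g) z \<in> adjoin z"
        unfolding adjoin_def using g(1) by (intro imageI polys_pcompose)
      \<comment> \<open>The inverse is \<open>h (x)\<close> with \<open>x = g (z)\<close>, hence the
        composed polynomial.\<close>
      moreover have "inverse x = poly (pcompose h g) z"
        using h(2) that by (simp add: poly_pcompose g(2) field_simps)
      ultimately show ?thesis by simp
    qed
  qed
qed

lemma fixed_subfield:
  assumes s: "\<And>x y. x \<in> L \<Longrightarrow> y \<in> L \<Longrightarrow> s (x + y) = s x + s y"
    "\<And>x y. x \<in> L \<Longrightarrow> y \<in> L \<Longrightarrow> s (x * y) = s x * s y" "s 1 = (1::complex)"
  shows "subfield {x \<in> L. s x = x} complex_ring"
proof (rule complex_subfieldI)
  have s0: "s 0 = 0" using s(1)[OF L_0 L_0] by simp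
  fix x assume x: "x \<in> {x \<in> L. s x = x}"
  have "s x + s (- x) = 0" using s(1)[of x "- x"] x L_minus s0 by simp
  thus "- x \<in> {x \<in> L. s x = x}" using x L_minus by (simp add: add_eq_0_iff)
  assume "x \<noteq> 0"
  hence "s x * s (inverse x) = 1" using s(2)[of x "inverse x"] x L_inverse s(3) by simp
  hence "x * s (inverse x) = 1" using x by simp
  hence "inverse x = s (inverse x)" by (rule inverse_unique)
  thus "inverse x \<in> {x \<in> L. s x = x}" using x L_inverse by auto
qed (use s L_1 L_add L_mult in auto)

text \<open>An injective endomorphism permutes the finitely many roots in \<open>L\<close> of every integer polynomial.\<close>

lemma automorphismI:
  assumes L: "\<And>x. x \<in> L \<Longrightarrow> s x \<in> L" and add: "\<And>x y. x \<in> L \<Longrightarrow> y \<in> L \<Longrightarrow> s (x + y) = s x + s y"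
    and mult: "\<And>x y. x \<in> L \<Longrightarrow> y \<in> L \<Longrightarrow> s (x * y) = s x * s y" and one: "s 1 = 1"
  shows "automorphism s"
proof -
  have s0: "s 0 = 0" using add[OF L_0 L_0] by simp
  have nz: "s x \<noteq> 0" if "x \<in> L" "x \<noteq> 0" for x
    using mult[of x "inverse x"] L_inverse that one by auto
  have inj: "inj_on s L"
  proof (rule inj_onI)
    fix x y assume xy: "x \<in> L" "y \<in> L" "s x = s y"
    have "s (x - y) + s y = s x" using add[of "x - y" y] L_diff xy by simp
    hence "s (x - y) = 0" using xy by simp
    thus "x = y" using nz[of "x - y"] L_diff xy by auto
  qed
  have fix_sub: "subfield {x \<in> L. s x = x} complex_ring" by (rule fixed_subfield[OF add mult one])
  \<comment> \<open>As a number field, the fixed field contains the integers, so \<open>s\<close>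
    fixes the coefficients of the integer polynomial below.\<close>
  interpret fixed: number_field "{x \<in> L. s x = x}" B
    by (rule number_field.intro) (use fix_sub finite_B L_span in auto)
  have "L \<subseteq> s ` L"
  proof
    fix x assume x: "x \<in> L"
    obtain p where p: "\<And>i. poly.coeff p i \<in> \<int>" "p \<noteq> 0" "poly p x = 0"
      using L_algebraic[OF x] by (auto simp: algebraic_def)
    define R where "R = {y \<in> L. poly p y = 0}"
    have "finite R" unfolding R_def using poly_roots_finite[OF p(2)] by simp
    have poly_s: "s (poly p y) = poly p (s y)" if y: "y \<in> L" for y
    proof -
      have pw: "s (y ^ n) = s y ^ n" for n
        by (induction n) (simp_all add: one mult[OF y L_power[OF y]])
      have "s (sum f {..n}) = (\<Sum>i\<le>n. s (f i))" if "\<And>i. f i \<in> L" for f and n :: nat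
        using that by (induction n) (simp_all add: add zm.subspace_sum[OF L_subspace])
      moreover have "s c = c" if "c \<in> \<int>" for c using fixed.L_Ints[OF that] by simp
      ultimately show ?thesis unfolding poly_altdef
        using p(1) y by (simp add: L_mult L_Ints L_power mult pw)
    qed
    have "s ` R \<subseteq> R" unfolding R_def using L s0 by (auto simp flip: poly_s)
    moreover have "inj_on s R" using inj by (rule inj_on_subset) (auto simp: R_def)
    ultimately have "s ` R = R" using endo_inj_surj[OF \<open>finite R\<close>] by blast
    moreover have "x \<in> R" using x p(3) by (simp add: R_def)
    ultimately show "x \<in> s ` L" by (auto simp: R_def)
  qed
  hence "bij_betw s L L" using inj L by (auto simp: bij_betw_def)
  thus ?thesis using add mult by (simp add: automorphism_def)
qed

lemma gal_group_automorphism: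
  assumes "s \<in> carrier (gal_group M L)"
  shows "automorphism s" "a \<in> M \<Longrightarrow> s a = a"
proof -
  from assms have s: "bij_betw s L L" "s \<in> Ring.ring_hom (subring_of L) (subring_of L)" "\<forall>a\<in>M. s a = a"
    by (auto simp: gal_group_def Bij_def ring_iso_def)
  thus "automorphism s" "a \<in> M \<Longrightarrow> s a = a"
    using Ring.ring_hom_add[OF s(2)] Ring.ring_hom_mult[OF s(2)] by (auto simp: automorphism_def)
qed

lemma aut_funpow:
  assumes "automorphism s" shows "automorphism (s ^^ j)"
proof (induction j)
  case 0 thus ?case by (simp add: automorphism_def bij_betw_def)
next
  case (Suc j)
  thus ?case using aut_comp[OF assms Suc] by (simp add: o_def)
qed

end

section \<open>The compositum with a cyclotomic field\<close>

text \<open>Nothing is assumed about the image, so this covers the elements of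
  \<open>embeddings\<close>, which are not known beforehand to map \<open>L\<close> to itself.
  Without injectivity, \<open>s 1 = 1\<close> has to be required.\<close>

definition hom_on :: "complex set \<Rightarrow> (complex \<Rightarrow> complex) \<Rightarrow> bool" where
  "hom_on A s \<longleftrightarrow> (\<forall>x\<in>A. \<forall>y\<in>A. s (x + y) = s x + s y \<and> s (x * y) = s x * s y) \<and> s 1 = 1"

context number_field
begin

lemma polys_pCons: "pCons a g \<in> polys \<longleftrightarrow> a \<in> L \<and> g \<in> polys"
proof
  assume "pCons a g \<in> polys"
  hence c: "poly.coeff (pCons a g) i \<in> L" for i by (simp add: polys_def)
  show "a \<in> L \<and> g \<in> polys" using c[of 0] c[of "Suc _"] by (simp add: polys_def)
qed (auto simp: polys_def coeff_pCons split: nat.splits)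

lemma polys_prod: "(\<And>i. i \<in> A \<Longrightarrow> f i \<in> polys) \<Longrightarrow> prod f A \<in> polys"
  using polys_const[OF L_1] by (induction A rule: infinite_finite_induct) (auto intro: polys_mult simp: one_pCons)

lemma aut_hom_on: "automorphism s \<Longrightarrow> hom_on L s"
  by (auto simp: hom_on_def aut_add aut_mult aut_1)

context
  fixes s assumes s: "hom_on L s"
begin

lemma hom_add: "x \<in> L \<Longrightarrow> y \<in> L \<Longrightarrow> s (x + y) = s x + s y"
  and hom_mult: "x \<in> L \<Longrightarrow> y \<in> L \<Longrightarrow> s (x * y) = s x * s y"
  and hom_1: "s 1 = 1"
  using s by (auto simp: hom_on_def)

lemma hom_0: "s 0 = 0"
  using hom_add[OF L_0 L_0] by simp

lemma hom_minus: "x \<in> L \<Longrightarrow> s (- x) = - s x"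
  using hom_add[of x "- x"] by (simp add: L_minus hom_0 add_eq_0_iff)

lemma hom_sum: "(\<And>i. i \<in> A \<Longrightarrow> f i \<in> L) \<Longrightarrow> s (sum f A) = (\<Sum>i\<in>A. s (f i))"
  by (induction A rule: infinite_finite_induct)
     (auto simp: hom_0 hom_add zm.subspace_sum[OF L_subspace])

lemma hom_map_poly_pCons: "map_poly s (pCons a g) = pCons (s a) (map_poly s g)"
  using hom_0 by (rule Polynomial.map_poly_pCons)

lemma hom_poly: "g \<in> polys \<Longrightarrow> x \<in> L \<Longrightarrow> poly g x \<in> L \<and> s (poly g x) = poly (map_poly s g) (s x)"
proof (induction g)
  case (pCons a g)
  thus ?case
    by (auto simp: polys_pCons hom_map_poly_pCons hom_0 hom_add hom_mult L_mult L_add)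
qed (simp add: hom_0 L_0)

lemma map_poly_add: "g \<in> polys \<Longrightarrow> h \<in> polys \<Longrightarrow> map_poly s (g + h) = map_poly s g + map_poly s h"
  by (intro poly_eqI) (simp add: coeff_map_poly hom_0 polys_def hom_add)

lemma map_poly_minus: "g \<in> polys \<Longrightarrow> map_poly s (- g) = - map_poly s g"
  by (intro poly_eqI) (simp add: coeff_map_poly hom_0 polys_def hom_minus)

lemma map_poly_mult: "g \<in> polys \<Longrightarrow> h \<in> polys \<Longrightarrow> map_poly s (g * h) = map_poly s g * map_poly s h"
  by (intro poly_eqI) (simp add: coeff_map_poly hom_0 polys_def coeff_mult hom_sum hom_mult L_mult)

lemma map_poly_prod_linear:
  "A \<subseteq> L \<Longrightarrow> map_poly s (\<Prod>b\<in>A. [:- b, 1:]) = (\<Prod>b\<in>A. [:- s b, 1:])"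
proof (induction A rule: infinite_finite_induct)
  case (insert b A)
  have "[:- b, 1:] \<in> polys" "(\<Prod>b\<in>A. [:- b, 1:]) \<in> polys"
    using insert.prems by (auto intro!: polys_prod simp: polys_pCons L_minus L_1 polys_const[OF L_0, simplified])
  hence "map_poly s ([:- b, 1:] * (\<Prod>b\<in>A. [:- b, 1:])) = map_poly s [:- b, 1:] * (\<Prod>b\<in>A. [:- s b, 1:])"
    using insert map_poly_mult[of "[:- b, 1:]" "\<Prod>b\<in>A. [:- b, 1:]"] by simp
  moreover have "map_poly s [:- b, 1:] = [:- s b, 1:]"
    using insert.prems by (simp add: hom_map_poly_pCons hom_minus hom_1)
  ultimately show ?case using insert.hyps by simp
qed (simp_all add: one_pCons hom_map_poly_pCons hom_1)

end

text \<open>Division is redone by induction on \<open>g\<close> in order to keep the coefficients of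
  quotient and remainder in \<open>L\<close>.\<close>

lemma monic_division:
  assumes g: "g \<in> polys" and m: "m > 0"
  defines "c \<equiv> (\<Sum>i\<le>m. Polynomial.monom 1 i)"
  shows "\<exists>q\<in>polys. \<exists>r\<in>polys. g = c * q + r \<and> (\<forall>i\<ge>m. poly.coeff r i = 0)"
  using g
proof (induction g)
  case 0
  thus ?case by (intro bexI[of _ 0]) auto
next
  case (pCons a g)
  have cc: "poly.coeff c i = (if i \<le> m then 1 else 0)" for i
    by (simp add: c_def coeff_sum)
  have c: "c \<in> polys" by (auto simp: polys_def cc L_0 L_1)
  have aL: "a \<in> L" using pCons.prems by (simp add: polys_pCons)
  from pCons obtain q r where qr: "q \<in> polys" "r \<in> polys" "g = c * q + r" "\<forall>i\<ge>m. poly.coeff r i = 0"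
    by (auto simp: polys_pCons)
  \<comment> \<open>Multiplying the old remainder by the variable moves this coefficient to degree
    \<open>m\<close>, where subtracting \<open>b * c\<close> removes it.\<close>
  define b where "b = poly.coeff r (m - 1)"
  have bL: "b \<in> L" using qr(2) by (simp add: polys_def b_def)
  define r' where "r' = pCons a r + - ([:b:] * c)"
  have "pCons a g = [:0, 1:] * g + [:a:]" by simp
  also have "\<dots> = c * ([:0, 1:] * q + [:b:]) + ([:a:] + [:0, 1:] * r - [:b:] * c)"
    unfolding qr(3) by (simp only: algebra_simps)
  also have "[:a:] + [:0, 1:] * r - [:b:] * c = r'" by (simp add: r'_def)
  finally have "pCons a g = c * ([:0, 1:] * q + [:b:]) + r'" .
  moreover have "[:0, 1:] * q + [:b:] \<in> polys" by (intro polys_add polys_mult polys_X polys_const qr bL)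
  moreover have "r' \<in> polys"
    unfolding r'_def using aL qr(2) by (intro polys_add polys_minus polys_mult polys_const bL c) (simp add: polys_pCons)
  moreover have "poly.coeff r' i = 0" if i: "i \<ge> m" for i
  proof -
    obtain j where j: "i = Suc j" using i m by (cases i) auto
    show ?thesis
    proof (cases "i = m")
      case True
      thus ?thesis using j by (auto simp: r'_def cc b_def)
    next
      case False
      hence "poly.coeff r j = 0" using qr(4) that j by auto
      thus ?thesis using j False that by (simp add: r'_def cc)
    qed
  qed
  ultimately show ?case by blast
qed

end

section \<open>The action of \<open>\<sigma>\<close> on the cyclotomic field\<close>

locale cyclotomic_base = FF: number_field F BF + LL: number_field L B
  for F BF L B :: "complex set" +
  fixes p :: nat and \<zeta> :: complex and K :: "complex set" and \<sigma> :: "complex \<Rightarrow> complex"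
  assumes prime_p: "prime p"
    and root: "primitive_root_of_unity p \<zeta>"
    and K_eq: "K = generate_field complex_ring (\<rat> \<union> {\<zeta>})"
    and L_eq: "L = generate_field complex_ring (F \<union> K)"
    and \<sigma>: "LL.automorphism \<sigma>" "a \<in> F \<Longrightarrow> \<sigma> a = a"
begin

lemma p_gt_1: "p > 1"
  using prime_p by (rule prime_gt_1_nat)

lemma \<zeta>_pow: "\<zeta> ^ p = 1" and \<zeta>_neq_1: "\<zeta> \<noteq> 1"
  using root p_gt_1 unfolding primitive_root_of_unity_def by (auto dest: spec[of _ 1])

lemma inclusions: "F \<subseteq> L" "K \<subseteq> L" "\<zeta> \<in> K" "\<rat> \<subseteq> K" "\<zeta> \<in> L" "subfield K complex_ring"
proof -
  show "F \<subseteq> L" "K \<subseteq> L" unfolding L_eq using generate_field_subset[of "F \<union> K"] by blast+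
  moreover show "\<zeta> \<in> K" "\<rat> \<subseteq> K"
    using generate_field_subset[of "\<rat> \<union> {\<zeta>}"] unfolding K_eq by blast+
  ultimately show "\<zeta> \<in> L" by blast
  show "subfield K complex_ring" unfolding K_eq by (rule generate_field_subfield)
qed

sublocale KK: number_field K B
  by (rule number_field.intro) (use inclusions LL.finite_B LL.L_span in auto)

lemma K_least: "subfield E complex_ring \<Longrightarrow> \<zeta> \<in> E \<Longrightarrow> \<rat> \<subseteq> E \<Longrightarrow> K \<subseteq> E"
  unfolding K_eq by (rule generate_field_least) auto

lemma hom_fixes_K:
  assumes s: "hom_on L s" "s \<zeta> = \<zeta>" and x: "x \<in> K"
  shows "s x = x"
proof -
  have fix_sub: "subfield {x \<in> L. s x = x} complex_ring"
    by (rule LL.fixed_subfield) (use s in \<open>auto simp: hom_on_def\<close>)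
  interpret fixed: number_field "{x \<in> L. s x = x}" B
    by (rule number_field.intro) (use fix_sub LL.finite_B LL.L_span in auto)
  have "K \<subseteq> {x \<in> L. s x = x}"
    using fixed.L_Rats s(2) inclusions(5) by (intro K_least fix_sub) auto
  thus ?thesis using x by blast
qed

lemma roots_of_unity: "{z. z ^ p = 1} = (\<lambda>i. \<zeta> ^ i) ` {..<p}"
proof (rule card_subset_eq[symmetric])
  have card: "card {z::complex. z ^ p = 1} = p" using p_gt_1 by (intro card_roots_unity_eq) auto
  thus "finite {z::complex. z ^ p = 1}" using p_gt_1 by (intro card_ge_0_finite) auto
  show "(\<lambda>i. \<zeta> ^ i) ` {..<p} \<subseteq> {z. z ^ p = 1}"
    by (auto simp: \<zeta>_pow power_mult[symmetric] mult.commute[of _ p] power_mult)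
  have ne: "\<zeta> ^ i \<noteq> \<zeta> ^ j" if "i < j" "j < p" for i j
  proof
    assume "\<zeta> ^ i = \<zeta> ^ j"
    also have "\<dots> = \<zeta> ^ i * \<zeta> ^ (j - i)" using that by (simp flip: power_add)
    finally have "\<zeta> ^ (j - i) = 1" using \<zeta>_pow p_gt_1 by (auto simp: power_0_left)
    moreover have "0 < j - i" "j - i < p" using that by auto
    ultimately show False using root unfolding primitive_root_of_unity_def by blast
  qed
  have "inj_on (\<lambda>i. \<zeta> ^ i) {..<p}"
    by (rule linorder_inj_onI') (use ne in auto)
  thus "card ((\<lambda>i. \<zeta> ^ i) ` {..<p}) = card {z::complex. z ^ p = 1}" by (simp add: card card_image)
qed

text \<open>\<open>\<sigma> \<zeta>\<close> is again a root of unity and thus a power of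
  \<open>\<zeta>\<close>, so \<open>\<sigma>\<close> maps \<open>K\<close> into \<open>K\<close>;
  bijectivity then comes from \<open>automorphismI\<close>.\<close>

lemma \<sigma>_K: "KK.automorphism \<sigma>"
proof (rule KK.automorphismI)
  have "\<sigma> \<zeta> ^ p = 1"
    using LL.aut_power[OF \<sigma>(1) inclusions(5), of p] LL.aut_1[OF \<sigma>(1)] by (simp add: \<zeta>_pow)
  then obtain i where "\<sigma> \<zeta> = \<zeta> ^ i" using roots_of_unity by blast
  hence "\<sigma> \<zeta> \<in> K" using KK.L_power[OF inclusions(3)] by simp
  moreover have "subfield {x \<in> L. \<sigma> x \<in> K} complex_ring"
  proof (rule complex_subfieldI)
    fix x assume x: "x \<in> {x \<in> L. \<sigma> x \<in> K}"
    thus "- x \<in> {x \<in> L. \<sigma> x \<in> K}" by (simp add: LL.L_minus LL.aut_minus[OF \<sigma>(1)] KK.L_minus)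
    assume "x \<noteq> 0"
    hence "\<sigma> x * \<sigma> (inverse x) = 1"
      using LL.aut_mult[OF \<sigma>(1), of x "inverse x"] LL.L_inverse[of x] x LL.aut_1[OF \<sigma>(1)] by simp
    hence "inverse (\<sigma> x) = \<sigma> (inverse x)" by (rule inverse_unique)
    moreover have "inverse (\<sigma> x) \<in> K" using KK.L_inverse x by simp
    ultimately show "inverse x \<in> {x \<in> L. \<sigma> x \<in> K}" using LL.L_inverse x by simp
  qed (auto simp: LL.L_1 LL.L_add LL.L_mult LL.aut_1[OF \<sigma>(1)] LL.aut_add[OF \<sigma>(1)]
      LL.aut_mult[OF \<sigma>(1)] KK.L_1 KK.L_add KK.L_mult)
  ultimately have K: "K \<subseteq> {x \<in> L. \<sigma> x \<in> K}"
    using inclusions FF.L_Rats \<sigma>(2) by (intro K_least) auto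
  show "\<sigma> x \<in> K" if "x \<in> K" for x using K that by blast
  show "\<sigma> 1 = 1" by (rule LL.aut_1[OF \<sigma>(1)])
  fix x y assume "x \<in> K" "y \<in> K"
  hence "x \<in> L" "y \<in> L" using inclusions(2) by auto
  thus "\<sigma> (x + y) = \<sigma> x + \<sigma> y" "\<sigma> (x * y) = \<sigma> x * \<sigma> y"
    by (simp_all add: LL.aut_add[OF \<sigma>(1)] LL.aut_mult[OF \<sigma>(1)])
qed

text \<open>\<open>p - j\<close> is one more than the distance from \<open>P j\<close> to
  \<open>P (p - 1)\<close>: the last step wraps around to \<open>P 1\<close>.\<close>

lemma funpow_image_numbering:
  assumes num: "prime_numbering p K (restrict \<sigma> K) q P"
  shows "1 \<le> j \<Longrightarrow> j + i \<le> p - 1 \<Longrightarrow> (\<sigma> ^^ i) ` P j = P (j + i)"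
    "1 \<le> j \<Longrightarrow> j \<le> p - 1 \<Longrightarrow> (\<sigma> ^^ (p - j)) ` P j = P 1"
proof -
  have PK: "P j \<subseteq> K" if "j \<in> {1..p - 1}" for j
  proof -
    have "P j \<in> primes_above_nat K q" using num that by (auto simp: prime_numbering_def bij_betw_def)
    thus ?thesis using KK.primeD(2)[OF KK.primes_above_natD(1)] KK.O_subset by blast
  qed
  have im: "restrict \<sigma> K ` P j = \<sigma> ` P j" if "j \<in> {1..p - 1}" for j
    using PK[OF that] by (intro image_cong) auto
  have step: "\<sigma> ` P j = P (j + 1)" if "j \<in> {1..p - 2}" for j
    using num that im[of j] by (auto simp: prime_numbering_def)
  have last: "\<sigma> ` P (p - 1) = P 1"
    using num im[of "p - 1"] p_gt_1 by (auto simp: prime_numbering_def)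
  show shift: "(\<sigma> ^^ i) ` P j = P (j + i)" if "1 \<le> j" "j + i \<le> p - 1" for i j
    using that(2)
  proof (induction i)
    case (Suc i)
    have "(\<sigma> ^^ Suc i) ` P j = \<sigma> ` ((\<sigma> ^^ i) ` P j)" by (simp add: image_comp)
    also have "\<dots> = P (j + Suc i)" using Suc step[of "j + i"] that(1) by simp
    finally show ?case .
  qed simp
  show "(\<sigma> ^^ (p - j)) ` P j = P 1" if j: "1 \<le> j" "j \<le> p - 1"
  proof -
    have "p - j = Suc (p - 1 - j)" using j p_gt_1 by simp
    hence "(\<sigma> ^^ (p - j)) ` P j = \<sigma> ` ((\<sigma> ^^ (p - 1 - j)) ` P j)" by (simp add: image_comp)
    also have "\<dots> = \<sigma> ` P (p - 1)"
      using shift[of j "p - 1 - j"] j by (simp only: le_add_diff_inverse)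
    finally show ?thesis unfolding last .
  qed
qed

text \<open>If two iterates agreed at \<open>\<zeta>\<close>, a power \<open>\<sigma> ^^ d\<close>
  with \<open>0 < d < p - 1\<close> would fix \<open>\<zeta>\<close>, hence \<open>K\<close>, hence
  \<open>P 1\<close>. But it sends \<open>P 1\<close> to the different prime
  \<open>P (1 + d)\<close>.\<close>

lemma orbit_if_numbering:
  assumes num: "prime_numbering p K (restrict \<sigma> K) q P"
  shows "inj_on (\<lambda>j. (\<sigma> ^^ j) \<zeta>) {..<p - 1}"
proof (rule linorder_inj_onI')
  fix i j assume "i \<in> {..<p - 1}" "j \<in> {..<p - 1}" and ij: "i < j"
  hence j: "j < p - 1" by simp
  show "(\<sigma> ^^ i) \<zeta> \<noteq> (\<sigma> ^^ j) \<zeta>"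
  proof
    assume eq: "(\<sigma> ^^ i) \<zeta> = (\<sigma> ^^ j) \<zeta>"
    define d where "d = j - i"
    note s = LL.aut_funpow[OF \<sigma>(1), of d]
    have "(\<sigma> ^^ j) \<zeta> = (\<sigma> ^^ i) ((\<sigma> ^^ d) \<zeta>)" using ij by (simp add: d_def flip: funpow_add[unfolded o_def, THEN fun_cong])
    hence "(\<sigma> ^^ d) \<zeta> = \<zeta>"
      using inj_onD[OF LL.aut_inj[OF LL.aut_funpow[OF \<sigma>(1), of i]], of "(\<sigma> ^^ d) \<zeta>" \<zeta>]
        eq LL.aut_closed[OF s] inclusions(5) by simp
    hence fixed: "(\<sigma> ^^ d) x = x" if "x \<in> K" for x
      using hom_fixes_K[OF LL.aut_hom_on[OF s] _ that] by simp
    have mem: "P k \<in> primes_above_nat K q" if "k \<in> {1..p - 1}" for k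
      using num that by (auto simp: prime_numbering_def bij_betw_def)
    have "P 1 \<subseteq> K"
      using KK.primeD(2)[OF KK.primes_above_natD(1)[OF mem[of 1]]] KK.O_subset p_gt_1 j by auto
    hence "(\<sigma> ^^ d) ` P 1 = P 1" using fixed by force
    moreover have "(\<sigma> ^^ d) ` P 1 = P (1 + d)"
      using j ij by (intro funpow_image_numbering(1)[OF num]) (auto simp: d_def)
    moreover have "inj_on P {1..p - 1}" using num by (auto simp: prime_numbering_def bij_betw_def)
    moreover have "1 + d \<le> p - 1" "d \<noteq> 0" using j ij by (auto simp: d_def)
    ultimately show False using inj_onD[of P "{1..p - 1}" 1 "1 + d"] by simp
  qed
qed

end

text \<open>\<open>F_fixed\<close> is the Galois property of \<open>F\<close> over the rationals,
  stated with all field automorphisms of \<open>F\<close>. \<open>orbit\<close> is kept out of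
  \<open>cyclotomic_base\<close> because it is derived there from a numbering of the primes.\<close>

locale cyclotomic_compositum = cyclotomic_base +
  assumes F_fixed: "y \<in> F \<Longrightarrow> (\<And>t. FF.automorphism t \<Longrightarrow> t y = y) \<Longrightarrow> y \<in> \<rat>"
    and orbit: "inj_on (\<lambda>j. (\<sigma> ^^ j) \<zeta>) {..<p - 1}"
begin

lemma polys_F_L: "FF.polys \<subseteq> LL.polys"
  using inclusions(1) by (auto simp: FF.polys_def LL.polys_def)

lemma L_eq_adjoin: "L = FF.adjoin \<zeta>"
proof
  note A = FF.adjoin_root_of_unity[OF \<zeta>_pow]
  have "K \<subseteq> FF.adjoin \<zeta>"
    using A p_gt_1 FF.L_Rats by (intro K_least) auto
  thus "L \<subseteq> FF.adjoin \<zeta>"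
    unfolding L_eq using A p_gt_1 by (intro generate_field_least) auto
  have "hom_on L (\<lambda>x. x)" by (simp add: hom_on_def)
  from LL.hom_poly[OF this _ inclusions(5)] show "FF.adjoin \<zeta> \<subseteq> L"
    using polys_F_L by (auto simp: FF.adjoin_def)
qed

lemma roots_of_unity_orbit: "{z. z ^ p = 1} - {1} = (\<lambda>j. (\<sigma> ^^ j) \<zeta>) ` {..<p - 1}"
proof (rule card_subset_eq[symmetric])
  have fin: "card {z::complex. z ^ p = 1} = p" using p_gt_1 by (intro card_roots_unity_eq) auto
  hence f: "finite {z::complex. z ^ p = 1}" using p_gt_1 by (intro card_ge_0_finite) auto
  thus "finite ({z::complex. z ^ p = 1} - {1})" by simp
  have "(\<sigma> ^^ j) \<zeta> \<in> {z. z ^ p = 1} - {1}" for j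
  proof -
    note s = LL.aut_funpow[OF \<sigma>(1), of j]
    have "((\<sigma> ^^ j) \<zeta>) ^ p = 1"
      using LL.aut_power[OF s inclusions(5), of p] LL.aut_1[OF s] by (simp add: \<zeta>_pow)
    moreover have "(\<sigma> ^^ j) \<zeta> \<noteq> 1"
      using inj_onD[OF LL.aut_inj[OF s], of \<zeta> 1] LL.aut_1[OF s] inclusions(5) LL.L_1 \<zeta>_neq_1 by auto
    ultimately show ?thesis by simp
  qed
  thus "(\<lambda>j. (\<sigma> ^^ j) \<zeta>) ` {..<p - 1} \<subseteq> {z. z ^ p = 1} - {1}" by auto
  show "card ((\<lambda>j. (\<sigma> ^^ j) \<zeta>) ` {..<p - 1}) = card ({z::complex. z ^ p = 1} - {1})"
    using card_image[OF orbit] fin f by simp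
qed

lemma funpow_\<sigma>_F: "a \<in> F \<Longrightarrow> (\<sigma> ^^ j) a = a"
  by (induction j) (auto simp: \<sigma>(2))

text \<open>The iterates of \<open>\<sigma>\<close> fix the coefficients of \<open>g\<close> and
  carry \<open>\<zeta>\<close> to every root of unity other than 1.\<close>

lemma conjugate_root:
  assumes g: "g \<in> FF.polys" "poly g \<zeta> = 0" and z: "z ^ p = 1" "z \<noteq> 1"
  shows "poly g z = 0"
proof -
  obtain j where j: "z = (\<sigma> ^^ j) \<zeta>" using roots_of_unity_orbit z by blast
  note s = LL.aut_hom_on[OF LL.aut_funpow[OF \<sigma>(1), of j]]
  have "map_poly (\<sigma> ^^ j) g = g"
    using g(1) by (intro poly_eqI) (simp add: coeff_map_poly LL.hom_0[OF s] funpow_\<sigma>_F FF.polys_def)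
  thus ?thesis using LL.hom_poly[OF s _ inclusions(5), of g] polys_F_L g LL.hom_0[OF s] j by auto
qed

text \<open>A nonzero \<open>g\<close> of degree below \<open>p - 1\<close> would have all
  \<open>p - 1\<close> nontrivial roots of unity as zeros. This replaces irreducibility of the
  cyclotomic polynomial over \<open>F\<close>.\<close>

lemma powers_independent:
  assumes g: "g \<in> FF.polys" "poly g \<zeta> = 0" "\<And>i. i \<ge> p - 1 \<Longrightarrow> poly.coeff g i = 0"
  shows "g = 0"
proof (rule ccontr)
  assume nz: "g \<noteq> 0"
  have "{z. z ^ p = 1} - {1} \<subseteq> {z. poly g z = 0}" using conjugate_root[OF g(1,2)] by auto
  hence "card ({z. z ^ p = 1} - {1::complex}) \<le> card {z. poly g z = 0}"
    by (intro card_mono poly_roots_finite nz)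
  also have "\<dots> \<le> Polynomial.degree g" by (rule card_poly_roots_bound[OF nz])
  finally have "p - 1 \<le> Polynomial.degree g"
    unfolding roots_of_unity_orbit using card_image[OF orbit] by simp
  hence "lead_coeff g = 0" by (rule g(3))
  thus False using nz by simp
qed

section \<open>Extending automorphisms of \<open>F\<close> to \<open>L\<close>\<close>

definition cyclo :: "complex poly" where
  "cyclo = (\<Sum>i\<le>p - 1. Polynomial.monom 1 i)"

lemma cyclo_root: "poly cyclo \<zeta> = 0"
proof -
  have "poly cyclo \<zeta> = (\<Sum>i<p. \<zeta> ^ i)"
    using p_gt_1 by (simp add: cyclo_def poly_sum poly_monom lessThan_Suc_atMost[symmetric])
  moreover have "(1 - \<zeta>) * (\<Sum>i<p. \<zeta> ^ i) = 0" using one_diff_power_eq[of \<zeta> p] \<zeta>_pow by simp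
  ultimately show ?thesis using \<zeta>_neq_1 by simp
qed

lemma cyclo_division:
  assumes "g \<in> FF.polys"
  obtains q r where "q \<in> FF.polys" "r \<in> FF.polys" "g = cyclo * q + r"
    "\<And>i. i \<ge> p - 1 \<Longrightarrow> poly.coeff r i = 0"
  using FF.monic_division[OF assms, of "p - 1"] p_gt_1 unfolding cyclo_def by auto

text \<open>By independence, a relation for \<open>\<zeta>\<close> over \<open>F\<close> is a
  multiple of \<open>cyclo\<close>, and \<open>t\<close> fixes the coefficients 0 and 1 of
  \<open>cyclo\<close>.\<close>

lemma map_poly_root:
  assumes t: "FF.automorphism t" and g: "g \<in> FF.polys" "poly g \<zeta> = 0"
  shows "poly (map_poly t g) \<zeta> = 0"
proof -
  obtain q r where qr: "q \<in> FF.polys" "r \<in> FF.polys" "g = cyclo * q + r"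
    "\<And>i. i \<ge> p - 1 \<Longrightarrow> poly.coeff r i = 0"
    using cyclo_division[OF g(1)] by blast
  have "poly r \<zeta> = 0" using g(2) by (simp add: qr(3) cyclo_root)
  hence "r = 0" by (rule powers_independent[OF qr(2) _ qr(4)])
  note h = FF.aut_hom_on[OF t]
  have c: "poly.coeff cyclo i = (if i \<le> p - 1 then 1 else 0)" for i
    by (simp add: cyclo_def coeff_sum)
  have "cyclo \<in> FF.polys" by (auto simp: FF.polys_def c FF.L_0 FF.L_1)
  moreover have "map_poly t cyclo = cyclo"
    by (intro poly_eqI) (simp add: coeff_map_poly FF.hom_0[OF h] FF.hom_1[OF h] c)
  ultimately have "map_poly t g = cyclo * map_poly t q"
    using \<open>r = 0\<close> qr(1) by (simp add: qr(3) FF.map_poly_mult[OF h])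
  thus ?thesis by (simp add: cyclo_root)
qed

text \<open>The automorphism of \<open>L = F(\<zeta>)\<close> that extends \<open>t\<close> and fixes \<open>\<zeta>\<close>; the value does not depend on
  the chosen polynomial by \<open>map_poly_root\<close>.\<close>

definition ext :: "(complex \<Rightarrow> complex) \<Rightarrow> complex \<Rightarrow> complex" where
  "ext t y = poly (map_poly t (SOME g. g \<in> FF.polys \<and> poly g \<zeta> = y)) \<zeta>"

lemma ext_poly:
  assumes t: "FF.automorphism t" and g: "g \<in> FF.polys"
  shows "ext t (poly g \<zeta>) = poly (map_poly t g) \<zeta>"
proof -
  define h where "h = (SOME h. h \<in> FF.polys \<and> poly h \<zeta> = poly g \<zeta>)"
  have h: "h \<in> FF.polys \<and> poly h \<zeta> = poly g \<zeta>"
    unfolding h_def by (rule someI[of _ g]) (use g in simp)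
  note s = FF.aut_hom_on[OF t]
  have "poly (map_poly t (h + - g)) \<zeta> = 0"
    using h g by (intro map_poly_root[OF t] FF.polys_add FF.polys_minus) auto
  moreover have "map_poly t (h + - g) = map_poly t h + - map_poly t g"
    using h g by (simp only: FF.map_poly_add[OF s] FF.polys_minus FF.map_poly_minus[OF s])
  ultimately show ?thesis by (simp add: ext_def h_def[symmetric])
qed

lemma L_polyE:
  assumes "y \<in> L"
  obtains g where "g \<in> FF.polys" "y = poly g \<zeta>"
  using assms unfolding L_eq_adjoin FF.adjoin_def by auto

lemma L_polyI: "g \<in> FF.polys \<Longrightarrow> poly g \<zeta> \<in> L"
  unfolding L_eq_adjoin FF.adjoin_def by auto

lemma ext_automorphism:
  assumes t: "FF.automorphism t"
  shows "LL.automorphism (ext t)" "ext t \<zeta> = \<zeta>" "a \<in> F \<Longrightarrow> ext t a = t a"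
proof -
  note s = FF.aut_hom_on[OF t]
  show c: "ext t a = t a" if "a \<in> F" for a
    using ext_poly[OF t FF.polys_const[OF that]] by (simp add: FF.hom_map_poly_pCons[OF s])
  show "ext t \<zeta> = \<zeta>"
    using ext_poly[OF t FF.polys_X] by (simp add: FF.hom_map_poly_pCons[OF s] FF.hom_0[OF s] FF.hom_1[OF s])
  show "LL.automorphism (ext t)"
  proof (rule LL.automorphismI)
    show "ext t 1 = 1" using c[OF FF.L_1] FF.hom_1[OF s] by simp
    fix x assume "x \<in> L"
    then obtain g where g: "g \<in> FF.polys" "x = poly g \<zeta>" by (rule L_polyE)
    have "map_poly t g \<in> FF.polys"
      using g(1) by (auto simp: FF.polys_def coeff_map_poly FF.hom_0[OF s] FF.aut_closed[OF t])
    thus "ext t x \<in> L" by (simp add: g ext_poly[OF t] L_polyI)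
    fix y assume "y \<in> L"
    then obtain h where h: "h \<in> FF.polys" "y = poly h \<zeta>" by (rule L_polyE)
    show "ext t (x + y) = ext t x + ext t y"
      using ext_poly[OF t FF.polys_add[OF g(1) h(1)]]
      by (simp add: g h ext_poly[OF t] FF.map_poly_add[OF s])
    show "ext t (x * y) = ext t x * ext t y"
      using ext_poly[OF t FF.polys_mult[OF g(1) h(1)]]
      by (simp add: g h ext_poly[OF t] FF.map_poly_mult[OF s])
  qed
qed

section \<open>Embeddings of \<open>L\<close> over \<open>K\<close>\<close>

lemma embeddingsI:
  assumes s: "LL.automorphism s" "s \<zeta> = \<zeta>"
  shows "restrict s L \<in> embeddings K L"
proof -
  have "restrict s L \<in> Ring.ring_hom (subring_of L) complex_ring"
    by (rule ring_hom_memI)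
       (auto simp: LL.L_mult LL.L_add LL.L_1 LL.aut_mult[OF s(1)] LL.aut_add[OF s(1)] LL.aut_1[OF s(1)])
  moreover have "\<forall>a\<in>K. restrict s L a = a"
    using hom_fixes_K[OF LL.aut_hom_on[OF s(1)] s(2)] inclusions(2) by auto
  ultimately show ?thesis by (simp add: embeddings_def)
qed

text \<open>\<open>M\<close> has the conjugates of \<open>f\<close> under the automorphisms of
  \<open>F\<close> as its simple roots. They are permuted by every automorphism, so the coefficients
  are fixed and hence rational. There are finitely many, being roots of an integer polynomial for
  \<open>f\<close>. This normality of \<open>F\<close> confines embeddings to
  \<open>L\<close>.\<close>

lemma galois_orbit_poly:
  assumes f: "f \<in> F"
  obtains M where "poly M f = 0" "\<And>i. poly.coeff M i \<in> \<rat>" "{z. poly M z = 0} \<subseteq> F"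
proof -
  define R where "R = {t f |t. FF.automorphism t}"
  have RF: "R \<subseteq> F" using f FF.aut_closed by (auto simp: R_def)
  obtain g where g: "\<And>i. poly.coeff g i \<in> \<int>" "g \<noteq> 0" "poly g f = 0"
    using FF.L_algebraic[OF f] by (auto simp: algebraic_def)
  have gp: "g \<in> FF.polys" using g(1) FF.L_Ints by (simp add: FF.polys_def)
  have "R \<subseteq> {z. poly g z = 0}"
  proof
    fix z assume "z \<in> R"
    then obtain t where t: "FF.automorphism t" "z = t f" by (auto simp: R_def)
    note s = FF.aut_hom_on[OF t(1)]
    have "map_poly t g = g"
      using g(1) by (intro poly_eqI) (simp add: coeff_map_poly FF.hom_0[OF s] FF.aut_Ints[OF t(1)])
    thus "z \<in> {z. poly g z = 0}" using FF.hom_poly[OF s gp f] g(3) FF.hom_0[OF s] t(2) by simp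
  qed
  hence fin: "finite R" using poly_roots_finite[OF g(2)] by (rule finite_subset)
  define M where "M = (\<Prod>b\<in>R. [:- b, 1:])"
  have MP: "M \<in> FF.polys"
    unfolding M_def using RF
    by (auto intro!: FF.polys_prod simp: FF.polys_pCons FF.L_minus FF.L_1 FF.polys_const[OF FF.L_0, simplified])
  have roots: "poly M z = 0 \<longleftrightarrow> z \<in> R" for z
    using fin by (auto simp: M_def poly_prod)
  have "map_poly t M = M" if t: "FF.automorphism t" for t
  proof -
    note s = FF.aut_hom_on[OF t]
    have inj: "inj_on t R" using FF.aut_inj[OF t] RF by (rule inj_on_subset)
    have "t ` R \<subseteq> R" using FF.aut_comp[OF t] by (auto simp: R_def)
    hence "t ` R = R" using endo_inj_surj[OF fin _ inj] by blast
    have "map_poly t M = (\<Prod>b\<in>R. [:- t b, 1:])"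
      unfolding M_def by (rule FF.map_poly_prod_linear[OF s RF])
    also have "\<dots> = (\<Prod>b\<in>t ` R. [:- b, 1:])" using prod.reindex[OF inj, of "\<lambda>b. [:- b, 1:]"] by simp
    finally show ?thesis using \<open>t ` R = R\<close> by (simp add: M_def)
  qed
  hence "t (poly.coeff M i) = poly.coeff M i" if "FF.automorphism t" for t i
    using that coeff_map_poly[of t M i, OF FF.hom_0[OF FF.aut_hom_on[OF that]]] by simp
  hence "poly.coeff M i \<in> \<rat>" for i
    using MP by (intro F_fixed) (auto simp: FF.polys_def)
  moreover have "FF.automorphism (\<lambda>x. x)" by (auto simp: FF.automorphism_def bij_betw_def)
  hence "f \<in> R" by (auto simp: R_def)
  hence "poly M f = 0" by (simp add: roots)
  moreover have "{z. poly M z = 0} \<subseteq> F" using roots RF by auto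
  ultimately show ?thesis using that by blast
qed

text \<open>A priori an embedding only maps into the complex numbers. It sends an element of
  \<open>F\<close> to a root of the same rational polynomial, hence into \<open>F\<close> by
  \<open>galois_orbit_poly\<close>, and it fixes \<open>\<zeta>\<close>; so it maps
  \<open>L = F(\<zeta>)\<close> into itself.\<close>

lemma embeddingsD:
  assumes s: "s \<in> embeddings K L"
  shows "LL.automorphism s" "a \<in> K \<Longrightarrow> s a = a" "s \<in> extensional L"
proof -
  show "s \<in> extensional L" and K: "a \<in> K \<Longrightarrow> s a = a" for a
    using s by (auto simp: embeddings_def)
  have rh: "s \<in> Ring.ring_hom (subring_of L) complex_ring" using s by (simp add: embeddings_def)
  have h: "hom_on L s"
    using Ring.ring_hom_add[OF rh] Ring.ring_hom_mult[OF rh] Ring.ring_hom_one[OF rh] by (auto simp: hom_on_def)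
  have sF: "s f \<in> F" if f: "f \<in> F" for f
  proof -
    obtain M where M: "poly M f = 0" "\<And>i. poly.coeff M i \<in> \<rat>" "{z. poly M z = 0} \<subseteq> F"
      using galois_orbit_poly[OF f] by blast
    have "map_poly s M = M"
      using M(2) inclusions(4) K by (intro poly_eqI) (auto simp: coeff_map_poly LL.hom_0[OF h])
    moreover have "M \<in> LL.polys" using M(2) LL.L_Rats by (simp add: LL.polys_def)
    ultimately have "poly M (s f) = 0"
      using LL.hom_poly[OF h, of M f] f inclusions(1) M(1) LL.hom_0[OF h] by auto
    thus ?thesis using M(3) by auto
  qed
  show "LL.automorphism s"
  proof (rule LL.automorphismI)
    fix x assume "x \<in> L"
    then obtain g where g: "g \<in> FF.polys" "x = poly g \<zeta>" by (rule L_polyE)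
    have "map_poly s g \<in> FF.polys"
      using g(1) sF by (auto simp: FF.polys_def coeff_map_poly LL.hom_0[OF h])
    moreover have "s x = poly (map_poly s g) \<zeta>"
      using LL.hom_poly[OF h _ inclusions(5), of g] polys_F_L g K[OF inclusions(3)] by auto
    ultimately show "s x \<in> L" by (simp add: L_polyI)
  qed (use h in \<open>auto simp: hom_on_def\<close>)
qed

text \<open>Written as a polynomial in \<open>\<zeta>\<close> of degree below \<open>p - 1\<close>,
  \<open>y\<close> has unique coefficients in \<open>F\<close>. Invariance under each
  \<open>ext t\<close> makes them invariant under \<open>t\<close>, so they are rational.\<close>

lemma fixed_by_embeddings:
  assumes y: "y \<in> L" and fixed: "\<And>s. s \<in> embeddings K L \<Longrightarrow> s y = y"
  shows "y \<in> K"
proof -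
  obtain g where g: "g \<in> FF.polys" "y = poly g \<zeta>" using y by (rule L_polyE)
  obtain q r where qr: "q \<in> FF.polys" "r \<in> FF.polys" "g = cyclo * q + r"
    "\<And>i. i \<ge> p - 1 \<Longrightarrow> poly.coeff r i = 0"
    using cyclo_division[OF g(1)] by blast
  have yr: "y = poly r \<zeta>" by (simp add: g(2) qr(3) cyclo_root)
  have "t (poly.coeff r i) = poly.coeff r i" if t: "FF.automorphism t" for t i
  proof -
    note s = FF.aut_hom_on[OF t]
    have "ext t y = y"
      using fixed[OF embeddingsI[OF ext_automorphism(1,2)[OF t]]] y by simp
    hence "poly (map_poly t r + - r) \<zeta> = 0" using ext_poly[OF t qr(2)] by (simp add: yr)
    moreover have "map_poly t r \<in> FF.polys"
      using qr(2) by (auto simp: FF.polys_def coeff_map_poly FF.hom_0[OF s] FF.aut_closed[OF t])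
    ultimately have "map_poly t r + - r = 0"
      using qr(2,4) by (intro powers_independent FF.polys_add FF.polys_minus)
        (auto simp: coeff_map_poly FF.hom_0[OF s])
    hence "poly.coeff (map_poly t r) i = poly.coeff r i" by simp
    thus ?thesis by (simp add: coeff_map_poly FF.hom_0[OF s])
  qed
  hence "poly.coeff r i \<in> \<rat>" for i
    using qr(2) by (intro F_fixed) (auto simp: FF.polys_def)
  hence "r \<in> KK.polys" using inclusions(4) by (auto simp: KK.polys_def)
  moreover have "hom_on K (\<lambda>x. x)" by (simp add: hom_on_def)
  ultimately show ?thesis using KK.hom_poly[of "\<lambda>x. x" r \<zeta>] inclusions(3) yr by simp
qed

text \<open>Composition with an embedding \<open>t\<close> permutes the embeddings, so
  \<open>t\<close> fixes the norm. Their finiteness is assumed here and later obtained from the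
  action on the primes above \<open>q\<close>.\<close>

lemma norm_in_K:
  assumes fin: "finite (embeddings K L)" and a: "a \<in> L"
  shows "field_norm K L a \<in> K"
proof (rule fixed_by_embeddings)
  let ?H = "embeddings K L"
  have sa: "s a \<in> L" if "s \<in> ?H" for s using LL.aut_closed[OF embeddingsD(1)[OF that] a] .
  show "field_norm K L a \<in> L" unfolding field_norm_def by (intro LL.L_prod sa)
  fix t assume t: "t \<in> ?H"
  note tD = embeddingsD[OF t]
  define c where "c = (\<lambda>s. restrict (\<lambda>x. t (s x)) L)"
  have "c ` ?H \<subseteq> ?H"
  proof (rule image_subsetI)
    fix s assume s: "s \<in> ?H"
    have "t (s \<zeta>) = \<zeta>"
      using embeddingsD(2)[OF s inclusions(3)] tD(2)[OF inclusions(3)] by simp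
    thus "c s \<in> ?H"
      unfolding c_def by (rule embeddingsI[OF LL.aut_comp[OF tD(1) embeddingsD(1)[OF s]]])
  qed
  moreover have inj: "inj_on c ?H"
  proof (rule inj_onI)
    fix u v assume uv: "u \<in> ?H" "v \<in> ?H" "c u = c v"
    show "u = v"
    proof (rule extensionalityI[OF embeddingsD(3)[OF uv(1)] embeddingsD(3)[OF uv(2)]])
      fix x assume x: "x \<in> L"
      have "t (u x) = t (v x)" using fun_cong[OF uv(3), of x] x by (simp add: c_def)
      thus "u x = v x"
        using inj_onD[OF LL.aut_inj[OF tD(1)]] LL.aut_closed[OF embeddingsD(1)] uv(1,2) x by blast
    qed
  qed
  ultimately have cH: "c ` ?H = ?H" using endo_inj_surj[OF fin] by blast
  have "t (field_norm K L a) = (\<Prod>s\<in>?H. t (s a))"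
    unfolding field_norm_def by (rule LL.aut_prod[OF tD(1) sa])
  also have "\<dots> = (\<Prod>s\<in>?H. c s a)" using a by (simp add: c_def)
  also have "\<dots> = (\<Prod>s\<in>c ` ?H. s a)" using prod.reindex[OF inj, of "\<lambda>s. s a"] by simp
  finally show "t (field_norm K L a) = field_norm K L a" by (simp add: cH field_norm_def)
qed

end

section \<open>The norm at a completely split prime\<close>

lemma (in number_field) prime_inter_subfield:
  assumes P: "P \<in> prime_ideals L" and K: "K \<subseteq> L" "number_field K B'"
  shows "P \<inter> ints_of K \<in> prime_ideals K"
proof -
  interpret K: number_field K B' by (rule K(2))
  have KO: "ints_of K \<subseteq> \<O>" using K(1) by (auto simp: ints_of_def)
  note PD = primeD[OF P]
  show ?thesis
    unfolding K.prime_ideals_iff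
  proof (intro conjI ballI impI)
    show "K.is_mod (P \<inter> ints_of K)"
    proof (rule K.is_modI)
      show "P \<inter> ints_of K \<subseteq> K" using K.O_subset by auto
    qed (use KO PD(1) is_modD in \<open>auto intro: K.O_0 K.O_add K.O_mult\<close>)
    obtain m :: nat where "m > 0" "of_nat m \<in> P" using O_multiple_in[OF PD(1-3)] .
    moreover have "of_nat m \<in> ints_of K" by (rule K.O_Ints) simp
    ultimately show "P \<inter> ints_of K \<noteq> {0}" by (metis IntI of_nat_eq_0_iff singletonD less_numeral_extra(3))
  qed (use PD KO in auto)
qed

context cyclotomic_compositum
begin

lemma K_ints: "ints_of K \<subseteq> ints_of L"
  using inclusions(2) by (auto simp: ints_of_def)

lemma prime_below:
  "Q \<in> prime_ideals L \<Longrightarrow> Q \<inter> ints_of K \<in> prime_ideals K"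
  by (rule LL.prime_inter_subfield[OF _ inclusions(2) KK.number_field_axioms])

lemma prime_above_nat_below:
  assumes "Q \<in> primes_above_nat L q"
  shows "Q \<inter> ints_of K \<in> primes_above_nat K q"
proof -
  have "ints_of \<rat> \<subseteq> ints_of K" using inclusions(4) by (auto simp: ints_of_def)
  hence "(Q \<inter> ints_of K) \<inter> ints_of \<rat> = Q \<inter> ints_of \<rat>" by blast
  thus ?thesis using assms prime_below[of Q] by (simp add: primes_above_def)
qed

lemma embeddings_inverse:
  assumes s: "s \<in> embeddings K L"
  shows "restrict (inv_into L s) L \<in> embeddings K L"
proof (rule embeddingsI)
  note sD = embeddingsD[OF s]
  show "LL.automorphism (inv_into L s)" by (rule LL.aut_inv[OF sD(1)])
  show "inv_into L s \<zeta> = \<zeta>"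
    using LL.aut_inv_left[OF sD(1) inclusions(5)] sD(2)[OF inclusions(3)] by simp
qed

lemma inv_image:
  assumes s: "LL.automorphism s" and Q: "Q \<subseteq> L"
  shows "inv_into L s ` (s ` Q) = Q" "s ` (inv_into L s ` Q) = Q"
proof -
  have "inv_into L s ` (s ` Q) = (\<lambda>x. x) ` Q"
    unfolding image_image using LL.aut_inv_left[OF s] Q by (intro image_cong) auto
  thus "inv_into L s ` (s ` Q) = Q" by simp
  have "s ` (inv_into L s ` Q) = (\<lambda>x. x) ` Q"
    unfolding image_image using LL.aut_inv_right[OF s] Q by (intro image_cong) auto
  thus "s ` (inv_into L s ` Q) = Q" by simp
qed

lemma image_below:
  assumes s: "LL.automorphism s" and t: "KK.automorphism s" and Q: "Q \<subseteq> L"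
  shows "(s ` Q) \<inter> ints_of K = s ` (Q \<inter> ints_of K)"
proof -
  have "ints_of K \<subseteq> L" using K_ints LL.O_subset by auto
  hence "s ` (Q \<inter> ints_of K) = s ` Q \<inter> s ` ints_of K"
    by (rule inj_on_image_Int[OF LL.aut_inj[OF s] Q])
  thus ?thesis by (simp add: KK.aut_image_O[OF t])
qed

lemma embedding_image_below:
  assumes s: "s \<in> embeddings K L" and Q: "Q \<subseteq> L"
  shows "(s ` Q) \<inter> ints_of K = Q \<inter> ints_of K"
proof -
  note sD = embeddingsD[OF s]
  have "KK.automorphism s"
    using sD(2) by (auto simp: KK.automorphism_def bij_betw_def inj_on_def image_iff KK.L_add KK.L_mult)
  hence "(s ` Q) \<inter> ints_of K = s ` (Q \<inter> ints_of K)" by (rule image_below[OF sD(1) _ Q])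
  also have "\<dots> = (\<lambda>x. x) ` (Q \<inter> ints_of K)"
    using sD(2) KK.O_subset by (intro image_cong) auto
  finally show ?thesis by simp
qed

text \<open>Splitting is assumed in the form of an inequality with \<open>card B\<close>, the form
  in which \<open>split_approximation\<close> uses it.\<close>

context
  fixes q :: nat
  assumes q: "prime q" and split: "card (primes_above_nat L q) \<ge> card B"
begin

lemma above_subset: "Q \<in> primes_above_nat L q \<Longrightarrow> Q \<subseteq> L"
  using LL.primeD(2)[OF LL.primes_above_natD(1)] LL.O_subset by blast

text \<open>The composite of \<open>t\<close> with the inverse of \<open>s\<close> fixes the split
  prime \<open>Q\<close> and is therefore the identity.\<close>

lemma embeddings_free:
  assumes s: "s \<in> embeddings K L" and t: "t \<in> embeddings K L" and Q: "Q \<in> primes_above_nat L q"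
    and eq: "s ` Q = t ` Q"
  shows "s = t"
proof (rule extensionalityI[OF embeddingsD(3)[OF s] embeddingsD(3)[OF t]])
  fix x assume x: "x \<in> L"
  note sD = embeddingsD[OF s] and tD = embeddingsD[OF t]
  have aut: "LL.automorphism (\<lambda>x. inv_into L s (t x))"
    by (rule LL.aut_comp[OF LL.aut_inv[OF sD(1)] tD(1)])
  have "(\<lambda>x. inv_into L s (t x)) ` Q = inv_into L s ` (s ` Q)" by (simp add: eq image_image)
  also have "\<dots> = Q" by (rule inv_image(1)[OF sD(1) above_subset[OF Q]])
  finally have "inv_into L s (t x) = x"
    using LL.aut_eq_id_if_fixes_split_prime[OF q split Q aut _ x] by simp
  thus "s x = t x" using LL.aut_inv_right[OF sD(1) LL.aut_closed[OF tD(1) x]] by simp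
qed

text \<open>Existence of a prime above \<open>q\<close> follows from the count alone:
  \<open>B\<close> is nonempty since its span contains 1.\<close>

lemma primes_above_nonempty: "primes_above_nat L q \<noteq> {}"
proof -
  have "1 \<in> qv.span B" using LL.L_1 LL.L_span by blast
  hence "B \<noteq> {}" by auto
  hence "card B > 0" using LL.finite_B by (simp add: card_gt_0_iff)
  hence "card (primes_above_nat L q) > 0" using split by simp
  thus ?thesis by auto
qed

text \<open>Because the action is free, the embeddings inject into the finite set of primes above
  \<open>q\<close>.\<close>

lemma finite_embeddings: "finite (embeddings K L)"
proof -
  obtain Q where Q: "Q \<in> primes_above_nat L q" using primes_above_nonempty by blast
  have "inj_on (\<lambda>s. s ` Q) (embeddings K L)"
    using embeddings_free[OF _ _ Q] by (intro inj_onI)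
  moreover have "(\<lambda>s. s ` Q) ` embeddings K L \<subseteq> primes_above_nat L q"
    using LL.prime_above_image[OF embeddingsD(1) Q] by auto
  ultimately show ?thesis
    using LL.finite_primes_above_nat[OF prime_gt_0_nat[OF q]] by (rule inj_on_finite)
qed

text \<open>Otherwise an integer that lies in \<open>Q'\<close> and is congruent to 1 modulo all conjugates of \<open>Q\<close>
  would have a norm in \<open>Q' \<inter> K = Q \<inter> K\<close>.\<close>

lemma embeddings_transitive:
  assumes Q: "Q \<in> primes_above_nat L q" and Q': "Q' \<in> primes_above_nat L q"
    and below: "Q \<inter> ints_of K = Q' \<inter> ints_of K"
  shows "\<exists>s\<in>embeddings K L. s ` Q = Q'"
proof (rule ccontr)
  assume contra: "\<not> ?thesis"
  let ?H = "embeddings K L"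
  define R where "R = (\<lambda>s. s ` Q) ` ?H"
  have R: "finite R" "R \<subseteq> primes_above_nat L q" "Q' \<notin> R"
    using finite_embeddings LL.prime_above_image[OF embeddingsD(1) Q] contra by (auto simp: R_def)
  note QP = LL.primes_above_natD(1)[OF Q] and Q'P = LL.primes_above_natD(1)[OF Q']
  have "\<exists>w. w \<in> Q' \<and> 1 - w \<in> P \<and> w \<in> ints_of L" if P: "P \<in> R" for P
  proof -
    have "P \<in> prime_ideals L" "P \<noteq> Q'" using LL.primes_above_natD(1) R P by auto
    thus ?thesis using LL.primes_comaximal[OF _ Q'P] by metis
  qed
  hence "\<exists>w. \<forall>P\<in>R. w P \<in> Q' \<and> 1 - w P \<in> P \<and> w P \<in> ints_of L" by (intro bchoice ballI)
  then obtain w where w: "\<forall>P\<in>R. w P \<in> Q' \<and> 1 - w P \<in> P \<and> w P \<in> ints_of L" ..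
  \<comment> \<open>Each factor \<open>1 - w P\<close> is 1 modulo \<open>Q'\<close>, so
    \<open>a\<close> lies in \<open>Q'\<close>; one factor lies in any given \<open>P\<close> of
    \<open>R\<close>, so \<open>a\<close> is 1 modulo that \<open>P\<close>.\<close>
  define a where "a = 1 - (\<Prod>P\<in>R. 1 - w P)"
  have wO: "1 - w P \<in> ints_of L" if "P \<in> R" for P using w that LL.O_diff[OF LL.O_1] by blast
  have aQ': "a \<in> Q'"
    unfolding a_def using w by (intro LL.one_minus_prod[OF LL.primeD(1)[OF Q'P] wO _ R(1)]) auto
  hence aO: "a \<in> ints_of L" and aL: "a \<in> L" using LL.primeD(2)[OF Q'P] LL.O_subset by auto
  have notin: "a \<notin> P" if P: "P \<in> R" for P
  proof
    have PP: "P \<in> prime_ideals L" using LL.primes_above_natD(1) R P by auto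
    note M = LL.primeD(1)[OF PP]
    assume aP: "a \<in> P"
    have "(\<Prod>P\<in>R. 1 - w P) = (\<Prod>P\<in>R - {P}. 1 - w P) * (1 - w P)"
      using prod.remove[OF R(1) P, of "\<lambda>P. 1 - w P"] by (simp add: mult.commute)
    moreover have "(\<Prod>P\<in>R - {P}. 1 - w P) \<in> ints_of L" using wO by (intro LL.O_prod) auto
    moreover have "1 - w P \<in> P" using w P by blast
    ultimately have "(\<Prod>P\<in>R. 1 - w P) \<in> P" using LL.is_modD(3)[OF M] by simp
    hence "a + (\<Prod>P\<in>R. 1 - w P) \<in> P" by (rule LL.is_modD(5)[OF M aP])
    thus False using LL.primeD(4)[OF PP] by (simp add: a_def)
  qed
  \<comment> \<open>The identity is one of the embeddings, so \<open>a\<close> itself is a factor of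
    its norm and the norm lies in \<open>Q'\<close>.\<close>
  define i where "i = restrict (\<lambda>x. x) L"
  have "LL.automorphism (\<lambda>x. x)" by (auto simp: LL.automorphism_def bij_betw_def)
  hence iH: "i \<in> ?H" unfolding i_def by (intro embeddingsI) auto
  have sO: "s a \<in> ints_of L" if "s \<in> ?H" for s using LL.aut_O[OF embeddingsD(1)[OF that] aO] .
  have "field_norm K L a = (\<Prod>s\<in>?H - {i}. s a) * a"
    unfolding field_norm_def using prod.remove[OF finite_embeddings iH, of "\<lambda>s. s a"] aL
    by (simp add: i_def mult.commute)
  moreover have "(\<Prod>s\<in>?H - {i}. s a) \<in> ints_of L" using sO by (intro LL.O_prod) auto
  ultimately have "field_norm K L a \<in> Q'"
    using LL.is_modD(3)[OF LL.primeD(1)[OF Q'P] _ aQ'] by simp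
  moreover have "field_norm K L a \<in> ints_of L"
    unfolding field_norm_def using sO by (rule LL.O_prod)
  hence "field_norm K L a \<in> ints_of K"
    using norm_in_K[OF finite_embeddings aL] by (simp add: ints_of_def)
  ultimately have "field_norm K L a \<in> Q" using below by blast
  \<comment> \<open>Since \<open>Q\<close> is prime, some conjugate \<open>s a\<close> lies in
    \<open>Q\<close>; then \<open>a\<close> lies in the preimage of \<open>Q\<close> under
    \<open>s\<close>, which is one of the conjugates in \<open>R\<close>.\<close>
  then obtain s where s: "s \<in> ?H" "s a \<in> Q"
    unfolding field_norm_def using LL.prime_prod[OF QP finite_embeddings, of "\<lambda>s. s a"] sO by blast
  note sD = embeddingsD[OF s(1)]
  have "inv_into L s (s a) \<in> inv_into L s ` Q" using s(2) by (rule imageI)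
  hence "a \<in> inv_into L s ` Q" using LL.aut_inv_left[OF sD(1) aL] by simp
  moreover have "inv_into L s ` Q = restrict (inv_into L s) L ` Q"
    using above_subset[OF Q] by (intro image_cong) auto
  moreover have "restrict (inv_into L s) L ` Q \<in> R"
    unfolding R_def by (rule imageI[OF embeddings_inverse[OF s(1)]])
  ultimately show False using notin by metis
qed

lemma val_norm:
  assumes Q: "Q \<in> primes_above_nat L q" and x: "x \<in> L" "x \<noteq> 0"
  shows "LL.val Q (field_norm K L x) =
    (\<Sum>Q' | Q' \<in> primes_above_nat L q \<and> Q' \<inter> ints_of K = Q \<inter> ints_of K. LL.val Q' x)"
proof -
  let ?H = "embeddings K L"
  let ?S = "{Q'. Q' \<in> primes_above_nat L q \<and> Q' \<inter> ints_of K = Q \<inter> ints_of K}"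
  have sx: "s x \<in> L \<and> s x \<noteq> 0" if "s \<in> ?H" for s
    using LL.aut_closed[OF embeddingsD(1)[OF that]] LL.aut_nonzero[OF embeddingsD(1)[OF that]] x by blast
  have "LL.val Q (field_norm K L x) = (\<Sum>s\<in>?H. LL.val Q (s x))"
    unfolding field_norm_def by (rule LL.val_prod[OF sx finite_embeddings])
  \<comment> \<open>The automorphism is moved from the element to the prime, where it becomes its
    inverse. The inverse is restricted to \<open>L\<close> to be again a member of
    \<open>embeddings K L\<close>.\<close>
  also have "\<dots> = (\<Sum>s\<in>?H. LL.val (restrict (inv_into L s) L ` Q) x)"
  proof (rule sum.cong)
    fix s assume s: "s \<in> ?H"
    note sD = embeddingsD[OF s]
    have r: "restrict (inv_into L s) L ` Q = inv_into L s ` Q"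
      using above_subset[OF Q] by (intro image_cong) auto
    have "inv_into L s ` Q \<in> prime_ideals L"
      by (rule LL.prime_image[OF LL.aut_inv[OF sD(1)] LL.primes_above_natD(1)[OF Q]])
    from LL.val_image[OF sD(1) x this] inv_image(2)[OF sD(1) above_subset[OF Q]]
    show "LL.val Q (s x) = LL.val (restrict (inv_into L s) L ` Q) x" unfolding r by simp
  qed simp
  also have "\<dots> = (\<Sum>Q'\<in>?S. LL.val Q' x)"
  proof (rule sum.reindex_bij_betw)
    show "bij_betw (\<lambda>s. restrict (inv_into L s) L ` Q) ?H ?S"
      unfolding bij_betw_def
    proof
      show "inj_on (\<lambda>s. restrict (inv_into L s) L ` Q) ?H"
      proof (rule inj_onI)
        fix s t assume s: "s \<in> ?H" and t: "t \<in> ?H"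
          and eq: "restrict (inv_into L s) L ` Q = restrict (inv_into L t) L ` Q"
        note sD = embeddingsD[OF s] and tD = embeddingsD[OF t]
        have inv: "restrict (inv_into L s) L = restrict (inv_into L t) L"
          by (rule embeddings_free[OF embeddings_inverse[OF s] embeddings_inverse[OF t] Q eq])
        show "s = t"
        proof (rule extensionalityI[OF sD(3) tD(3)])
          fix y assume y: "y \<in> L"
          have "inv_into L s (t y) = y"
            using fun_cong[OF inv, of "t y"] LL.aut_closed[OF tD(1) y] LL.aut_inv_left[OF tD(1) y] by simp
          thus "s y = t y" using LL.aut_inv_right[OF sD(1) LL.aut_closed[OF tD(1) y]] by simp
        qed
      qed
      show "(\<lambda>s. restrict (inv_into L s) L ` Q) ` ?H = ?S"
      proof
        show "(\<lambda>s. restrict (inv_into L s) L ` Q) ` ?H \<subseteq> ?S"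
        proof (rule image_subsetI)
          fix s assume s: "s \<in> ?H"
          note i = embeddings_inverse[OF s]
          show "restrict (inv_into L s) L ` Q \<in> ?S"
            using LL.prime_above_image[OF embeddingsD(1)[OF i] Q] embedding_image_below[OF i above_subset[OF Q]]
            by simp
        qed
        show "?S \<subseteq> (\<lambda>s. restrict (inv_into L s) L ` Q) ` ?H"
        proof
          fix Q' assume "Q' \<in> ?S"
          hence Q': "Q' \<in> primes_above_nat L q" "Q' \<inter> ints_of K = Q \<inter> ints_of K" by auto
          obtain s where s: "s \<in> ?H" "s ` Q' = Q" using embeddings_transitive[OF Q'(1) Q Q'(2)] by blast
          have "restrict (inv_into L s) L ` Q = inv_into L s ` (s ` Q')"
            unfolding s(2) using above_subset[OF Q] by (intro image_cong) auto
          also have "\<dots> = Q'" by (rule inv_image(1)[OF embeddingsD(1)[OF s(1)] above_subset[OF Q'(1)]])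
          finally show "Q' \<in> (\<lambda>s. restrict (inv_into L s) L ` Q) ` ?H" using s(1) by blast
        qed
      qed
    qed
  qed
  finally show ?thesis .
qed

lemma ideal_exponent_I_part:
  assumes x: "x \<in> L" "x \<noteq> 0"
  shows "ideal_exponent K (I_part K L q x) P =
    (\<Sum>Q | Q \<in> primes_above_nat L q \<and> Q \<inter> ints_of K = P. LL.val Q x)"
proof -
  let ?S = "primes_above_nat L q"
  have fin: "finite ?S" by (rule LL.finite_primes_above_nat[OF prime_gt_0_nat[OF q]])
  note SP = LL.primes_above_natD(1)
  have J: "ideal_exponent L (J_part L q x) R = (if R \<in> ?S then LL.val R x else 0)" for R
  proof -
    have fr: "fractional_ideal L (Q [^]\<^bsub>ideal_group L\<^esub> LL.val Q x)" if "Q \<in> ?S" for Q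
      using LL.prime_int_pow_closed[OF SP[OF that]] by simp
    have "ideal_exponent L (J_part L q x) R = (\<Sum>Q\<in>?S. ideal_exponent L (Q [^]\<^bsub>ideal_group L\<^esub> LL.val Q x) R)"
      unfolding J_part_def LL.val_def[symmetric] by (rule LL.ideal_exponent_finprod(1)[OF fr fin])
    also have "\<dots> = (\<Sum>Q\<in>?S. if Q = R then LL.val Q x else 0)"
      using LL.ideal_exponent_int_pow[OF LL.fractional_prime[OF SP]] LL.ideal_exponent_prime[OF SP]
      by (intro sum.cong) auto
    finally show ?thesis using fin by simp
  qed
  define T where "T = {Q \<in> prime_ideals L. ideal_exponent L (J_part L q x) Q \<noteq> 0}"
  have T: "T \<subseteq> ?S" "finite T" using fin by (auto simp: T_def J intro: finite_subset[of _ ?S])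
  have res: "residue_degree K L Q = 1" if Q: "Q \<in> ?S" for Q
  proof (rule LL.residue_degree_one[OF SP[OF Q]])
    show "\<exists>c::int. a - of_int c \<in> Q" if a: "a \<in> ints_of L" for a
      by (rule LL.split_residue_int[OF q split Q a]) blast
    show "\<int> \<subseteq> ints_of K" using KK.O_Ints by blast
  qed (rule K_ints)
  define e where "e = (\<lambda>Q. int (residue_degree K L Q) * ideal_exponent L (J_part L q x) Q)"
  have e: "e Q = LL.val Q x" if "Q \<in> ?S" for Q using that by (simp add: e_def res J)
  have fr: "fractional_ideal K ((Q \<inter> ints_of K) [^]\<^bsub>ideal_group K\<^esub> e Q)" if "Q \<in> T" for Q
    using KK.prime_int_pow_closed[OF prime_below[OF SP]] that T(1) by auto
  have "ideal_exponent K (I_part K L q x) P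
      = (\<Sum>Q\<in>T. ideal_exponent K ((Q \<inter> ints_of K) [^]\<^bsub>ideal_group K\<^esub> e Q) P)"
    unfolding I_part_def ideal_norm_def T_def[symmetric] e_def[symmetric]
    using KK.ideal_exponent_finprod(1)[OF fr T(2)] by (simp add: e_def)
  also have "\<dots> = (\<Sum>Q\<in>T. if Q \<inter> ints_of K = P then LL.val Q x else 0)"
  proof (rule sum.cong)
    fix Q assume "Q \<in> T"
    hence Q: "Q \<in> ?S" using T(1) by auto
    note B = prime_below[OF SP[OF Q]]
    show "ideal_exponent K ((Q \<inter> ints_of K) [^]\<^bsub>ideal_group K\<^esub> e Q) P
        = (if Q \<inter> ints_of K = P then LL.val Q x else 0)"
      using KK.ideal_exponent_int_pow[OF KK.fractional_prime[OF B], of "e Q" P] KK.ideal_exponent_prime[OF B, of P]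
      by (auto simp: e[OF Q])
  qed simp
  \<comment> \<open>The ideal norm ranges over the support \<open>T\<close> of the
    \<open>q\<close>-part; the remaining primes above \<open>q\<close> have valuation 0 and may be
    added.\<close>
  also have "\<dots> = (\<Sum>Q\<in>?S. if Q \<inter> ints_of K = P then LL.val Q x else 0)"
    by (rule sum.mono_neutral_left[OF fin T(1)]) (auto simp: T_def J dest: SP)
  also have "\<dots> = (\<Sum>Q | Q \<in> ?S \<and> Q \<inter> ints_of K = P. LL.val Q x)"
    using fin by (simp add: sum.If_cases Int_def)
  finally show ?thesis .
qed

lemma chi_eq_val:
  assumes num: "prime_numbering p K (restrict \<sigma> K) q P" and x: "x \<in> L" "x \<noteq> 0"
    and u: "u \<in> L" "u ^ p = 1" and p2: "p > 2"
  obtains Q where "LL.val Q (Phi p e \<sigma> (u * field_norm K L x)) = chi p e K P (I_part K L q x)"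
proof -
  define b where "b = (\<lambda>j. ideal_exponent K (I_part K L q x) (P j))"
  define y where "y = field_norm K L x"
  have mem: "P k \<in> primes_above_nat K q" if "k \<in> {1..p - 1}" for k
    using num that by (auto simp: prime_numbering_def bij_betw_def)
  have PK: "P k \<subseteq> K" if "k \<in> {1..p - 1}" for k
    using KK.primeD(2)[OF KK.primes_above_natD(1)[OF mem[OF that]]] KK.O_subset by blast
  note sL = LL.aut_funpow[OF \<sigma>(1)] and sK = KK.aut_funpow[OF \<sigma>_K]
  have sx: "s x \<in> L \<and> s x \<noteq> 0" if "s \<in> embeddings K L" for s
    using LL.aut_closed[OF embeddingsD(1)[OF that]] LL.aut_nonzero[OF embeddingsD(1)[OF that]] x by blast
  have y: "y \<in> L" "y \<noteq> 0"
    unfolding y_def field_norm_def using sx finite_embeddings by (auto intro!: LL.L_prod)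
  have u0: "u \<noteq> 0" using u(2) p2 by (auto simp: power_0_left)
  \<comment> \<open>A prime over \<open>P 1\<close> is found without a lying-over theorem: any prime
    above \<open>q\<close> lies over some \<open>P j\<close>, and \<open>\<sigma> ^^ (p - j)\<close>
    moves it over \<open>P 1\<close>.\<close>
  obtain Q0 where Q0: "Q0 \<in> primes_above_nat L q" "Q0 \<inter> ints_of K = P 1"
  proof -
    obtain R where R: "R \<in> primes_above_nat L q" using primes_above_nonempty by blast
    have "R \<inter> ints_of K \<in> P ` {1..p - 1}"
      using prime_above_nat_below[OF R] num by (auto simp: prime_numbering_def bij_betw_def)
    then obtain j where j: "1 \<le> j" "j \<le> p - 1" "R \<inter> ints_of K = P j" by auto
    have "(\<sigma> ^^ (p - j)) ` R \<inter> ints_of K = (\<sigma> ^^ (p - j)) ` (R \<inter> ints_of K)"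
      by (rule image_below[OF sL sK above_subset[OF R]])
    also have "\<dots> = P 1" unfolding j(3) by (rule funpow_image_numbering(2)[OF num j(1,2)])
    finally show ?thesis using that LL.prime_above_image[OF sL R] by blast
  qed
  \<comment> \<open>The preimage of \<open>Q0\<close> under \<open>\<sigma> ^^ j\<close> lies over
    the prime \<open>j\<close> places before \<open>P 1\<close> in a cycle of length
    \<open>p - 1\<close>, which is \<open>P (p - j)\<close>. For \<open>j = 0\<close> this index
    would be \<open>p\<close>, outside the range, so it is replaced by 1.\<close>
  have val: "LL.val Q0 ((\<sigma> ^^ j) y) = b (if j = 0 then 1 else p - j)" if j: "j \<le> p - 2" for j
  proof -
    define m where "m = (if j = 0 then 1 else p - j)"
    have m: "m \<in> {1..p - 1}" using j p2 by (auto simp: m_def)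
    have sm: "(\<sigma> ^^ j) ` P m = P 1"
    proof (cases "j = 0")
      case False
      hence "p - m = j" using j p2 by (simp add: m_def)
      thus ?thesis using funpow_image_numbering(2)[OF num, of m] m by auto
    qed (simp add: m_def)
    define R where "R = inv_into L (\<sigma> ^^ j) ` Q0"
    have R: "R \<in> primes_above_nat L q"
      unfolding R_def by (rule LL.prime_above_image[OF LL.aut_inv[OF sL] Q0(1)])
    have sR: "(\<sigma> ^^ j) ` R = Q0" unfolding R_def by (rule inv_image(2)[OF sL above_subset[OF Q0(1)]])
    have "(\<sigma> ^^ j) ` (R \<inter> ints_of K) = (\<sigma> ^^ j) ` P m"
      using image_below[OF sL sK above_subset[OF R], of j] sR Q0(2) sm by simp
    moreover have "R \<inter> ints_of K \<subseteq> L" "P m \<subseteq> L" using above_subset[OF R] PK[OF m] inclusions(2) by auto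
    ultimately have RP: "R \<inter> ints_of K = P m" using inj_on_image_eq_iff[OF LL.aut_inj[OF sL]] by blast
    have "LL.val Q0 ((\<sigma> ^^ j) y) = LL.val R y"
      using LL.val_image[OF sL y LL.primes_above_natD(1)[OF R], of j] by (simp only: sR)
    also have "\<dots> = b m"
      unfolding y_def b_def ideal_exponent_I_part[OF x] val_norm[OF R x] RP ..
    finally show ?thesis by (simp add: m_def)
  qed
  have valu: "LL.val Q0 ((\<sigma> ^^ j) (u * y)) = LL.val Q0 ((\<sigma> ^^ j) y)" for j
  proof -
    have "(\<sigma> ^^ j) u ^ p = 1"
      using LL.aut_power[OF sL u(1), of j p] LL.aut_1[OF sL, of j] u(2) by simp
    hence "LL.val Q0 ((\<sigma> ^^ j) u) = 0"
      using LL.val_root_of_unity[OF LL.aut_closed[OF sL u(1)]] p2 by simp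
    thus ?thesis
      using LL.aut_mult[OF sL u(1) y(1), of j] LL.aut_closed[OF sL] LL.aut_nonzero[OF sL] u(1) u0 y
      by (simp add: LL.val_mult)
  qed
  have uy: "(\<sigma> ^^ j) (u * y) \<in> L" "(\<sigma> ^^ j) (u * y) \<noteq> 0" for j
    using LL.aut_closed[OF sL] LL.aut_nonzero[OF sL] LL.L_mult u(1) u0 y by auto
  have "LL.val Q0 (Phi p e \<sigma> (u * y)) = (\<Sum>j=0..p-2. LL.val Q0 (((\<sigma> ^^ j) (u * y)) ^ (e ^ (p - 2 - j))))"
    unfolding Phi_def using uy by (intro LL.val_prod) (auto intro: LL.L_power)
  also have "\<dots> = (\<Sum>j=0..p-2. int e ^ (p - 2 - j) * b (if j = 0 then 1 else p - j))"
    using uy by (intro sum.cong) (auto simp: LL.val_power valu val)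
  also have "\<dots> = int e ^ (p - 2) * b 1 + (\<Sum>j=1..p-2. int e ^ (p - 2 - j) * b (p - j))"
    by (simp add: sum.atLeast_Suc_atMost numeral_2_eq_2)
  \<comment> \<open>The substitution \<open>k = p - j\<close> turns the exponent
    \<open>p - 2 - j\<close> into \<open>k - 2\<close>, as in \<open>chi\<close>.\<close>
  also have "(\<Sum>j=1..p-2. int e ^ (p - 2 - j) * b (p - j)) = (\<Sum>k=2..p-1. int e ^ (k - 2) * b k)"
    by (rule sum.reindex_bij_witness[of _ "\<lambda>k. p - k" "\<lambda>j. p - j"]) (use p2 in auto)
  finally have "LL.val Q0 (Phi p e \<sigma> (u * y)) = chi p e K P (I_part K L q x)"
    by (simp add: chi_def b_def)
  thus ?thesis using that by (simp add: y_def)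
qed

text \<open>The factor \<open>u\<close> allows both claims to be treated at once, with
  \<open>u = 1\<close> and \<open>u = \<zeta>\<close>.\<close>

lemma Phi_not_power:
  assumes num: "prime_numbering p K (restrict \<sigma> K) q P" and x: "x \<in> L" "x \<noteq> 0"
    and u: "u \<in> L" "u ^ p = 1" and p2: "p > 2"
    and nd: "\<not> int p dvd chi p e K P (I_part K L q x)"
  shows "Phi p e \<sigma> (u * field_norm K L x) \<notin> nonzero_powers L p"
proof
  assume "Phi p e \<sigma> (u * field_norm K L x) \<in> nonzero_powers L p"
  then obtain z where z: "z \<in> L" "z \<noteq> 0" "Phi p e \<sigma> (u * field_norm K L x) = z ^ p"
    by (auto simp: nonzero_powers_def)
  obtain Q where "LL.val Q (Phi p e \<sigma> (u * field_norm K L x)) = chi p e K P (I_part K L q x)"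
    using chi_eq_val[OF num x u p2] by blast
  hence "chi p e K P (I_part K L q x) = int p * LL.val Q z"
    using LL.val_power[OF z(1,2), of Q p] z(3) by simp
  thus False using nd by simp
qed

end

end

theorem corollary3p2:
  fixes p e n :: nat
    and F K L :: "complex set"
    and \<zeta> x :: complex
    and \<sigma> :: "complex \<Rightarrow> complex"
    and q :: "nat \<Rightarrow> nat"
    and l :: "nat \<Rightarrow> int"
  assumes p: "prime p" "odd p"
    and F: "cyclic_ext \<rat> F" "degree_ext \<rat> F = p"
    and \<zeta>: "primitive_root_of_unity p \<zeta>"
    and K: "K = generate_field complex_ring (\<rat> \<union> {\<zeta>})"
    and L: "L = generate_field complex_ring (F \<union> K)"
    and \<sigma>: "\<sigma> \<in> carrier (gal_group F L)"
           "subgroup_generated (gal_group F L) {\<sigma>} = gal_group F L"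
    and e: "residue_primroot p e"
    and x: "x \<in> L - {0}"
    and n: "n \<ge> 1"
    and q: "inj_on q {1..n}" "\<forall>i\<in>{1..n}. prime (q i)"
    and l: "\<forall>i\<in>{1..n}. l i \<noteq> 0"
    and norm: "field_norm \<rat> L x = (\<Prod>i=1..n. of_nat (q i) powi l i) \<or>
               field_norm \<rat> L x = - (\<Prod>i=1..n. of_nat (q i) powi l i)"
    and split: "\<exists>i\<in>{1..n}. splits_completely L (q i) \<and>
                  (\<exists>P. prime_numbering p K (restrict \<sigma> K) (q i) P \<and>
                       \<not> int p dvd chi p e K P (I_part K L (q i) x))"
  shows "Phi p e \<sigma> (field_norm K L x) \<notin> nonzero_powers L p \<and>
         Phi p e \<sigma> (\<zeta> * field_norm K L x) \<notin> nonzero_powers L p"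
proof -
  have p2: "p > 2" using p prime_ge_2_nat[OF p(1)] by (cases "p = 2") auto
  have galF: "finite_galois_ext \<rat> F" using F(1) by (simp add: cyclic_ext_def)
  hence Fs: "subfield F complex_ring" "cx.finite_dimension \<rat> F"
    "{y \<in> F. \<forall>s\<in>carrier (gal_group \<rat> F). s y = y} = \<rat>"
    by (auto simp: finite_galois_ext_def)
  obtain BF where BF: "finite BF" "F \<subseteq> qv.span BF" using finite_dimension_span[OF Fs(2)] by blast
  interpret FF: number_field F BF by (rule number_field.intro[OF Fs(1) BF])
  have \<zeta>p: "\<zeta> ^ p = 1" "p > 0" using \<zeta> p2 by (auto simp: primitive_root_of_unity_def)
  note A = FF.adjoin_root_of_unity[OF \<zeta>p]
  have Ls: "subfield L complex_ring" unfolding L by (rule generate_field_subfield)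
  have "\<rat> \<subseteq> FF.adjoin \<zeta>" using A(2) FF.L_Rats by blast
  hence "K \<subseteq> FF.adjoin \<zeta>" unfolding K using A(3) by (intro generate_field_least A(1)) auto
  hence "L \<subseteq> FF.adjoin \<zeta>" unfolding L using A(2) by (intro generate_field_least A(1)) auto
  hence Lspan: "L \<subseteq> qv.span ((\<lambda>(b, i). b * \<zeta> ^ i) ` (BF \<times> {..<p}))" using A(4) by blast
  \<comment> \<open>The products \<open>b * \<zeta> ^ i\<close> serve only to show finite dimension.
    Comparison with the number of primes needs a spanning set with at most
    \<open>degree_ext \<rat> L\<close> elements, which finite dimension then provides.\<close>
  have "cx.finite_dimension \<rat> L"
    by (rule finite_dimension_if_span[OF Ls _ Lspan]) (simp add: BF)
  then obtain B where B: "finite B" "card B \<le> degree_ext \<rat> L" "L \<subseteq> qv.span B"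
    using finite_dimension_span by blast
  interpret LL: number_field L B by (rule number_field.intro[OF Ls B(1,3)])
  obtain i P where i: "i \<in> {1..n}" "splits_completely L (q i)"
    and num: "prime_numbering p K (restrict \<sigma> K) (q i) P"
    and nd: "\<not> int p dvd chi p e K P (I_part K L (q i) x)"
    using split by blast
  interpret base: cyclotomic_base F BF L B p \<zeta> K \<sigma>
    by unfold_locales (use p \<zeta> K L LL.gal_group_automorphism[OF \<sigma>(1)] in auto)
  interpret cyclotomic_compositum F BF L B p \<zeta> K \<sigma>
  proof unfold_locales
    show "y \<in> \<rat>" if y: "y \<in> F" "\<And>t. FF.automorphism t \<Longrightarrow> t y = y" for y
      using Fs(3) y FF.gal_group_automorphism(1) by blast
    show "inj_on (\<lambda>j. (\<sigma> ^^ j) \<zeta>) {..<p - 1}" by (rule base.orbit_if_numbering[OF num])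
  qed
  have card: "card (primes_above_nat L (q i)) \<ge> card B"
    using i(2) B(2) by (simp add: splits_completely_def)
  have qi: "prime (q i)" using q(2) i(1) by blast
  have xL: "x \<in> L" "x \<noteq> 0" using x by auto
  note * = Phi_not_power[OF qi card num xL _ _ p2 nd]
  show ?thesis using *[of 1] *[of \<zeta>] LL.L_1 base.inclusions(5) \<zeta>p(1) by simp
qed

end
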